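(* Let $\mathcal A$ and $\mathcal B$ be finite structures with the same domain (each with a finite signature possibly containing both operation and relation symbols). Suppose that the clone generated by the basic operations of the algebraic reduct of $\mathcal A$ equals the clone generated by the basic operations of the algebraic reduct of $\mathcal B$, and that the relational reduct of $\mathcal A$ and the relational reduct of $\mathcal B$ have exactly the same partial polymorphisms. Then $\mathrm{CSP}(\mathcal A)$ and $\mathrm{CSP}(\mathcal B)$ are equivalent under polynomial-time many-one reductions. (In other words, the complexity of $\mathrm{CSP}(\mathcal A)$ depends only on the clone generated by the basic operations of the algebraic reduct of $\mathcal A$ together with the set of partial polymorphisms of the relational reduct of $\mathcal A$.)
   Context: A structure $\mathcal A$ with signature $S$ consists of a domain $A$ and interpretations of the operation symbols of $S$ as operations on $A$ and of the relation symbols as relations on $A$ (of matching arities). The algebraic reduct keeps only the operations; the relational reduct keeps only the relations. A homomorphism $h:\mathcal X\to\mathcal A$ between $S$-structures is a map with $h(f^{\mathcal X}(a_1,\dots,a_k))=f^{\mathcal A}(h(a_1),\dots,h(a_k))$ for every operation symbol $f$ and $(h(a_1),\dots,h(a_k))\in R^{\mathcal A}$ whenever $(a_1,\dots,a_k)\in R^{\mathcal X}$, for every relation symbol $R$. $\mathrm{CSP}(\mathcal A)$ is the decision problem: given a finite $S$-structure $\mathcal X$, decide whether there is a homomorphism $\mathcal X\to\mathcal A$. The clone generated by a set of operations on $A$ is the set of all operations obtainable from them and projections by composition (term operations). A partial operation $h:A^n\rightharpoonup A$ is a partial polymorphism of a relational structure if for every relation $R$ and tuples $t_1,\dots,t_n\in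 R$, whenever $h(t_1,\dots,t_n)$ (computed coordinatewise) is defined, it lies in $R$. *)

theory Defs
  imports "HOL-Computational_Algebra.Polynomial" "HOL-Library.FuncSet"
begin

section \<open>Structures and homomorphisms\<close>

text \<open>Symbols of a finite signature are positions in two lists of arities.  Arities may be 0 and
  domains may be empty, for templates and instances alike.\<close>

record signature =
  op_arities :: "nat list"
  rel_arities :: "nat list"

record 'a struct =
  universe :: "'a set"
  operations :: "('a list \<Rightarrow> 'a) list"
  relations :: "'a list set list"

definition tuples :: "'a set \<Rightarrow> nat \<Rightarrow> 'a list set" where
  "tuples D k = {xs. length xs = k \<and> set xs \<subseteq> D}"

definition is_structure :: "signature \<Rightarrow> 'a struct \<Rightarrow> bool" where
  "is_structure S A \<longleftrightarrow>
     length (operations A) = length (op_arities S) \<and>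
     length (relations A) = length (rel_arities S) \<and>
     (\<forall>i < length (op_arities S). \<forall>xs \<in> tuples (universe A) (op_arities S ! i).
        (operations A ! i) xs \<in> universe A) \<and>
     (\<forall>i < length (rel_arities S). relations A ! i \<subseteq> tuples (universe A) (rel_arities S ! i))"

definition is_hom :: "signature \<Rightarrow> 'a struct \<Rightarrow> 'b struct \<Rightarrow> ('a \<Rightarrow> 'b) \<Rightarrow> bool" where
  "is_hom S X A h \<longleftrightarrow>
     h \<in> universe X \<rightarrow> universe A \<and>
     (\<forall>i < length (op_arities S). \<forall>xs \<in> tuples (universe X) (op_arities S ! i).
        h ((operations X ! i) xs) = (operations A ! i) (map h xs)) \<and>
     (\<forall>i < length (rel_arities S). \<forall>xs \<in> relations X ! i. map h xs \<in> relations A ! i)"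

section \<open>Clones and partial polymorphisms\<close>

definition basic_operations :: "signature \<Rightarrow> 'a struct \<Rightarrow> (nat \<times> ('a list \<Rightarrow> 'a)) set" where
  "basic_operations S A = set (zip (op_arities S) (operations A))"

definition basic_relations :: "signature \<Rightarrow> 'a struct \<Rightarrow> (nat \<times> 'a list set) set" where
  "basic_relations S A = set (zip (rel_arities S) (relations A))"

text \<open>An operation of arity \<open>n\<close> on \<open>D\<close> is a pair \<open>(n, f)\<close> with \<open>f\<close> extensional on
  \<open>tuples D n\<close>, so that equality of pairs is equality of operations.\<close>

inductive_set clone :: "'a set \<Rightarrow> (nat \<times> ('a list \<Rightarrow> 'a)) set \<Rightarrow> (nat \<times> ('a list \<Rightarrow> 'a)) set"
  for D :: "'a set" and F :: "(nat \<times> ('a list \<Rightarrow> 'a)) set"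
where
  basic: "(n, f) \<in> F \<Longrightarrow> (n, restrict f (tuples D n)) \<in> clone D F"
| proj: "i < n \<Longrightarrow> (n, \<lambda>xs \<in> tuples D n. xs ! i) \<in> clone D F"
| comp: "\<lbrakk>(length gs, f) \<in> clone D F; \<forall>g \<in> set gs. (n, g) \<in> clone D F\<rbrakk>
    \<Longrightarrow> (n, \<lambda>xs \<in> tuples D n. f (map (\<lambda>g. g xs) gs)) \<in> clone D F"

text \<open>A partial operation of arity \<open>n\<close> is a pair \<open>(n, h)\<close>; the arity \<open>n = 0\<close> is included.  A nullary
  total operation preserves \<open>R\<close> iff \<open>R\<close> contains the corresponding constant tuple, so this is what
  tells an empty relation from the absence of a relation.\<close>

definition partial_operations :: "'a set \<Rightarrow> (nat \<times> ('a list \<Rightarrow> 'a option)) set" where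
  "partial_operations D = {(n, h). dom h \<subseteq> tuples D n \<and> ran h \<subseteq> D}"

definition preserves :: "nat \<times> ('a list \<Rightarrow> 'a option) \<Rightarrow> nat \<times> 'a list set \<Rightarrow> bool" where
  "preserves = (\<lambda>(n, h) (k, R).
     \<forall>ts. length ts = n \<and> set ts \<subseteq> R \<and> (\<forall>j < k. map (\<lambda>t. t ! j) ts \<in> dom h)
       \<longrightarrow> map (\<lambda>j. the (h (map (\<lambda>t. t ! j) ts))) [0..<k] \<in> R)"

definition partial_polymorphisms ::
    "'a set \<Rightarrow> (nat \<times> 'a list set) set \<Rightarrow> (nat \<times> ('a list \<Rightarrow> 'a option)) set" where
  "partial_polymorphisms D \<Gamma> = {p \<in> partial_operations D. \<forall>r \<in> \<Gamma>. preserves p r}"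

section \<open>Polynomial-time computable functions\<close>

text \<open>Deterministic multi-tape Turing machines with two-way infinite tapes.  States are
  \<open>0, \<dots>, num_states - 1\<close>, tape symbols are \<open>0, \<dots>, num_symbols - 1\<close>.  Symbol 0 is the blank;
  symbols 1 and 2 are the bits of input and output words.\<close>

datatype head_move = MoveLeft | Stay | MoveRight

record tm =
  num_tapes :: nat
  num_states :: nat
  num_symbols :: nat
  start_state :: nat
  halt_state :: nat
  transition :: "nat \<Rightarrow> nat list \<Rightarrow> nat \<times> (nat \<times> head_move) list"

definition is_tm :: "tm \<Rightarrow> bool" where
  "is_tm M \<longleftrightarrow>
     num_tapes M \<ge> 1 \<and> num_symbols M \<ge> 3 \<and>
     start_state M < num_states M \<and> halt_state M < num_states M \<and>
     (\<forall>q < num_states M. \<forall>ss \<in> tuples {..<num_symbols M} (num_tapes M).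
        case transition M q ss of (q', acts) \<Rightarrow>
          q' < num_states M \<and> map fst acts \<in> tuples {..<num_symbols M} (num_tapes M))"

type_synonym tape = "(int \<Rightarrow> nat) \<times> int"
type_synonym config = "nat \<times> tape list"

definition read_tape :: "tape \<Rightarrow> nat" where
  "read_tape = (\<lambda>(c, p). c p)"

fun act_tape :: "nat \<times> head_move \<Rightarrow> tape \<Rightarrow> tape" where
  "act_tape (s, m) (c, p) =
     (c(p := s), case m of MoveLeft \<Rightarrow> p - 1 | Stay \<Rightarrow> p | MoveRight \<Rightarrow> p + 1)"

definition tm_step :: "tm \<Rightarrow> config \<Rightarrow> config" where
  "tm_step M = (\<lambda>(q, ts).
     if q = halt_state M then (q, ts)
     else case transition M q (map read_tape ts) of (q', acts) \<Rightarrow> (q', map2 act_tape acts ts))"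

definition bit_symbol :: "bool \<Rightarrow> nat" where
  "bit_symbol b = (if b then 2 else 1)"

definition word_tape :: "bool list \<Rightarrow> tape" where
  "word_tape w =
     (\<lambda>i. if 0 \<le> i \<and> nat i < length w then bit_symbol (w ! nat i) else 0, 0)"

definition initial_config :: "tm \<Rightarrow> bool list \<Rightarrow> config" where
  "initial_config M w = (start_state M, word_tape w # replicate (num_tapes M - 1) (word_tape []))"

text \<open>The output word extends from the head of the first tape up to the next blank.\<close>

definition tape_output :: "tape \<Rightarrow> bool list \<Rightarrow> bool" where
  "tape_output = (\<lambda>(c, p) w.
     (\<forall>i < length w. c (p + int i) = bit_symbol (w ! i)) \<and> c (p + int (length w)) = 0)"

definition tm_computes_within :: "tm \<Rightarrow> bool list \<Rightarrow> bool list \<Rightarrow> nat \<Rightarrow> bool" where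
  "tm_computes_within M w v t \<longleftrightarrow>
     (\<exists>t' \<le> t. \<exists>ts. (tm_step M ^^ t') (initial_config M w) = (halt_state M, ts) \<and>
        tape_output (hd ts) v)"

definition polytime_computable :: "(bool list \<Rightarrow> bool list) \<Rightarrow> bool" where
  "polytime_computable f \<longleftrightarrow>
     (\<exists>M. is_tm M \<and> (\<exists>p :: nat poly. \<forall>w. tm_computes_within M w (f w) (poly p (length w))))"

section \<open>Decision problems and reductions\<close>

text \<open>Instances are kept apart from arbitrary words: a reduction has to send instances to instances,
  so a no-instance cannot be mapped to a word that encodes nothing.\<close>

record decision_problem =
  instances :: "bool list set"
  yes_instances :: "bool list set"

definition polytime_reducible :: "decision_problem \<Rightarrow> decision_problem \<Rightarrow> bool" where
  "polytime_reducible P Q \<longleftrightarrow>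
     (\<exists>f. polytime_computable f \<and>
        (\<forall>w \<in> instances P. f w \<in> instances Q \<and> (w \<in> yes_instances P \<longleftrightarrow> f w \<in> yes_instances Q)))"

definition polytime_equivalent :: "decision_problem \<Rightarrow> decision_problem \<Rightarrow> bool" where
  "polytime_equivalent P Q \<longleftrightarrow> polytime_reducible P Q \<and> polytime_reducible Q P"

section \<open>The constraint satisfaction problem\<close>

text \<open>A finite structure with domain \<open>{0, \<dots>, n - 1}\<close> is encoded as \<open>n\<close>, followed by the value table
  of each operation and the characteristic table of each relation, tables being listed in
  lexicographic order of the argument tuples and domain elements being written in unary.  For a
  fixed signature the length is polynomial in \<open>n\<close>.\<close>

definition encode_nat :: "nat \<Rightarrow> bool list" where
  "encode_nat n = replicate n True @ [False]"

definition all_tuples :: "nat \<Rightarrow> nat \<Rightarrow> nat list list" where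
  "all_tuples n k = product_lists (replicate k [0..<n])"

definition encode_operation :: "nat \<Rightarrow> nat \<times> (nat list \<Rightarrow> nat) \<Rightarrow> bool list" where
  "encode_operation n = (\<lambda>(k, f). concat (map (\<lambda>xs. encode_nat (f xs)) (all_tuples n k)))"

definition encode_relation :: "nat \<Rightarrow> nat \<times> nat list set \<Rightarrow> bool list" where
  "encode_relation n = (\<lambda>(k, R). map (\<lambda>xs. xs \<in> R) (all_tuples n k))"

definition encode_structure :: "signature \<Rightarrow> nat struct \<Rightarrow> bool list" where
  "encode_structure S X = (let n = card (universe X) in
     encode_nat n @
     concat (map (encode_operation n) (zip (op_arities S) (operations X))) @
     concat (map (encode_relation n) (zip (rel_arities S) (relations X))))"

definition finite_structures :: "signature \<Rightarrow> nat struct set" where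
  "finite_structures S = {X. is_structure S X \<and> (\<exists>n. universe X = {..<n})}"

definition CSP :: "signature \<Rightarrow> 'a struct \<Rightarrow> decision_problem" where
  "CSP S A = \<lparr>
     instances = encode_structure S ` finite_structures S,
     yes_instances = encode_structure S ` {X \<in> finite_structures S. \<exists>h. is_hom S X A h}\<rparr>"

end

theory Submission
  imports Defs
begin

text \<open>Equality of the clones makes every basic operation of one algebra a term operation of the
  other.  Equality of the partial polymorphisms makes every basic relation of one structure the
  conjunction of those atoms over the other (equalities included) that it implies: any tuple
  satisfying them all is the image of the enumerated relation under a partial polymorphism.

  An instance \<open>X\<close> of \<open>CSP(A)\<close> is therefore mapped to the structure that has the translated terms as
  operations and the implied atoms as relations, where elements are identified along the congruence
  generated by the implied equalities and by the pairs that equate each basic operation with its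
  double translation.  Every homomorphism to \<open>A\<close> contains this congruence in its kernel.  The universe
  is kept: operations return least representatives and relations are saturated under the
  congruence, so no renumbering of classes is needed.

  For polynomial time, structured programs over tapes are compiled to Turing machines.  A number is
  the head position on a tape containing a word of length \<open>n\<close>, so that it never exceeds the length
  of the input and loops are polynomially bounded; operations and relations are stored as bit tables,
  on which first-order formulas are evaluated by exhaustive scanning.  The congruence is reached by
  \<open>n\<^sup>2\<close> rounds of adding pairs.\<close>

section \<open>Programs on Turing machines\<close>

text \<open>What the partial polymorphisms determine is definability without quantifiers. This
  matters: an existential quantifier would add elements to the instance, and the operations would
  have to be given values on them. Without quantifiers the domain can stay as it is. The remaining
  obstacle is that an instance is an arbitrary algebra and need not satisfy the identities of the
  template. Writing an operation as a term over the other signature and translating back gives the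
  same operation on A, but in general another one on \<open>X\<close>, and the target only sees the
  latter. Identifying the two is harmless because every homomorphism does so anyway. Implied
  equalities must be imposed in the same way, since equality is not a relation symbol that the
  output could use. On the machine side, time bounds have to hold on every input word, whatever the
  tapes contain. Hence programs are described by total functions on memories, and their bounds
  depend only on word lengths that a loop cannot change.\<close>

datatype com =
    Act nat "nat \<Rightarrow> nat" head_move
  | Seq com com
  | Cond nat "nat \<Rightarrow> bool" com com
  | Loop nat "nat \<Rightarrow> bool" com

text \<open>The times are those of the compiled code: every test is one branch instruction, and a
  true branch or a loop body ends with one further jump, hence 2 against 1.\<close>

inductive exec :: "com \<Rightarrow> (nat \<Rightarrow> tape) \<Rightarrow> nat \<Rightarrow> (nat \<Rightarrow> tape) \<Rightarrow> bool" where
  exec_Act: "exec (Act i g m) ts 1 (ts(i := act_tape (g (read_tape (ts i)), m) (ts i)))"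
| exec_Seq: "\<lbrakk>exec c ts a ts'; exec d ts' b ts''\<rbrakk> \<Longrightarrow> exec (Seq c d) ts (a + b) ts''"
| exec_CondT: "\<lbrakk>P (read_tape (ts i)); exec c ts a ts'\<rbrakk> \<Longrightarrow> exec (Cond i P c d) ts (a + 2) ts'"
| exec_CondF: "\<lbrakk>\<not> P (read_tape (ts i)); exec d ts a ts'\<rbrakk> \<Longrightarrow> exec (Cond i P c d) ts (a + 1) ts'"
| exec_LoopT: "\<lbrakk>P (read_tape (ts i)); exec c ts a ts'; exec (Loop i P c) ts' b ts''\<rbrakk>
    \<Longrightarrow> exec (Loop i P c) ts (a + b + 2) ts''"
| exec_LoopF: "\<not> P (read_tape (ts i)) \<Longrightarrow> exec (Loop i P c) ts 1 ts"

text \<open>Symbols 3, 4, 5 serve as marked copies of the symbols 0, 1, 2.\<close>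

fun com_ok :: "com \<Rightarrow> bool" where
  "com_ok (Act i g m) \<longleftrightarrow> (\<forall>s < 6. g s < 6)"
| "com_ok (Seq c d) \<longleftrightarrow> com_ok c \<and> com_ok d"
| "com_ok (Cond i P c d) \<longleftrightarrow> com_ok c \<and> com_ok d"
| "com_ok (Loop i P c) \<longleftrightarrow> com_ok c"

fun tape_bound :: "com \<Rightarrow> nat" where
  "tape_bound (Act i g m) = Suc i"
| "tape_bound (Seq c d) = max (tape_bound c) (tape_bound d)"
| "tape_bound (Cond i P c d) = max (Suc i) (max (tape_bound c) (tape_bound d))"
| "tape_bound (Loop i P c) = max (Suc i) (tape_bound c)"

section \<open>Compilation of programs to machine code\<close>

datatype instr = IAct nat "nat \<Rightarrow> nat" head_move | IBranch nat "nat \<Rightarrow> bool" nat nat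

fun com_size :: "com \<Rightarrow> nat" where
  "com_size (Act i g m) = 1"
| "com_size (Seq c d) = com_size c + com_size d"
| "com_size (Cond i P c d) = com_size c + com_size d + 2"
| "com_size (Loop i P c) = com_size c + 2"

text \<open>\<open>p\<close> is the absolute address of the first instruction, and control leaves
  every fragment at \<open>p + com_size c\<close>. A branch with two equal targets serves as an
  unconditional jump.\<close>

fun compile :: "com \<Rightarrow> nat \<Rightarrow> instr list" where
  "compile (Act i g m) p = [IAct i g m]"
| "compile (Seq c d) p = compile c p @ compile d (p + com_size c)"
| "compile (Cond i P c d) p =
     [IBranch i P (p + 1) (p + com_size c + 2)] @ compile c (p + 1) @
     [IBranch i P (p + com_size c + com_size d + 2) (p + com_size c + com_size d + 2)] @
     compile d (p + com_size c + 2)"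
| "compile (Loop i P c) p =
     [IBranch i P (p + 1) (p + com_size c + 2)] @ compile c (p + 1) @ [IBranch i P p p]"

lemma length_compile [simp]: "length (compile c p) = com_size c"
  by (induction c arbitrary: p) auto

fun instr_ok :: "nat \<Rightarrow> nat \<Rightarrow> instr \<Rightarrow> bool" where
  "instr_ok K m (IAct i g d) \<longleftrightarrow> i < K \<and> (\<forall>s < 6. g s < 6)"
| "instr_ok K m (IBranch i P a b) \<longleftrightarrow> i < K \<and> a \<le> m \<and> b \<le> m"

lemma instr_ok_mono: "instr_ok K m x \<Longrightarrow> m \<le> m' \<Longrightarrow> instr_ok K m' x"
  by (cases x) auto

lemma compile_ok:
  "com_ok c \<Longrightarrow> tape_bound c \<le> K \<Longrightarrow> x \<in> set (compile c p) \<Longrightarrow> instr_ok K (p + com_size c) x"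
proof (induction c arbitrary: p)
  case (Seq c d)
  then show ?case
    by (fastforce intro: instr_ok_mono simp: add.assoc)
next
  case (Cond i P c d)
  have "x = IBranch i P (p + 1) (p + com_size c + 2) \<or> x \<in> set (compile c (p + 1)) \<or>
    x = IBranch i P (p + com_size c + com_size d + 2) (p + com_size c + com_size d + 2) \<or>
    x \<in> set (compile d (p + com_size c + 2))"
    using Cond.prems(3) by auto
  moreover have "instr_ok K (p + com_size (Cond i P c d)) x" if "x \<in> set (compile c (p + 1))"
    using Cond.IH(1)[OF _ _ that] Cond.prems by (auto elim: instr_ok_mono)
  moreover have "instr_ok K (p + com_size (Cond i P c d)) x"
    if "x \<in> set (compile d (p + com_size c + 2))"
    using Cond.IH(2)[OF _ _ that] Cond.prems by (auto elim: instr_ok_mono)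
  ultimately show ?case
    using Cond.prems by auto
next
  case (Loop i P c)
  have "x = IBranch i P (p + 1) (p + com_size c + 2) \<or> x \<in> set (compile c (p + 1)) \<or>
    x = IBranch i P p p"
    using Loop.prems(3) by auto
  moreover have "instr_ok K (p + com_size (Loop i P c)) x" if "x \<in> set (compile c (p + 1))"
    using Loop.IH[OF _ _ that] Loop.prems by (auto elim: instr_ok_mono)
  ultimately show ?case
    using Loop.prems by auto
qed auto

text \<open>The state is the program counter. Tapes that an instruction does not mention are
  rewritten with the symbol just read, so a step changes at most one tape.\<close>

definition machine :: "nat \<Rightarrow> instr list \<Rightarrow> tm" where
  "machine K code = \<lparr>num_tapes = K, num_states = Suc (length code), num_symbols = 6,
     start_state = 0, halt_state = length code,
     transition = (\<lambda>q ss. if q < length code then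
        (case code ! q of
           IAct i g m \<Rightarrow> (Suc q, map (\<lambda>j. if j = i then (g (ss ! j), m) else (ss ! j, Stay)) [0..<K])
         | IBranch i P a b \<Rightarrow> (if P (ss ! i) then a else b, map (\<lambda>j. (ss ! j, Stay)) [0..<K]))
        else (q, map (\<lambda>j. (ss ! j, Stay)) [0..<K]))\<rparr>"

lemma is_tm_machine:
  assumes "K \<ge> 1" and "\<forall>x \<in> set code. instr_ok K (length code) x"
  shows "is_tm (machine K code)"
proof -
  have "case transition (machine K code) q ss of (q', acts) \<Rightarrow>
          q' < Suc (length code) \<and> map fst acts \<in> tuples {..<6} K"
    if q: "q < Suc (length code)" and ss: "ss \<in> tuples {..<6} K" for q ss
  proof -
    have ss': "ss ! j < 6" if "j < K" for j
      using ss that nth_mem unfolding tuples_def by fastforce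
    show ?thesis
    proof (cases "q < length code")
      case True
      then have ok: "instr_ok K (length code) (code ! q)"
        using assms by auto
      show ?thesis
        using ok ss' True
        by (cases "code ! q") (auto simp: machine_def tuples_def)
    next
      case False
      then show ?thesis
        using q ss' by (auto simp: machine_def tuples_def)
    qed
  qed
  then show ?thesis
    using assms by (auto simp: is_tm_def machine_def)
qed

lemma act_tape_read: "act_tape (read_tape t, Stay) t = t"
  by (cases t) (auto simp: read_tape_def)

lemma machine_step_act:
  assumes "q < length code" "code ! q = IAct i g m" "i < K"
  shows "tm_step (machine K code) (q, map ts [0..<K]) =
    (Suc q, map (ts(i := act_tape (g (read_tape (ts i)), m) (ts i))) [0..<K])"
  using assms by (auto simp: tm_step_def machine_def act_tape_read intro!: nth_equalityI)

lemma machine_step_branch: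
  assumes "q < length code" "code ! q = IBranch i P a b" "i < K"
  shows "tm_step (machine K code) (q, map ts [0..<K]) =
    (if P (read_tape (ts i)) then a else b, map ts [0..<K])"
  using assms by (auto simp: tm_step_def machine_def act_tape_read intro!: nth_equalityI)

text \<open>The surrounding code \<open>pre\<close> and \<open>post\<close> is arbitrary because the
  induction descends to fragments; only the start address \<open>length pre\<close> ties a fragment
  to its place. After a loop body the jump returns to that same address, so the second induction
  hypothesis applies to the same splitting of the code.\<close>

lemma machine_exec:
  assumes "exec c ts t ts'" and "tape_bound c \<le> K" and "code = pre @ compile c (length pre) @ post"
  shows "(tm_step (machine K code) ^^ t) (length pre, map ts [0..<K]) =
    (length pre + com_size c, map ts' [0..<K])"
  using assms
proof (induction arbitrary: pre post rule: exec.induct)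
  case (exec_Act i g m ts)
  then show ?case
    using machine_step_act[of "length pre" code i g m K ts] by (simp add: nth_append)
next
  case (exec_Seq c ts a ts' d b ts'')
  have 1: "(tm_step (machine K code) ^^ a) (length pre, map ts [0..<K]) =
      (length pre + com_size c, map ts' [0..<K])"
    using exec_Seq.prems
    by (intro exec_Seq.IH(1)[where post = "compile d (length pre + com_size c) @ post"]) auto
  have 2: "(tm_step (machine K code) ^^ b) (length (pre @ compile c (length pre)), map ts' [0..<K]) =
      (length (pre @ compile c (length pre)) + com_size d, map ts'' [0..<K])"
    using exec_Seq.prems by (intro exec_Seq.IH(2)[where post = post]) auto
  show ?case
    unfolding add.commute[of a b] funpow_add o_apply 1 using 2 by (simp add: add.assoc)
next
  case (exec_CondT P ts i c a ts' d)
  let ?n = "length pre" let ?M = "machine K code"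
  let ?b = "IBranch i P (?n + 1) (?n + com_size c + 2)"
  let ?e = "?n + com_size c + com_size d + 2"
  have code: "code = (pre @ [?b]) @ compile c (length (pre @ [?b])) @
      (IBranch i P ?e ?e # compile d (?n + com_size c + 2) @ post)"
    using exec_CondT.prems by simp
  have i: "i < K" "tape_bound c \<le> K"
    using exec_CondT.prems by auto
  have 1: "tm_step ?M (?n, map ts [0..<K]) = (?n + 1, map ts [0..<K])"
    using machine_step_branch[of ?n code i P "?n + 1" "?n + com_size c + 2" K ts] i exec_CondT.hyps
    by (simp add: code nth_append)
  have 2: "(tm_step ?M ^^ a) (?n + 1, map ts [0..<K]) = (?n + 1 + com_size c, map ts' [0..<K])"
    using exec_CondT.IH[OF i(2) code] by simp
  have 3: "tm_step ?M (?n + 1 + com_size c, map ts' [0..<K]) = (?e, map ts' [0..<K])"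
    using machine_step_branch[of "?n + 1 + com_size c" code i P ?e ?e K ts'] i
    by (simp add: code nth_append)
  have "(tm_step ?M ^^ (a + 2)) (?n, map ts [0..<K]) =
      tm_step ?M ((tm_step ?M ^^ a) (tm_step ?M (?n, map ts [0..<K])))"
    by (simp add: funpow_swap1)
  then show ?case
    by (simp only: 1 2 3) simp
next
  case (exec_CondF P ts i d a ts' c)
  let ?n = "length pre" let ?M = "machine K code"
  let ?b = "IBranch i P (?n + 1) (?n + com_size c + 2)"
  let ?e = "?n + com_size c + com_size d + 2"
  let ?pre = "pre @ ?b # compile c (?n + 1) @ [IBranch i P ?e ?e]"
  have code: "code = ?pre @ compile d (length ?pre) @ post"
    using exec_CondF.prems by (simp add: add.assoc)
  have i: "i < K" "tape_bound d \<le> K"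
    using exec_CondF.prems by auto
  have 1: "tm_step ?M (?n, map ts [0..<K]) = (?n + com_size c + 2, map ts [0..<K])"
    using machine_step_branch[of ?n code i P "?n + 1" "?n + com_size c + 2" K ts] i exec_CondF.hyps
    by (simp add: code nth_append)
  have 2: "(tm_step ?M ^^ a) (?n + com_size c + 2, map ts [0..<K]) = (?e, map ts' [0..<K])"
    using exec_CondF.IH[OF i(2) code] by (simp add: algebra_simps)
  have "(tm_step ?M ^^ (a + 1)) (?n, map ts [0..<K]) =
      (tm_step ?M ^^ a) (tm_step ?M (?n, map ts [0..<K]))"
    by (simp add: funpow_swap1)
  then show ?case
    by (simp only: 1 2) simp
next
  case (exec_LoopT P ts i c a ts' b ts'')
  let ?n = "length pre" let ?M = "machine K code"
  let ?b = "IBranch i P (?n + 1) (?n + com_size c + 2)"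
  have code: "code = (pre @ [?b]) @ compile c (length (pre @ [?b])) @ (IBranch i P ?n ?n # post)"
    using exec_LoopT.prems by simp
  have i: "i < K" "tape_bound c \<le> K"
    using exec_LoopT.prems by auto
  have 1: "tm_step ?M (?n, map ts [0..<K]) = (?n + 1, map ts [0..<K])"
    using machine_step_branch[of ?n code i P "?n + 1" "?n + com_size c + 2" K ts] i exec_LoopT.hyps
    by (simp add: code nth_append)
  have 2: "(tm_step ?M ^^ a) (?n + 1, map ts [0..<K]) = (?n + 1 + com_size c, map ts' [0..<K])"
    using exec_LoopT.IH(1)[OF i(2) code] by simp
  have 3: "tm_step ?M (?n + 1 + com_size c, map ts' [0..<K]) = (?n, map ts' [0..<K])"
    using machine_step_branch[of "?n + 1 + com_size c" code i P ?n ?n K ts'] i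
    by (simp add: code nth_append)
  have 4: "(tm_step ?M ^^ b) (?n, map ts' [0..<K]) =
      (?n + com_size (Loop i P c), map ts'' [0..<K])"
    using exec_LoopT.IH(2)[OF exec_LoopT.prems] .
  have "(tm_step ?M ^^ (a + b + 2)) (?n, map ts [0..<K]) =
      (tm_step ?M ^^ b) (tm_step ?M ((tm_step ?M ^^ a) (tm_step ?M (?n, map ts [0..<K]))))"
    by (simp add: funpow_swap1 funpow_add[symmetric] add.commute
        flip: funpow_add[unfolded o_def fun_eq_iff, rule_format])
  then show ?case
    by (simp only: 1 2 3 4)
next
  case (exec_LoopF P ts i c)
  let ?n = "length pre"
  have "tm_step (machine K code) (?n, map ts [0..<K]) = (?n + com_size c + 2, map ts [0..<K])"
    using machine_step_branch[of ?n code i P "?n + 1" "?n + com_size c + 2" K ts] exec_LoopF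
    by (simp add: nth_append)
  then show ?case by simp
qed

lemma exec_tm_computes:
  assumes "com_ok c" and "exec c (\<lambda>i. if i = 0 then word_tape w else word_tape []) t ts"
    and "tape_output (ts 0) v" and "tape_bound c \<le> K" and "1 \<le> K"
  shows "tm_computes_within (machine K (compile c 0)) w v t"
proof -
  let ?ts = "\<lambda>i::nat. if i = 0 then word_tape w else word_tape []"
  have "word_tape w # replicate (K - 1) (word_tape []) = map ?ts [0..<K]"
    using assms(5) by (intro nth_equalityI) (auto simp: nth_Cons')
  then have init: "initial_config (machine K (compile c 0)) w = (0, map ?ts [0..<K])"
    by (simp add: initial_config_def machine_def)
  have "(tm_step (machine K (compile c 0)) ^^ t) (0, map ?ts [0..<K]) =
      (com_size c, map ts [0..<K])"
    using machine_exec[OF assms(2,4), of "compile c 0" "[]" "[]"] by simp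
  moreover have "hd (map ts [0..<K]) = ts 0"
    using assms(5) by (simp add: upt_conv_Cons)
  ultimately show ?thesis
    unfolding tm_computes_within_def init using assms(3)
    by (intro exI[of _ t] conjI exI[of _ "map ts [0..<K]"]) (auto simp: machine_def)
qed

lemma polytime_computableI:
  fixes p :: "nat poly"
  assumes "com_ok c"
    and "\<And>w. \<exists>t ts. t \<le> poly p (length w) \<and>
      exec c (\<lambda>i. if i = 0 then word_tape w else word_tape []) t ts \<and> tape_output (ts 0) (f w)"
  shows "polytime_computable f"
proof -
  define K where "K = Suc (tape_bound c)"
  have "is_tm (machine K (compile c 0))"
    using compile_ok[OF assms(1), of K _ 0] by (intro is_tm_machine) (auto simp: K_def)
  moreover have "tm_computes_within (machine K (compile c 0)) w (f w) (poly p (length w))" for w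
  proof -
    obtain t ts where t: "t \<le> poly p (length w)"
      "exec c (\<lambda>i. if i = 0 then word_tape w else word_tape []) t ts" "tape_output (ts 0) (f w)"
      using assms(2) by blast
    have "tm_computes_within (machine K (compile c 0)) w (f w) t"
      using exec_tm_computes[OF assms(1) t(2,3), of K] by (simp add: K_def)
    then show ?thesis
      unfolding tm_computes_within_def using t(1) order_trans by blast
  qed
  ultimately show ?thesis
    unfolding polytime_computable_def by blast
qed

section \<open>Words on tapes\<close>

text \<open>A memory gives the word and the head position on each tape.  The word is surrounded by blanks
  and may start at any cell \<open>r\<close>.\<close>

type_synonym mem = "nat \<Rightarrow> bool list \<times> nat"

definition tape_of :: "int \<Rightarrow> bool list \<times> nat \<Rightarrow> tape" where
  "tape_of r = (\<lambda>(u, h).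
     (\<lambda>j. if r \<le> j \<and> j < r + int (length u) then bit_symbol (u ! nat (j - r)) else 0, r + int h))"

definition tapes_of :: "(nat \<Rightarrow> int) \<Rightarrow> mem \<Rightarrow> nat \<Rightarrow> tape" where
  "tapes_of r s = (\<lambda>i. tape_of (r i) (s i))"

definition symb :: "bool list \<times> nat \<Rightarrow> nat" where
  "symb = (\<lambda>(u, h). if h < length u then bit_symbol (u ! h) else 0)"

text \<open>The head stands on the word or on the first blank behind it. A blank under the head thus
  means that the end of the word has been reached exactly.\<close>

definition wf_mem :: "mem \<Rightarrow> bool" where
  "wf_mem s \<longleftrightarrow> (\<forall>i. snd (s i) \<le> length (fst (s i)))"

lemma read_tape_of [simp]: "read_tape (tape_of r x) = symb x"
  by (cases x) (auto simp: read_tape_def tape_of_def symb_def)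

lemma tapes_of_apply [simp]: "tapes_of r s i = tape_of (r i) (s i)"
  by (simp add: tapes_of_def)

lemma tapes_of_upd: "tapes_of r (s(i := x)) = (tapes_of r s)(i := tape_of (r i) x)"
  by (auto simp: tapes_of_def)

lemma bit_symbol_simps [simp]: "bit_symbol b \<noteq> 0" "0 < bit_symbol b" "bit_symbol b < 3"
  "bit_symbol b < 6" "bit_symbol b = 2 \<longleftrightarrow> b" "bit_symbol b = bit_symbol b' \<longleftrightarrow> b = b'"
  by (auto simp: bit_symbol_def)

lemma symb_eq_0: "symb x = 0 \<longleftrightarrow> length (fst x) \<le> snd x"
  by (cases x) (auto simp: symb_def)

lemma symb_less_3 [simp]: "symb x < 3"
  by (cases x) (auto simp: symb_def)

lemma act_right: "act_tape (symb (u, h), MoveRight) (tape_of r (u, h)) = tape_of r (u, Suc h)"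
  by (auto simp: tape_of_def symb_def fun_eq_iff)

lemma act_put: "h < length u \<Longrightarrow>
    act_tape (bit_symbol b, Stay) (tape_of r (u, h)) = tape_of r (u[h := b], h)"
  by (auto simp: tape_of_def fun_eq_iff nth_list_update)

lemma act_app:
  "act_tape (bit_symbol b, MoveRight) (tape_of r (u, length u)) = tape_of r (u @ [b], Suc (length u))"
  by (auto simp: tape_of_def fun_eq_iff nth_append)

text \<open>All origins \<open>r\<close> are allowed because moving the input away leaves tape 0
  with a shifted origin. The bound on the growth of the words is recorded here because it is what
  makes the time polynomials of successive programs compose.\<close>

definition execs :: "com \<Rightarrow> mem \<Rightarrow> nat \<Rightarrow> mem \<Rightarrow> bool" where
  "execs c s t s' \<longleftrightarrow> (\<forall>r. exec c (tapes_of r s) t (tapes_of r s')) \<and> wf_mem s' \<and>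
     (\<forall>i. length (fst (s' i)) \<le> length (fst (s i)) + t)"

lemma execsI:
  assumes "\<And>r. exec c (tapes_of r s) t (tapes_of r s')" "wf_mem s'"
    and "\<And>i. length (fst (s' i)) \<le> length (fst (s i)) + t"
  shows "execs c s t s'"
  using assms by (simp add: execs_def)

lemma execsD:
  assumes "execs c s t s'"
  shows "exec c (tapes_of r s) t (tapes_of r s')" "wf_mem s'"
    and "length (fst (s' i)) \<le> length (fst (s i)) + t"
  using assms by (simp_all add: execs_def)

lemma execs_Act:
  assumes "\<And>r. act_tape (g (symb (s i)), m) (tape_of r (s i)) = tape_of r x" "wf_mem s"
    and "snd x \<le> length (fst x)" "length (fst x) \<le> Suc (length (fst (s i)))"
  shows "execs (Act i g m) s 1 (s(i := x))"
proof (rule execsI)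
  fix r
  show "exec (Act i g m) (tapes_of r s) 1 (tapes_of r (s(i := x)))"
    using exec_Act[of i g m "tapes_of r s"] by (simp add: assms(1) tapes_of_upd)
qed (use assms in \<open>auto simp: wf_mem_def\<close>)

lemma execs_Seq:
  assumes "execs c s a s'" "execs d s' b s''"
  shows "execs (Seq c d) s (a + b) s''"
proof (rule execsI)
  fix i
  show "length (fst (s'' i)) \<le> length (fst (s i)) + (a + b)"
    using execsD(3)[OF assms(1), of i] execsD(3)[OF assms(2), of i] by linarith
qed (use assms in \<open>auto intro: exec_Seq execsD\<close>)

lemma execs_CondT:
  assumes "P (symb (s i))" "execs c s a s'"
  shows "execs (Cond i P c d) s (a + 2) s'"
proof (rule execsI)
  fix j
  show "length (fst (s' j)) \<le> length (fst (s j)) + (a + 2)"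
    using execsD(3)[OF assms(2), of j] by linarith
  show "exec (Cond i P c d) (tapes_of r s) (a + 2) (tapes_of r s')" for r
    using assms(1) by (intro exec_CondT execsD(1)[OF assms(2)]) simp
qed (rule execsD(2)[OF assms(2)])

lemma execs_CondF:
  assumes "\<not> P (symb (s i))" "execs d s a s'"
  shows "execs (Cond i P c d) s (a + 1) s'"
proof (rule execsI)
  fix j
  show "length (fst (s' j)) \<le> length (fst (s j)) + (a + 1)"
    using execsD(3)[OF assms(2), of j] by linarith
  show "exec (Cond i P c d) (tapes_of r s) (a + 1) (tapes_of r s')" for r
    using assms(1) by (intro exec_CondF execsD(1)[OF assms(2)]) simp
qed (rule execsD(2)[OF assms(2)])

lemma execs_LoopT:
  assumes "P (symb (s i))" "execs c s a s'" "execs (Loop i P c) s' b s''"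
  shows "execs (Loop i P c) s (a + b + 2) s''"
proof (rule execsI)
  fix j
  show "length (fst (s'' j)) \<le> length (fst (s j)) + (a + b + 2)"
    using execsD(3)[OF assms(2), of j] execsD(3)[OF assms(3), of j] by linarith
  show "exec (Loop i P c) (tapes_of r s) (a + b + 2) (tapes_of r s'')" for r
    using assms(1) by (intro exec_LoopT[OF _ execsD(1)[OF assms(2)] execsD(1)[OF assms(3)]]) simp
qed (rule execsD(2)[OF assms(3)])

lemma execs_LoopF:
  assumes "\<not> P (symb (s i))" "wf_mem s"
  shows "execs (Loop i P c) s 1 s"
  using assms by (intro execsI exec_LoopF) auto

text \<open>\<open>Z\<close> collects the tapes whose words keep their length; the running time is polynomial in
  these lengths only, so that a loop may append to the other tapes without losing its time bound.\<close>

definition realizes :: "nat set \<Rightarrow> (mem \<Rightarrow> mem) \<Rightarrow> com \<Rightarrow> nat poly \<Rightarrow> bool" where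
  "realizes Z f c p \<longleftrightarrow> com_ok c \<and>
     (\<forall>s N. wf_mem s \<longrightarrow> (\<forall>i\<in>Z. length (fst (s i)) \<le> N) \<longrightarrow> (\<exists>t \<le> poly p N. execs c s t (f s))) \<and>
     (\<forall>s. wf_mem s \<longrightarrow> (\<forall>i\<in>Z. length (fst (f s i)) = length (fst (s i)))) \<and>
     (\<forall>s. wf_mem s \<longrightarrow> wf_mem (f s))"

section \<open>Polynomial-time commands: sequencing, branching, elementary moves\<close>

definition realizable :: "nat set \<Rightarrow> (mem \<Rightarrow> mem) \<Rightarrow> bool" where
  "realizable Z f \<longleftrightarrow> (\<exists>c p. realizes Z f c p)"

lemma realizableI:
  assumes "com_ok c"
    and "\<And>s N. wf_mem s \<Longrightarrow> (\<And>i. i \<in> Z \<Longrightarrow> length (fst (s i)) \<le> N) \<Longrightarrow>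
      \<exists>t \<le> poly p N. execs c s t (f s)"
    and "\<And>s i. i \<in> Z \<Longrightarrow> wf_mem s \<Longrightarrow> length (fst (f s i)) = length (fst (s i))"
    and "\<And>s. wf_mem s \<Longrightarrow> wf_mem (f s)"
  shows "realizable Z f"
  unfolding realizable_def realizes_def using assms by blast

lemma realizesD:
  assumes "realizes Z f c p"
  shows "com_ok c"
    and "\<And>s N. wf_mem s \<Longrightarrow> (\<And>i. i \<in> Z \<Longrightarrow> length (fst (s i)) \<le> N) \<Longrightarrow>
      \<exists>t \<le> poly p N. execs c s t (f s)"
    and "\<And>s i. i \<in> Z \<Longrightarrow> wf_mem s \<Longrightarrow> length (fst (f s i)) = length (fst (s i))"
    and "\<And>s. wf_mem s \<Longrightarrow> wf_mem (f s)"
  using assms by (simp_all add: realizes_def)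

lemma execs_skip:
  assumes "wf_mem s"
  shows "execs (Act 0 id Stay) s 1 s"
proof -
  have "execs (Act 0 id Stay) s 1 (s(0 := s 0))"
    using assms act_tape_read[of "tape_of _ (s 0)"]
    by (intro execs_Act) (auto simp: wf_mem_def)
  then show ?thesis by simp
qed

lemma realizable_id: "realizable Z (\<lambda>s. s)"
proof (rule realizableI[where c = "Act 0 id Stay" and p = 1])
  fix s :: mem and N assume "wf_mem s"
  then show "\<exists>t\<le>poly 1 N. execs (Act 0 id Stay) s t s"
    using execs_skip by (intro exI[of _ 1]) auto
qed auto

lemma realizable_comp:
  assumes "realizable Z f" "realizable Z g"
  shows "realizable Z (\<lambda>s. g (f s))"
proof -
  obtain c p where "realizes Z f c p"
    using assms(1) unfolding realizable_def by blast
  note c = realizesD[OF this]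
  obtain d q where "realizes Z g d q"
    using assms(2) unfolding realizable_def by blast
  note d = realizesD[OF this]
  show ?thesis
  proof (rule realizableI[where c = "Seq c d" and p = "p + q"])
    fix s N assume s: "wf_mem s" "\<And>i. i \<in> Z \<Longrightarrow> length (fst (s i)) \<le> N"
    obtain a where a: "a \<le> poly p N" "execs c s a (f s)"
      using c(2)[OF s] by blast
    obtain b where b: "b \<le> poly q N" "execs d (f s) b (g (f s))"
      using d(2)[OF c(4)[OF s(1)], of N] c(3)[OF _ s(1)] s(2) by auto
    show "\<exists>t\<le>poly (p + q) N. execs (Seq c d) s t (g (f s))"
      using execs_Seq[OF a(2) b(2)] a(1) b(1) by (auto intro!: exI[of _ "a + b"])
  qed (use c d in auto)
qed

lemma realizable_symb:
  assumes "realizable Z f" "realizable Z g"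
  shows "realizable Z (\<lambda>s. if P (symb (s i)) then f s else g s)"
proof -
  obtain c p where "realizes Z f c p"
    using assms(1) unfolding realizable_def by blast
  note c = realizesD[OF this]
  obtain d q where "realizes Z g d q"
    using assms(2) unfolding realizable_def by blast
  note d = realizesD[OF this]
  show ?thesis
  proof (rule realizableI[where c = "Cond i P c d" and p = "p + q + 2"])
    fix s N assume s: "wf_mem s" "\<And>i. i \<in> Z \<Longrightarrow> length (fst (s i)) \<le> N"
    obtain a where a: "a \<le> poly p N" "execs c s a (f s)"
      using c(2)[OF s] by blast
    obtain b where b: "b \<le> poly q N" "execs d s b (g s)"
      using d(2)[OF s] by blast
    show "\<exists>t\<le>poly (p + q + 2) N. execs (Cond i P c d) s t (if P (symb (s i)) then f s else g s)"
    proof (cases "P (symb (s i))")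
      case True
      then show ?thesis
        using execs_CondT[where P = P and d = d, OF True a(2)] a(1)
        by (intro exI[of _ "a + 2"]) simp
    next
      case False
      then show ?thesis
        using execs_CondF[where P = P and c = c, OF False b(2)] b(1)
        by (intro exI[of _ "b + 1"]) simp
    qed
  qed (use c d in auto)
qed

text \<open>The minimum keeps \<open>wf_mem\<close> true; on the machine it is a test for the blank
  before the move.\<close>

definition mvr :: "nat \<Rightarrow> mem \<Rightarrow> mem" where
  "mvr i s = s(i := (fst (s i), min (Suc (snd (s i))) (length (fst (s i)))))"

definition rew :: "nat \<Rightarrow> mem \<Rightarrow> mem" where
  "rew i s = s(i := (fst (s i), 0))"

definition put :: "nat \<Rightarrow> bool \<Rightarrow> mem \<Rightarrow> mem" where
  "put i b s = s(i := ((fst (s i))[snd (s i) := b], snd (s i)))"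

definition app :: "nat \<Rightarrow> bool \<Rightarrow> mem \<Rightarrow> mem" where
  "app i b s = (if length (fst (s i)) \<le> snd (s i) then s(i := (fst (s i) @ [b], Suc (snd (s i)))) else s)"

lemma wf_mem_upd: "wf_mem s \<Longrightarrow> snd x \<le> length (fst x) \<Longrightarrow> wf_mem (s(i := x))"
  by (auto simp: wf_mem_def)

lemma execs_right:
  assumes "wf_mem s" "snd (s i) < length (fst (s i))"
  shows "execs (Act i id MoveRight) s 1 (s(i := (fst (s i), Suc (snd (s i)))))"
proof (rule execs_Act)
  show "act_tape (id (symb (s i)), MoveRight) (tape_of r (s i)) = tape_of r (fst (s i), Suc (snd (s i)))"
    for r
    using act_right[of "fst (s i)" "snd (s i)" r] by simp
qed (use assms in auto)

lemma realizable_right_if: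
  "realizable Z (\<lambda>s. if symb (s i) \<noteq> 0 then s(i := (fst (s i), Suc (snd (s i)))) else s)"
proof -
  let ?c = "Act 0 id Stay"
  show ?thesis
  proof (rule realizableI[where c = "Cond i (\<lambda>s. s \<noteq> 0) (Act i id MoveRight) ?c" and p = "3"])
    fix s N assume s: "wf_mem s" "\<And>i. i \<in> Z \<Longrightarrow> length (fst (s i)) \<le> N"
    have a: "execs ?c s 1 s"
      using execs_skip[OF s(1)] .
    show "\<exists>t\<le>poly 3 N. execs (Cond i (\<lambda>s. s \<noteq> 0) (Act i id MoveRight) ?c) s t
        (if symb (s i) \<noteq> 0 then s(i := (fst (s i), Suc (snd (s i)))) else s)"
    proof (cases "symb (s i) \<noteq> 0")
      case True
      then show ?thesis
        using execs_CondT[where P = "\<lambda>s. s \<noteq> 0" and d = ?c and i = i, OF _ execs_right, of s i] s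
        by (auto simp: symb_eq_0 numeral_3_eq_3 intro!: exI[of _ 3])
    next
      case False
      then show ?thesis
        using execs_CondF[where P = "\<lambda>s. s \<noteq> 0", OF _ a, of i "Act i id MoveRight"]
        by (auto intro!: exI[of _ 2] simp: numeral_2_eq_2)
    qed
  qed (auto simp: symb_eq_0 wf_mem_def)
qed

lemma realizable_cong:
  assumes "realizable Z f" "\<And>s. wf_mem s \<Longrightarrow> f s = g s"
  shows "realizable Z g"
proof -
  obtain c p where "realizes Z f c p"
    using assms(1) unfolding realizable_def by blast
  note c = realizesD[OF this]
  show ?thesis
    by (rule realizableI[OF c(1), of Z p]) (use c assms(2) in auto)
qed

lemma realizable_mvr: "realizable Z (mvr i)"
proof (rule realizable_cong[OF realizable_right_if])
  fix s assume "wf_mem s"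
  then have "snd (s i) \<le> length (fst (s i))"
    by (simp add: wf_mem_def)
  then show "(if symb (s i) \<noteq> 0 then s(i := (fst (s i), Suc (snd (s i)))) else s) = mvr i s"
    by (auto simp: mvr_def symb_eq_0 fun_upd_idem_iff min_def prod_eq_iff)
qed

lemma realizable_put: "realizable Z (put i b)"
\<comment> \<open>A blank under the head stays blank, in accordance with \<open>list_update\<close>
  beyond the end of a list.\<close>
proof (rule realizableI[where c = "Act i (\<lambda>s. if s = 0 then 0 else bit_symbol b) Stay" and p = 1])
  fix s :: mem and N assume s: "wf_mem s"
  let ?g = "\<lambda>s. if s = 0 then 0 else bit_symbol b"
  have "act_tape (?g (symb (s i)), Stay) (tape_of r (s i)) = tape_of r ((fst (s i))[snd (s i) := b], snd (s i))"
    for r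
  proof (cases "symb (s i) = 0")
    case True
    then show ?thesis
      using act_tape_read[of "tape_of r (s i)"] by (simp add: list_update_beyond[OF True[unfolded symb_eq_0]])
  next
    case False
    then show ?thesis
      using act_put[of "snd (s i)" "fst (s i)" b r] by (simp add: symb_eq_0)
  qed
  then have "exec (Act i ?g Stay) (tapes_of r s) 1 (tapes_of r (put i b s))" for r
    using exec_Act[of i ?g Stay "tapes_of r s"] by (simp add: put_def tapes_of_upd)
  then show "\<exists>t\<le>poly 1 N. execs (Act i ?g Stay) s t (put i b s)"
    using s by (auto simp: execs_def put_def wf_mem_def)
qed (auto simp: put_def wf_mem_def)

lemma realizable_app:
  assumes "i \<notin> Z"
  shows "realizable Z (app i b)"
proof -
  let ?c = "Act 0 id Stay"
  let ?A = "Act i (\<lambda>_. bit_symbol b) MoveRight"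
  show ?thesis
  proof (rule realizableI[where c = "Cond i (\<lambda>s. s = 0) ?A ?c" and p = "3"])
    fix s N assume s: "wf_mem s" "\<And>i. i \<in> Z \<Longrightarrow> length (fst (s i)) \<le> N"
    have a: "execs ?c s 1 s"
      using execs_skip[OF s(1)] .
    show "\<exists>t\<le>poly 3 N. execs (Cond i (\<lambda>s. s = 0) ?A ?c) s t (app i b s)"
    proof (cases "symb (s i) = 0")
      case True
      then have h: "snd (s i) = length (fst (s i))"
        using s by (simp add: symb_eq_0 wf_mem_def antisym)
      then have "s i = (fst (s i), length (fst (s i)))"
        by (simp add: prod_eq_iff)
      then have "execs ?A s 1 (s(i := (fst (s i) @ [b], Suc (snd (s i)))))"
        using s(1) h act_app[of b _ "fst (s i)"] by (intro execs_Act) auto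
      then have "execs ?A s 1 (app i b s)"
        using h by (simp add: app_def)
      then show ?thesis
        using execs_CondT[where P = "\<lambda>s. s = 0" and s = s and i = i and d = ?c, OF True] by (auto simp: numeral_3_eq_3 intro!: exI[of _ 3])
    next
      case False
      then show ?thesis
        using execs_CondF[where P = "\<lambda>s. s = 0", OF _ a, of i ?A]
        by (auto intro!: exI[of _ 2] simp: app_def symb_eq_0 numeral_2_eq_2)
    qed
  qed (use assms in \<open>auto simp: app_def wf_mem_def\<close>)
qed

text \<open>Each of the \<open>k\<close> cells costs a test, a move and a jump back; the last step
  is the failing test.\<close>

lemma exec_scan:
  assumes "ts i = (c, p)" "\<And>j. j < k \<Longrightarrow> P (c (p + d * int j))" "\<not> P (c (p + d * int k))"
    and "d = 1 \<and> m = MoveRight \<or> d = -1 \<and> m = MoveLeft"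
  shows "exec (Loop i P (Act i id m)) ts (3 * k + 1) (ts(i := (c, p + d * int k)))"
  using assms(1-3)
proof (induction k arbitrary: ts p)
  case 0
  then show ?case
    using exec_LoopF[of P ts i] by (simp add: read_tape_def fun_upd_idem)
next
  case (Suc k)
  let ?ts = "ts(i := (c, p + d))"
  have "exec (Act i id m) ts 1 ?ts"
    using exec_Act[of i id m ts] Suc.prems(1) assms(4) by (auto simp: read_tape_def)
  moreover have "exec (Loop i P (Act i id m)) ?ts (3 * k + 1) (?ts(i := (c, p + d + d * int k)))"
    using Suc.prems(2)[of "Suc _"] Suc.prems(3)
    by (intro Suc.IH) (auto simp: algebra_simps)
  moreover have "P (read_tape (ts i))"
    using Suc.prems(1) Suc.prems(2)[of 0] by (simp add: read_tape_def)
  ultimately have "exec (Loop i P (Act i id m)) ts (1 + (3 * k + 1) + 2) (?ts(i := (c, p + d + d * int k)))"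
    by (rule exec_LoopT[rotated])
  moreover have "1 + (3 * k + 1) + 2 = 3 * Suc k + 1" "p + d + d * int k = p + d * int (Suc k)"
    by (simp_all add: algebra_simps)
  ultimately show ?case
    by (simp only: fun_upd_upd)
qed

text \<open>The head may be on the blank behind the word, where a scan for a blank would stop at
  once; the first step to the left avoids this. The scan ends on the blank in front of the word, one
  cell too far, which the last step corrects.\<close>

definition rew_com :: "nat \<Rightarrow> com" where
  "rew_com i = Seq (Act i id MoveLeft)
     (Seq (Loop i (\<lambda>s. s \<noteq> 0) (Act i id MoveLeft)) (Act i id MoveRight))"

lemma exec_rew:
  assumes "ts i = (c, p + int k)" "\<And>j. j < k \<Longrightarrow> c (p + int j) \<noteq> 0" "c (p - 1) = 0"
  shows "exec (rew_com i) ts (3 * k + 3) (ts(i := (c, p)))"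
proof -
  let ?t1 = "ts(i := (c, p + int k - 1))" let ?t2 = "ts(i := (c, p - 1))"
  have 1: "exec (Act i id MoveLeft) ts 1 ?t1"
    using exec_Act[of i id MoveLeft ts] assms(1) by (simp add: read_tape_def)
  have "c (p + int k - 1 + - 1 * int j) \<noteq> 0" if "j < k" for j
    using assms(2)[of "k - 1 - j"] that by (simp add: algebra_simps of_nat_diff)
  then have "exec (Loop i (\<lambda>s. s \<noteq> 0) (Act i id MoveLeft)) ?t1 (3 * k + 1)
      (?t1(i := (c, p + int k - 1 + - 1 * int k)))"
    using assms(3) by (intro exec_scan) auto
  then have 2: "exec (Loop i (\<lambda>s. s \<noteq> 0) (Act i id MoveLeft)) ?t1 (3 * k + 1) ?t2"
    by simp
  have 3: "exec (Act i id MoveRight) ?t2 1 (ts(i := (c, p)))"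
    using exec_Act[of i id MoveRight ?t2] by (simp add: read_tape_def)
  show ?thesis
    using exec_Seq[OF 1 exec_Seq[OF 2 3]] by (simp add: rew_com_def numeral_3_eq_3)
qed

lemma execs_rew:
  assumes "wf_mem s"
  shows "execs (rew_com i) s (3 * snd (s i) + 3) (rew i s)"
proof -
  obtain u h where uh: "s i = (u, h)" and h: "h \<le> length u"
    using assms by (metis wf_mem_def prod.collapse)
  have "exec (rew_com i) (tapes_of r s) (3 * h + 3) (tapes_of r (rew i s))" for r
  proof -
    have "exec (rew_com i) (tapes_of r s) (3 * h + 3)
        ((tapes_of r s)(i := (fst (tape_of (r i) (u, h)), r i)))"
      using h by (intro exec_rew) (auto simp: uh tape_of_def)
    then show ?thesis
      by (simp add: rew_def uh tapes_of_upd) (simp add: tape_of_def)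
  qed
  then show ?thesis
    using assms by (auto simp: execs_def uh rew_def intro!: wf_mem_upd)
qed

lemma com_ok_rew: "com_ok (rew_com i)"
  by (simp add: rew_com_def)

lemma realizable_rew:
  assumes "i \<in> Z"
  shows "realizable Z (rew i)"
proof (rule realizableI[where c = "rew_com i" and p = "[:3, 3:]"])
  fix s N assume s: "wf_mem s" "\<And>i. i \<in> Z \<Longrightarrow> length (fst (s i)) \<le> N"
  have "snd (s i) \<le> N"
    using s(1) s(2)[OF assms] unfolding wf_mem_def by (meson le_trans)
  then show "\<exists>t\<le>poly [:3, 3:] N. execs (rew_com i) s t (rew i s)"
    using execs_rew[OF s(1), of i] by (intro exI[of _ "3 * snd (s i) + 3"]) auto
qed (auto simp: rew_def com_ok_rew wf_mem_def)

section \<open>Bounded loops\<close>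

primrec loop_from :: "nat \<Rightarrow> (mem \<Rightarrow> bool) \<Rightarrow> (mem \<Rightarrow> mem) \<Rightarrow> nat \<Rightarrow> mem \<Rightarrow> mem" where
  "loop_from i B f 0 s = s"
| "loop_from i B f (Suc k) s =
     (if B (f s) then (f s)(i := (fst (f s i), length (fst (f s i))))
      else loop_from i B f k ((f s)(i := (fst (f s i), Suc (snd (f s i))))))"

text \<open>The loop variable is the head of tape \<open>i\<close>, so the length of that word
  bounds the number of rounds. An early exit sends the head to the end of the word, where the loop
  test of the machine fails, and the final rewind makes both kinds of exit look alike.\<close>

definition for_until :: "nat \<Rightarrow> nat \<Rightarrow> (nat \<Rightarrow> bool) \<Rightarrow> (mem \<Rightarrow> mem) \<Rightarrow> mem \<Rightarrow> mem" where
  "for_until i j P f s =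
     rew i (loop_from i (\<lambda>s. P (symb (s j))) f (length (fst (s i))) (rew i s))"

definition for_all :: "nat \<Rightarrow> (mem \<Rightarrow> mem) \<Rightarrow> mem \<Rightarrow> mem" where
  "for_all i = for_until i i (\<lambda>_. False)"

definition keeps :: "(mem \<Rightarrow> mem) \<Rightarrow> nat \<Rightarrow> bool" where
  "keeps f i \<longleftrightarrow> (\<forall>s. f s i = s i)"

lemma keepsD: "keeps f i \<Longrightarrow> f s i = s i"
  by (simp add: keeps_def)

lemma execs_to_end:
  assumes "wf_mem s"
  shows "execs (Loop i (\<lambda>s. s \<noteq> 0) (Act i id MoveRight)) s
    (3 * (length (fst (s i)) - snd (s i)) + 1) (s(i := (fst (s i), length (fst (s i)))))"
proof (rule execsI)
  obtain u h where uh: "s i = (u, h)" and h: "h \<le> length u"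
    using assms by (metis wf_mem_def prod.collapse)
  fix r
  have "exec (Loop i (\<lambda>s. s \<noteq> 0) (Act i id MoveRight)) (tapes_of r s) (3 * (length u - h) + 1)
     ((tapes_of r s)(i := (fst (tape_of (r i) (u, h)), r i + int h + 1 * int (length u - h))))"
    using h by (intro exec_scan) (auto simp: uh tape_of_def)
  moreover have "r i + int h + 1 * int (length u - h) = r i + int (length u)"
    using h by simp
  ultimately show "exec (Loop i (\<lambda>s. s \<noteq> 0) (Act i id MoveRight)) (tapes_of r s)
    (3 * (length (fst (s i)) - snd (s i)) + 1)
    (tapes_of r (s(i := (fst (s i), length (fst (s i))))))"
    by (simp add: uh tapes_of_upd) (simp add: tape_of_def)
qed (use assms in \<open>auto simp: wf_mem_def\<close>)

lemma loop_from_wf_length: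
  assumes len: "\<And>s i. i \<in> Z \<Longrightarrow> wf_mem s \<Longrightarrow> length (fst (f s i)) = length (fst (s i))"
    and wf: "\<And>s. wf_mem s \<Longrightarrow> wf_mem (f s)"
    and "keeps f i" "wf_mem s" "snd (s i) + k = length (fst (s i))"
  shows "wf_mem (loop_from i B f k s) \<and>
    (\<forall>l\<in>Z. length (fst (loop_from i B f k s l)) = length (fst (s l)))"
  using assms(4,5)
proof (induction k arbitrary: s)
  case (Suc k)
  have fi: "f s i = s i"
    using \<open>keeps f i\<close> by (rule keepsD)
  define s' where "s' = (f s)(i := (fst (f s i), Suc (snd (f s i))))"
  have "wf_mem s'"
    unfolding s'_def using wf[OF Suc.prems(1)] Suc.prems(2) by (intro wf_mem_upd) (simp_all add: fi)
  moreover have "snd (s' i) + k = length (fst (s' i))"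
    using Suc.prems(2) by (simp add: s'_def fi)
  ultimately have IH: "wf_mem (loop_from i B f k s') \<and>
      (\<forall>l\<in>Z. length (fst (loop_from i B f k s' l)) = length (fst (s' l)))"
    by (rule Suc.IH)
  have len': "length (fst (s' l)) = length (fst (s l))" if "l \<in> Z" for l
    using len[OF that Suc.prems(1)] by (auto simp: s'_def)
  show ?case
  proof (cases "B (f s)")
    case True
    have "wf_mem ((f s)(i := (fst (f s i), length (fst (f s i)))))"
      by (rule wf_mem_upd[OF wf[OF Suc.prems(1)]]) simp
    moreover have "length (fst (((f s)(i := (fst (f s i), length (fst (f s i))))) l)) = length (fst (s l))"
      if "l \<in> Z" for l
      using len[OF that Suc.prems(1)] by (simp add: fi)
    ultimately show ?thesis
      unfolding loop_from.simps if_P[OF True] by blast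
  next
    case False
    then have "loop_from i B f (Suc k) s = loop_from i B f k s'"
      by (simp add: s'_def)
    then show ?thesis
      using IH len' by simp
  qed
qed simp

text \<open>A round costs at most \<open>b\<close> for the body, \<open>3 * N + 3\<close> for the
  conditional when it runs to the end of the tape, and 2 for the loop itself; the last 1 is the
  failing test.\<close>

lemma execs_loop_from:
  assumes run: "\<And>s. wf_mem s \<Longrightarrow> (\<And>i. i \<in> Z \<Longrightarrow> length (fst (s i)) \<le> N) \<Longrightarrow>
      \<exists>t \<le> b. execs c s t (f s)"
    and len: "\<And>s i. i \<in> Z \<Longrightarrow> wf_mem s \<Longrightarrow> length (fst (f s i)) = length (fst (s i))"
    and wf: "\<And>s. wf_mem s \<Longrightarrow> wf_mem (f s)"
    and "i \<in> Z" "keeps f i" "wf_mem s" "\<And>i. i \<in> Z \<Longrightarrow> length (fst (s i)) \<le> N"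
    and "snd (s i) + k = length (fst (s i))"
  shows "\<exists>t \<le> k * (b + 3 * N + 5) + 1. execs
      (Loop i (\<lambda>s. s \<noteq> 0) (Seq c (Cond j P (Loop i (\<lambda>s. s \<noteq> 0) (Act i id MoveRight)) (Act i id MoveRight))))
      s t (loop_from i (\<lambda>s. P (symb (s j))) f k s)"
  using assms(6-8)
proof (induction k arbitrary: s)
  case 0
  then show ?case
    by (auto intro!: exI[of _ 1] execs_LoopF simp: symb_eq_0)
next
  case (Suc k)
  let ?E = "Loop i (\<lambda>s. s \<noteq> 0) (Act i id MoveRight)"
  let ?D = "Cond j P ?E (Act i id MoveRight)"
  let ?L = "Loop i (\<lambda>s. s \<noteq> 0) (Seq c ?D)"
  have fi: "f s i = s i"
    using \<open>keeps f i\<close> by (rule keepsD)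
  have head: "symb (s i) \<noteq> 0" and lt: "snd (s i) < length (fst (s i))"
    using Suc.prems(3) by (auto simp: symb_eq_0)
  have wff: "wf_mem (f s)"
    using wf Suc.prems(1) by blast
  obtain a where a: "a \<le> b" "execs c s a (f s)"
    using run[OF Suc.prems(1,2)] by blast
  have len': "length (fst (f s l)) = length (fst (s l))" if "l \<in> Z" for l
    using len[OF that Suc.prems(1)] .
  show ?case
  proof (cases "P (symb (f s j))")
    case True
    let ?s = "(f s)(i := (fst (f s i), length (fst (f s i))))"
    let ?t = "3 * (length (fst (f s i)) - snd (f s i)) + 1"
    have "execs ?D (f s) (?t + 2) ?s"
      using execs_CondT[where P = P and s = "f s" and i = j, OF True execs_to_end[OF wff]] .
    then have body: "execs (Seq c ?D) s (a + (?t + 2)) ?s"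
      by (rule execs_Seq[OF a(2)])
    have "execs ?L ?s 1 ?s"
      using wff by (intro execs_LoopF) (auto simp: symb_eq_0 wf_mem_def)
    then have "execs ?L s (a + (?t + 2) + 1 + 2) ?s"
      by (intro execs_LoopT[where P = "\<lambda>s. s \<noteq> 0", OF head body])
    moreover have "?t \<le> 3 * N + 1"
      using Suc.prems(2)[OF \<open>i \<in> Z\<close>] by (auto simp: fi)
    moreover have "a + (?t + 2) + 1 + 2 \<le> Suc k * (b + 3 * N + 5) + 1" if "?t \<le> 3 * N + 1"
    proof -
      have "a + (?t + 2) + 1 + 2 \<le> (b + 3 * N + 5) + 1"
        using a(1) that by linarith
      also have "\<dots> \<le> Suc k * (b + 3 * N + 5) + 1"
        by simp
      finally show ?thesis .
    qed
    moreover have "loop_from i (\<lambda>s. P (symb (s j))) f (Suc k) s = ?s"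
      by (simp only: loop_from.simps True if_True)
    ultimately show ?thesis
      by metis
  next
    case False
    let ?s = "(f s)(i := (fst (f s i), Suc (snd (f s i))))"
    have "execs ?D (f s) (1 + 1) ?s"
      using lt by (intro execs_CondF[where P = P and s = "f s" and i = j, OF False] execs_right wff)
        (simp add: fi)
    then have body: "execs (Seq c ?D) s (a + (1 + 1)) ?s"
      by (rule execs_Seq[OF a(2)])
    have "\<exists>t \<le> k * (b + 3 * N + 5) + 1. execs ?L ?s t (loop_from i (\<lambda>s. P (symb (s j))) f k ?s)"
    proof (rule Suc.IH)
      show "wf_mem ?s"
        using wff lt by (intro wf_mem_upd) (auto simp: fi)
      show "length (fst (?s l)) \<le> N" if "l \<in> Z" for l
        using Suc.prems(2)[OF that] len'[OF that] by auto
      show "snd (?s i) + k = length (fst (?s i))"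
        using Suc.prems(3) by (simp add: fi)
    qed
    then obtain t where t: "t \<le> k * (b + 3 * N + 5) + 1"
      "execs ?L ?s t (loop_from i (\<lambda>s. P (symb (s j))) f k ?s)"
      by blast
    have "execs ?L s (a + (1 + 1) + t + 2) (loop_from i (\<lambda>s. P (symb (s j))) f k ?s)"
      using execs_LoopT[where P = "\<lambda>s. s \<noteq> 0", OF head body t(2)] .
    moreover have "a + (1 + 1) + t + 2 \<le> Suc k * (b + 3 * N + 5) + 1"
      using a(1) t(1) by simp
    moreover have "loop_from i (\<lambda>s. P (symb (s j))) f (Suc k) s =
        loop_from i (\<lambda>s. P (symb (s j))) f k ?s"
      by (simp only: loop_from.simps False if_False)
    ultimately show ?thesis
      by metis
  qed
qed

lemma realizable_for_until:
  assumes "realizable Z f" "i \<in> Z" "keeps f i"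
  shows "realizable Z (for_until i j P f)"
proof -
  obtain c p where "realizes Z f c p"
    using assms(1) unfolding realizable_def by blast
  note c = realizesD[OF this]
  let ?L = "Loop i (\<lambda>s. s \<noteq> 0)
    (Seq c (Cond j P (Loop i (\<lambda>s. s \<noteq> 0) (Act i id MoveRight)) (Act i id MoveRight)))"
  let ?C = "Seq (rew_com i) (Seq ?L (rew_com i))"
  let ?p = "[:3, 3:] + ([:0, 1:] * (p + [:5, 3:]) + 1 + [:3, 3:])"
  have inv: "wf_mem (loop_from i (\<lambda>s. P (symb (s j))) f (length (fst (s i))) (rew i s)) \<and>
      (\<forall>l\<in>Z. length (fst (loop_from i (\<lambda>s. P (symb (s j))) f (length (fst (s i))) (rew i s) l)) =
        length (fst (rew i s l)))" if "wf_mem s" for s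
    using that c(3,4) assms(3) by (intro loop_from_wf_length) (auto simp: rew_def wf_mem_def)
  show ?thesis
  proof (rule realizableI[where c = ?C and p = ?p])
    show "com_ok ?C"
      using c(1) by (simp add: com_ok_rew)
  next
    fix s N assume s: "wf_mem s" "\<And>i. i \<in> Z \<Longrightarrow> length (fst (s i)) \<le> N"
    define k where "k = length (fst (s i))"
    define s' where "s' = loop_from i (\<lambda>s. P (symb (s j))) f k (rew i s)"
    have k: "k \<le> N"
      using s(2) assms(2) by (simp add: k_def)
    have h: "snd (s i) \<le> N"
      using s(1) s(2)[OF assms(2)] unfolding wf_mem_def by (meson le_trans)
    have 1: "execs (rew_com i) s (3 * snd (s i) + 3) (rew i s)"
      by (rule execs_rew[OF s(1)])
    have wf1: "wf_mem (rew i s)"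
      by (rule execsD(2)[OF 1])
    have "\<exists>t \<le> k * (poly p N + 3 * N + 5) + 1. execs ?L (rew i s) t s'"
      unfolding s'_def
    proof (rule execs_loop_from[where Z = Z])
      show "\<exists>t\<le>poly p N. execs c s t (f s)" if "wf_mem s" "\<And>i. i \<in> Z \<Longrightarrow> length (fst (s i)) \<le> N" for s
        using c(2)[OF that] .
    qed (use assms(2,3) wf1 c(3,4) s(2) in \<open>auto simp: rew_def k_def\<close>)
    then obtain t where t: "t \<le> k * (poly p N + 3 * N + 5) + 1" "execs ?L (rew i s) t s'"
      by blast
    have "length (fst (s' i)) \<le> N"
      using inv[OF s(1)] assms(2) s(2)[OF assms(2)] by (simp add: s'_def k_def rew_def)
    then have h': "snd (s' i) \<le> N"
      using execsD(2)[OF t(2)] unfolding wf_mem_def by (meson le_trans)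
    have 3: "execs (rew_com i) s' (3 * snd (s' i) + 3) (rew i s')"
      by (rule execs_rew[OF execsD(2)[OF t(2)]])
    let ?t = "3 * snd (s i) + 3 + (t + (3 * snd (s' i) + 3))"
    have "execs ?C s ?t (rew i s')"
      by (intro execs_Seq[OF 1] execs_Seq[OF t(2)] 3)
    moreover have "?t \<le> poly ?p N"
    proof -
      have "t \<le> N * (poly p N + 3 * N + 5) + 1"
        using t(1) k by (meson add_le_mono1 le_trans mult_le_mono1)
      then show ?thesis
        using h h' by (simp add: algebra_simps)
    qed
    moreover have "for_until i j P f s = rew i s'"
      by (simp only: for_until_def s'_def k_def)
    ultimately show "\<exists>t\<le>poly ?p N. execs ?C s t (for_until i j P f s)"
      by metis
  next
    fix s assume s: "wf_mem s"
    show "wf_mem (for_until i j P f s)"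
      using inv[OF s] by (auto simp: for_until_def rew_def intro!: wf_mem_upd)
    show "length (fst (for_until i j P f s l)) = length (fst (s l))" if "l \<in> Z" for l
      using inv[OF s] that by (auto simp: for_until_def rew_def)
  qed
qed

lemma realizable_for_all:
  assumes "realizable Z f" "i \<in> Z" "keeps f i"
  shows "realizable Z (for_all i f)"
  using realizable_for_until[OF assms] by (simp add: for_all_def)

definition count_true :: "bool list \<times> nat \<Rightarrow> nat" where
  "count_true = (\<lambda>(u, h). length (takeWhile id (drop h u)))"

lemma count_true_0: "symb x \<noteq> 2 \<Longrightarrow> count_true x = 0"
  by (cases x) (auto simp: symb_def count_true_def takeWhile_eq_Nil_iff hd_drop_conv_nth)

lemma count_true_Suc: "symb x = 2 \<Longrightarrow> count_true x = Suc (count_true (fst x, Suc (snd x)))"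
  by (cases x) (auto simp: symb_def count_true_def Cons_nth_drop_Suc[symmetric] split: if_splits)

lemma count_true_le: "count_true x \<le> length (fst x)"
  by (cases x) (auto simp: count_true_def intro: le_trans[OF length_takeWhile_le])

definition while_true :: "nat \<Rightarrow> (mem \<Rightarrow> mem) \<Rightarrow> mem \<Rightarrow> mem" where
  "while_true i f s = (f ^^ count_true (s i)) s"

text \<open>The machine tests the current bit in every round. Since the body advances tape
  \<open>i\<close> by exactly one cell, the number of rounds is fixed at the start and the loop is a
  plain iteration. This is how unary numbers are read.\<close>

lemma realizable_while_true:
  assumes "realizable Z f" "i \<in> Z" "\<And>s. f s i = mvr i s i"
  shows "realizable Z (while_true i f)"
proof -
  obtain c p where "realizes Z f c p"
    using assms(1) unfolding realizable_def by blast
  note c = realizesD[OF this]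
  let ?L = "Loop i (\<lambda>s. s = 2) c"
  have inv: "wf_mem ((f ^^ k) s) \<and> (\<forall>l\<in>Z. length (fst ((f ^^ k) s l)) = length (fst (s l)))"
    if "wf_mem s" for k s
    using that c(3,4) by (induction k) auto
  have run: "\<exists>t \<le> k * (poly p N + 2) + 1. execs ?L s t ((f ^^ k) s)"
    if "wf_mem s" "\<And>i. i \<in> Z \<Longrightarrow> length (fst (s i)) \<le> N" "k = count_true (s i)" for k s N
    using that
  proof (induction k arbitrary: s)
    case 0
    then have "symb (s i) \<noteq> 2"
      using count_true_Suc[of "s i"] by auto
    then show ?case
      using 0 by (auto intro!: exI[of _ 1] execs_LoopF)
  next
    case (Suc k)
    then have head: "symb (s i) = 2"
      using count_true_0[of "s i"] by (cases "symb (s i) = 2") auto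
    then have lt: "snd (s i) < length (fst (s i))"
      using symb_eq_0[of "s i"] by linarith
    obtain a where a: "a \<le> poly p N" "execs c s a (f s)"
      using c(2)[OF Suc.prems(1,2)] by blast
    have "\<exists>t \<le> k * (poly p N + 2) + 1. execs ?L (f s) t ((f ^^ k) (f s))"
    proof (rule Suc.IH)
      show "k = count_true (f s i)"
        using Suc.prems(3) count_true_Suc[OF head] lt by (simp add: assms(3) mvr_def min_def)
    qed (use c(3,4) Suc.prems in auto)
    then obtain t where t: "t \<le> k * (poly p N + 2) + 1" "execs ?L (f s) t ((f ^^ k) (f s))"
      by blast
    have "execs ?L s (a + t + 2) ((f ^^ Suc k) s)"
      using execs_LoopT[where P = "\<lambda>s. s = 2", OF head a(2) t(2)] by (simp add: funpow_swap1)
    then show ?case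
      using a(1) t(1) by (intro exI[of _ "a + t + 2"]) auto
  qed
  show ?thesis
  proof (rule realizableI[where c = ?L and p = "[:0, 1:] * (p + 2) + 1"])
    fix s N assume s: "wf_mem s" "\<And>i. i \<in> Z \<Longrightarrow> length (fst (s i)) \<le> N"
    obtain t where t: "t \<le> count_true (s i) * (poly p N + 2) + 1" "execs ?L s t (while_true i f s)"
      using run[OF s refl] unfolding while_true_def by blast
    have "count_true (s i) \<le> N"
      using count_true_le s(2)[OF assms(2)] le_trans by blast
    then have "t \<le> N * (poly p N + 2) + 1"
      using t(1) by (meson add_le_mono1 le_trans mult_le_mono1)
    then show "\<exists>t\<le>poly ([:0, 1:] * (p + 2) + 1) N. execs ?L s t (while_true i f s)"
      using t(2) by (intro exI[of _ t]) auto
  qed (use c inv in \<open>auto simp: while_true_def\<close>)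
qed

text \<open>To compare two head positions, mark both current cells, rewind, and move both heads to the right
  until the first one meets its mark; the positions are equal iff the second head is on its mark too.\<close>

definition mark_com :: "nat \<Rightarrow> com" where
  "mark_com i = Act i (\<lambda>s. if s < 3 then s + 3 else s) Stay"

definition unmark_com :: "nat \<Rightarrow> com" where
  "unmark_com i = Act i (\<lambda>s. if s < 3 then s else s - 3) Stay"

definition lockstep_com :: "nat \<Rightarrow> nat \<Rightarrow> com" where
  "lockstep_com i j = Loop i (\<lambda>s. s < 3) (Seq (Act i id MoveRight)
     (Cond j (\<lambda>s. s \<noteq> 0) (Act j id MoveRight) (Act j id Stay)))"

text \<open>A round takes five steps, and a sixth while the second head still moves, because the
  true branch of a conditional is one step longer. The second head waits at its first blank, at
  distance \<open>e\<close>, which it may reach before the first head meets its mark.\<close>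

lemma exec_lockstep:
  assumes "i \<noteq> j" "ts i = (c, p)" "ts j = (d, q)"
    and "\<And>l. l < k \<Longrightarrow> c (p + int l) < 3" "\<not> c (p + int k) < 3"
    and "\<And>l. l < e \<Longrightarrow> d (q + int l) \<noteq> 0" "d (q + int e) = 0"
  shows "exec (lockstep_com i j) ts (5 * k + min k e + 1)
    (ts(i := (c, p + int k), j := (d, q + int (min k e))))"
  using assms(2-)
proof (induction k arbitrary: ts p q e)
  case 0
  then show ?case
    using exec_LoopF[of "\<lambda>s. s < 3" ts i] by (simp add: read_tape_def lockstep_com_def fun_upd_idem)
next
  case (Suc k)
  let ?D = "Cond j (\<lambda>s. s \<noteq> 0) (Act j id MoveRight) (Act j id Stay)"
  define q' where "q' = (if e = 0 then q else q + 1)"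
  define ts1 where "ts1 = ts(i := (c, p + 1))"
  define ts2 where "ts2 = ts1(j := (d, q'))"
  have i: "read_tape (ts i) < 3"
    using Suc.prems(1) Suc.prems(3)[of 0] by (simp add: read_tape_def)
  have 1: "exec (Act i id MoveRight) ts 1 ts1"
    using exec_Act[of i id MoveRight ts] Suc.prems(1) by (simp add: read_tape_def ts1_def)
  have j: "ts1 j = (d, q)"
    using Suc.prems(2) assms(1) by (simp add: ts1_def)
  have 2: "exec ?D ts1 (if e = 0 then 1 + 1 else 1 + 2) ts2"
  proof (cases "e = 0")
    case True
    have "exec (Act j id Stay) ts1 1 ts2"
      using exec_Act[of j id Stay ts1] j True by (simp add: read_tape_def ts2_def q'_def)
    then show ?thesis
      using exec_CondF[where P = "\<lambda>s. s \<noteq> 0" and i = j and ts = ts1] Suc.prems(6) j True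
      by (simp add: read_tape_def)
  next
    case False
    have "exec (Act j id MoveRight) ts1 1 ts2"
      using exec_Act[of j id MoveRight ts1] j False by (simp add: read_tape_def ts2_def q'_def)
    moreover have "read_tape (ts1 j) \<noteq> 0"
      using Suc.prems(5)[of 0] j False by (simp add: read_tape_def)
    ultimately have "exec ?D ts1 (1 + 2) ts2"
      by (intro exec_CondT)
    then show ?thesis
      using False by simp
  qed
  have body: "exec (Seq (Act i id MoveRight) ?D) ts (1 + (if e = 0 then 1 + 1 else 1 + 2)) ts2"
    by (rule exec_Seq[OF 1 2])
  have "exec (lockstep_com i j) ts2 (5 * k + min k (e - 1) + 1)
      (ts2(i := (c, p + 1 + int k), j := (d, q' + int (min k (e - 1)))))"
  proof (rule Suc.IH)
    show "ts2 i = (c, p + 1)" "ts2 j = (d, q')"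
      using assms(1) by (simp_all add: ts2_def ts1_def)
    show "c (p + 1 + int l) < 3" if "l < k" for l
      using Suc.prems(3)[of "Suc l"] that by (simp add: algebra_simps)
    show "\<not> c (p + 1 + int k) < 3"
      using Suc.prems(4) by (simp add: algebra_simps)
    show "d (q' + int l) \<noteq> 0" if "l < e - 1" for l
      using Suc.prems(5)[of "Suc l"] that by (auto simp: algebra_simps q'_def)
    show "d (q' + int (e - 1)) = 0"
      using Suc.prems(6) by (cases e) (simp_all add: algebra_simps q'_def)
  qed
  then have "exec (lockstep_com i j) ts
      (1 + (if e = 0 then 1 + 1 else 1 + 2) + (5 * k + min k (e - 1) + 1) + 2)
      (ts2(i := (c, p + 1 + int k), j := (d, q' + int (min k (e - 1)))))"
    unfolding lockstep_com_def
    by (intro exec_LoopT[where P = "\<lambda>s. s < 3", OF i body])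
  moreover have "1 + (if e = 0 then 1 + 1 else 1 + 2) + (5 * k + min k (e - 1) + 1) + 2 =
      5 * Suc k + min (Suc k) e + 1"
    by (cases e) auto
  moreover have "q' + int (min k (e - 1)) = q + int (min (Suc k) e)"
    by (cases e) (auto simp: q'_def)
  moreover have "p + 1 + int k = p + int (Suc k)"
    by simp
  moreover have "ts2(i := x, j := y) = ts(i := x, j := y)" for x y
    using assms(1) by (auto simp: ts2_def ts1_def fun_eq_iff)
  ultimately show ?case
    by (simp only:)
qed

definition compare_com :: "nat \<Rightarrow> nat \<Rightarrow> com" where
  "compare_com i j = Seq (mark_com i) (Seq (mark_com j) (Seq (rew_com i) (Seq (rew_com j)
     (lockstep_com i j))))"

definition restore_com :: "nat \<Rightarrow> nat \<Rightarrow> com" where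
  "restore_com i j = Seq (unmark_com i) (Seq (rew_com j)
     (Seq (Loop j (\<lambda>s. s < 3) (Act j id MoveRight)) (unmark_com j)))"

text \<open>The outcome is visible only on the marked tapes, so the machine has to branch before the
  marks can be removed; each branch will therefore begin with \<open>restore_com\<close>. A mark on
  the blank behind the second word pushes the first blank one cell further, which is the case
  distinction in \<open>e\<close>.\<close>

lemma exec_compare:
  assumes "i \<noteq> j" and si: "s i = (u, h)" "h \<le> length u" and sj: "s j = (v, g)" "g \<le> length v"
  defines "e \<equiv> if g = length v then Suc (length v) else length v"
  shows "\<exists>ts. exec (compare_com i j) (tapes_of r s) (8 * h + 3 * g + min h e + 9) ts \<and>
    (read_tape (ts j) \<ge> 3 \<longleftrightarrow> h = g) \<and>
    exec (restore_com i j) ts (3 * min h e + 3 * g + 6) (tapes_of r s)"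
proof -
  define T where "T = tapes_of r s"
  define c where "c = fst (tape_of (r i) (u, h))"
  define d where "d = fst (tape_of (r j) (v, g))"
  define a where "a = r i"
  define b where "b = r j"
  define c' where "c' = c(a + int h := c (a + int h) + 3)"
  define d' where "d' = d(b + int g := d (b + int g) + 3)"
  have Ti: "T i = (c, a + int h)" and Tj: "T j = (d, b + int g)"
    by (simp_all add: T_def si sj c_def d_def a_def b_def tape_of_def)
  have c_less: "c x < 3" for x
    by (simp add: c_def tape_of_def)
  have d_less: "d x < 3" for x
    by (simp add: d_def tape_of_def)
  have c_in: "c (a + int l) \<noteq> 0" if "l < length u" for l
    using that by (simp add: c_def tape_of_def a_def)
  have d_in: "d (b + int l) \<noteq> 0" if "l < length v" for l
    using that by (simp add: d_def tape_of_def b_def)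
  have c_out: "c (a - 1) = 0"
    by (simp add: c_def tape_of_def a_def)
  have d_out: "d (b - 1) = 0"
    by (simp add: d_def tape_of_def b_def)
  have d_end: "d (b + int l) = 0" if "length v \<le> l" for l
    using that by (simp add: d_def tape_of_def b_def)
  have d'_in: "d' (b + int l) \<noteq> 0" if "l < e" for l
    using that d_in[of l] by (auto simp: d'_def e_def less_Suc_eq split: if_splits)
  have d'_end: "d' (b + int e) = 0"
    using sj(2) d_end by (auto simp: d'_def e_def)
  have ge: "g < e"
    using sj(2) by (auto simp: e_def)
  define T1 where "T1 = T(i := (c', a + int h))"
  define T2 where "T2 = T1(j := (d', b + int g))"
  define T3 where "T3 = T2(i := (c', a))"
  define T4 where "T4 = T3(j := (d', b))"
  define T5 where "T5 = T4(i := (c', a + int h), j := (d', b + int (min h e)))"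
  have 1: "exec (mark_com i) T 1 T1"
    using exec_Act[of i "\<lambda>s. if s < 3 then s + 3 else s" Stay T] Ti c_less
    by (simp add: mark_com_def read_tape_def T1_def c'_def)
  have 2: "exec (mark_com j) T1 1 T2"
    using exec_Act[of j "\<lambda>s. if s < 3 then s + 3 else s" Stay T1] Tj d_less assms(1)
    by (simp add: mark_com_def read_tape_def T1_def T2_def d'_def)
  have 3: "exec (rew_com i) T2 (3 * h + 3) T3"
    unfolding T3_def
    using assms(1) si c_in c_out by (intro exec_rew) (auto simp: T2_def T1_def c'_def)
  have 4: "exec (rew_com j) T3 (3 * g + 3) T4"
    unfolding T4_def
    using assms(1) sj d_in d_out by (intro exec_rew) (auto simp: T3_def T2_def d'_def)
  have 5: "exec (lockstep_com i j) T4 (5 * h + min h e + 1) T5"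
    unfolding T5_def
    using assms(1) c_less d'_in d'_end
    by (intro exec_lockstep) (auto simp: T4_def T3_def c'_def)
  have "exec (compare_com i j) T (1 + (1 + (3 * h + 3 + (3 * g + 3 + (5 * h + min h e + 1))))) T5"
    unfolding compare_com_def by (intro exec_Seq[OF 1] exec_Seq[OF 2] exec_Seq[OF 3] exec_Seq[OF 4] 5)
  moreover have "1 + (1 + (3 * h + 3 + (3 * g + 3 + (5 * h + min h e + 1)))) = 8 * h + 3 * g + min h e + 9"
    by simp
  ultimately have compare: "exec (compare_com i j) T (8 * h + 3 * g + min h e + 9) T5"
    by (simp only:)
  \<comment> \<open>The mark lies strictly before the blank at \<open>e\<close>, so a head that was
    stopped at \<open>e\<close> is never on the mark.\<close>
  have "min h e = g \<longleftrightarrow> h = g"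
    using ge by (auto simp: min_def)
  then have eq: "read_tape (T5 j) \<ge> 3 \<longleftrightarrow> h = g"
    using d_less[of "b + int (min h e)"] by (auto simp: T5_def read_tape_def d'_def)
  define T6 where "T6 = T5(i := (c, a + int h))"
  define T7 where "T7 = T6(j := (d', b))"
  define T8 where "T8 = T7(j := (d', b + 1 * int g))"
  have 6: "exec (unmark_com i) T5 1 T6"
    using exec_Act[of i "\<lambda>s. if s < 3 then s else s - 3" Stay T5] assms(1)
    by (simp add: unmark_com_def read_tape_def T6_def T5_def c'_def)
  have 7: "exec (rew_com j) T6 (3 * min h e + 3) T7"
    unfolding T7_def
    using assms(1) d'_in d_out by (intro exec_rew) (auto simp: T6_def T5_def d'_def)
  have 8: "exec (Loop j (\<lambda>s. s < 3) (Act j id MoveRight)) T7 (3 * g + 1) T8"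
    unfolding T8_def using d_less by (intro exec_scan) (auto simp: T7_def d'_def)
  have 9: "exec (unmark_com j) T8 1 (T8(j := (d, b + int g)))"
    using exec_Act[of j "\<lambda>s. if s < 3 then s else s - 3" Stay T8] assms(1)
    by (simp add: unmark_com_def read_tape_def T8_def d'_def)
  have "exec (restore_com i j) T5 (1 + (3 * min h e + 3 + (3 * g + 1 + 1))) (T8(j := (d, b + int g)))"
    unfolding restore_com_def by (intro exec_Seq[OF 6] exec_Seq[OF 7] exec_Seq[OF 8] 9)
  moreover have "T8(j := (d, b + int g)) = T"
    using Ti Tj by (auto simp: T8_def T7_def T6_def T5_def T4_def T3_def T2_def T1_def fun_eq_iff)
  moreover have "1 + (3 * min h e + 3 + (3 * g + 1 + 1)) = 3 * min h e + 3 * g + 6"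
    by simp
  ultimately have "exec (restore_com i j) T5 (3 * min h e + 3 * g + 6) T"
    by (simp only:)
  then show ?thesis
    using compare eq unfolding T_def by blast
qed

lemma realizable_if_eq:
  assumes "realizable Z f" "realizable Z g" "i \<noteq> j" "i \<in> Z" "j \<in> Z"
  shows "realizable Z (\<lambda>s. if snd (s i) = snd (s j) then f s else g s)"
proof -
  obtain c p where "realizes Z f c p"
    using assms(1) unfolding realizable_def by blast
  note c = realizesD[OF this]
  obtain d q where "realizes Z g d q"
    using assms(2) unfolding realizable_def by blast
  note d = realizesD[OF this]
  let ?C = "Seq (compare_com i j) (Cond j (\<lambda>s. s \<ge> 3) (Seq (restore_com i j) c) (Seq (restore_com i j) d))"
  show ?thesis
  \<comment> \<open>With both positions at most \<open>N\<close>, comparison and restoration cost at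
    most \<open>18 * N + 15\<close> together; the conditional adds at most 2.\<close>
  proof (rule realizableI[where c = ?C and p = "p + q + [:17, 18:]"])
    show "com_ok ?C"
      using c(1) d(1) by (auto simp: compare_com_def restore_com_def mark_com_def unmark_com_def
          lockstep_com_def com_ok_rew)
  next
    fix s N assume s: "wf_mem s" "\<And>i. i \<in> Z \<Longrightarrow> length (fst (s i)) \<le> N"
    obtain u h where uh: "s i = (u, h)" "h \<le> length u"
      using s(1) by (metis wf_mem_def prod.collapse)
    obtain v k where vk: "s j = (v, k)" "k \<le> length v"
      using s(1) by (metis wf_mem_def prod.collapse)
    have N: "h \<le> N" "k \<le> N"
      using s(2)[OF assms(4)] s(2)[OF assms(5)] uh vk by auto
    define e where "e = (if k = length v then Suc (length v) else length v)"
    have cmp: "\<exists>ts. exec (compare_com i j) (tapes_of r s) (8 * h + 3 * k + min h e + 9) ts \<and>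
      (read_tape (ts j) \<ge> 3 \<longleftrightarrow> h = k) \<and>
      exec (restore_com i j) ts (3 * min h e + 3 * k + 6) (tapes_of r s)" for r
      unfolding e_def by (rule exec_compare[OF assms(3) uh vk])
    obtain a where a: "a \<le> poly p N" "execs c s a (f s)"
      using c(2)[OF s] by blast
    obtain b where b: "b \<le> poly q N" "execs d s b (g s)"
      using d(2)[OF s] by blast
    let ?t1 = "8 * h + 3 * k + min h e + 9" let ?t2 = "3 * min h e + 3 * k + 6"
    show "\<exists>t\<le>poly (p + q + [:17, 18:]) N. execs ?C s t (if snd (s i) = snd (s j) then f s else g s)"
    proof (cases "h = k")
      case True
      let ?t = "?t1 + (?t2 + a + 2)"
      have "exec ?C (tapes_of r s) ?t (tapes_of r (f s))" for r
      proof -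
        obtain ts where ts: "exec (compare_com i j) (tapes_of r s) ?t1 ts" "read_tape (ts j) \<ge> 3"
          "exec (restore_com i j) ts ?t2 (tapes_of r s)"
          using cmp[of r] True by blast
        show ?thesis
          by (rule exec_Seq[OF ts(1) exec_CondT[where P = "\<lambda>s. s \<ge> 3", OF ts(2)
                  exec_Seq[OF ts(3) execsD(1)[OF a(2)]]]])
      qed
      moreover have "length (fst (f s l)) \<le> length (fst (s l)) + ?t" for l
        using execsD(3)[OF a(2), of l] by linarith
      ultimately have "execs ?C s ?t (f s)"
        using execsD(2)[OF a(2)] by (intro execsI)
      moreover have "?t \<le> poly (p + q + [:17, 18:]) N"
        using a(1) N by simp
      moreover have eq: "(if snd (s i) = snd (s j) then f s else g s) = f s"
        using True by (simp only: uh vk snd_conv refl if_True if_False)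
      ultimately show ?thesis
        unfolding eq by (intro exI[of _ ?t] conjI)
    next
      case False
      let ?t = "?t1 + (?t2 + b + 1)"
      have "exec ?C (tapes_of r s) ?t (tapes_of r (g s))" for r
      proof -
        obtain ts where ts: "exec (compare_com i j) (tapes_of r s) ?t1 ts" "\<not> read_tape (ts j) \<ge> 3"
          "exec (restore_com i j) ts ?t2 (tapes_of r s)"
          using cmp[of r] False by blast
        show ?thesis
          by (rule exec_Seq[OF ts(1) exec_CondF[where P = "\<lambda>s. s \<ge> 3", OF ts(2)
                  exec_Seq[OF ts(3) execsD(1)[OF b(2)]]]])
      qed
      moreover have "length (fst (g s l)) \<le> length (fst (s l)) + ?t" for l
        using execsD(3)[OF b(2), of l] by linarith
      ultimately have "execs ?C s ?t (g s)"
        using execsD(2)[OF b(2)] by (intro execsI)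
      moreover have "?t \<le> poly (p + q + [:17, 18:]) N"
        using b(1) N by simp
      moreover have eq: "(if snd (s i) = snd (s j) then f s else g s) = g s"
        using False by (simp only: uh vk snd_conv refl if_True if_False)
      ultimately show ?thesis
        unfolding eq by (intro exI[of _ ?t] conjI)
    qed
  qed (use c d in auto)
qed

text \<open>In contrast to \<open>realizable\<close>, no tape has to keep its length and the bound
  may involve every tape. Such programs are sequenced but not put into loops; the notion joins
  phases in which different tapes grow.\<close>

definition feasible :: "(mem \<Rightarrow> mem) \<Rightarrow> bool" where
  "feasible f \<longleftrightarrow> (\<exists>c. com_ok c \<and> (\<exists>p :: nat poly. \<forall>s N. wf_mem s \<longrightarrow>
     (\<forall>i. length (fst (s i)) \<le> N) \<longrightarrow> (\<exists>t \<le> poly p N. execs c s t (f s))))"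

lemma feasibleI:
  assumes "com_ok c"
    and "\<And>s N. wf_mem s \<Longrightarrow> \<forall>i. length (fst (s i)) \<le> N \<Longrightarrow> \<exists>t \<le> poly p N. execs c s t (f s)"
  shows "feasible f"
  unfolding feasible_def using assms by blast

lemma feasibleE:
  assumes "feasible f"
  obtains c and p :: "nat poly" where "com_ok c"
    and "\<And>s N. wf_mem s \<Longrightarrow> \<forall>i. length (fst (s i)) \<le> N \<Longrightarrow> \<exists>t \<le> poly p N. execs c s t (f s)"
proof -
  obtain c p where "com_ok c" "\<forall>s N. wf_mem s \<longrightarrow> (\<forall>i. length (fst (s i)) \<le> N) \<longrightarrow>
      (\<exists>t \<le> poly p N. execs c s t (f s))"
    using assms unfolding feasible_def by (elim exE conjE)
  then show ?thesis
    by (intro that[of c p]) simp_all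
qed

lemma realizable_feasible:
  assumes "realizable Z f"
  shows "feasible f"
proof -
  obtain c p where "realizes Z f c p"
    using assms unfolding realizable_def by blast
  note c = realizesD[OF this]
  show ?thesis
  proof (rule feasibleI[where c = c and p = p])
    fix s N assume "wf_mem s" "\<forall>i. length (fst (s i)) \<le> N"
    then show "\<exists>t\<le>poly p N. execs c s t (f s)"
      using c(2)[of s N] by blast
  qed (rule c(1))
qed

lemma feasible_comp:
  assumes "feasible f" "feasible g"
  shows "feasible (\<lambda>s. g (f s))"
proof -
  obtain c p where c: "com_ok c" "\<And>s N. wf_mem s \<Longrightarrow> \<forall>i. length (fst (s i)) \<le> N \<Longrightarrow>
      \<exists>t \<le> poly p N. execs c s t (f s)"
    using feasibleE[OF assms(1)] by blast
  obtain d q where d: "com_ok d" "\<And>s N. wf_mem s \<Longrightarrow> \<forall>i. length (fst (s i)) \<le> N \<Longrightarrow>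
      \<exists>t \<le> poly q N. execs d s t (g s)"
    using feasibleE[OF assms(2)] by blast
  show ?thesis
  \<comment> \<open>After the first program every word has length at most
    \<open>N + poly p N\<close>, hence the substitution into \<open>q\<close>.\<close>
  proof (rule feasibleI[where c = "Seq c d" and p = "p + pcompose q ([:0, 1:] + p)"])
    show "com_ok (Seq c d)"
      using c(1) d(1) by simp
    fix s N assume s: "wf_mem s" "\<forall>i. length (fst (s i)) \<le> N"
    obtain a where a: "a \<le> poly p N" "execs c s a (f s)"
      using c(2)[OF s] by blast
    have "length (fst (f s i)) \<le> N + poly p N" for i
      using execsD(3)[OF a(2), of i] a(1) s(2) by (meson add_mono le_trans)
    then obtain b where b: "b \<le> poly q (N + poly p N)" "execs d (f s) b (g (f s))"
      using d(2)[OF execsD(2)[OF a(2)]] by blast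
    have "execs (Seq c d) s (a + b) (g (f s))"
      by (rule execs_Seq[OF a(2) b(2)])
    moreover have "a + b \<le> poly (p + pcompose q ([:0, 1:] + p)) N"
      using a(1) b(1) by (simp add: poly_pcompose)
    ultimately show "\<exists>t\<le>poly (p + pcompose q ([:0, 1:] + p)) N. execs (Seq c d) s t (g (f s))"
      by blast
  qed
qed

section \<open>Input and output conventions of the machines\<close>

definition move_com :: com where
  "move_com = Loop 0 (\<lambda>s. s \<noteq> 0) (Seq
     (Cond 0 (\<lambda>s. s = 2) (Act 1 (\<lambda>_. 2) MoveRight) (Act 1 (\<lambda>_. 1) MoveRight))
     (Act 0 (\<lambda>_. 0) MoveRight))"

text \<open>The machine finds its input on tape 0, which is also the output tape, and the programs
  below start with an empty output. Erasing the input from left to right leaves an empty word whose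
  origin has moved behind the input. A letter costs at most 6 steps: 2 for the loop, 3 for the copy,
  1 for the erasure.\<close>

lemma exec_move:
  "\<exists>t \<le> 6 * length v + 1. exec move_com
     (tapes_of (r(0 := k)) (s(0 := (v, 0), 1 := (u, length u)))) t
     (tapes_of (r(0 := k + int (length v))) (s(0 := ([], 0), 1 := (u @ v, length (u @ v)))))"
proof (induction v arbitrary: k u)
  case Nil
  have "exec move_com (tapes_of (r(0 := k)) (s(0 := ([], 0), 1 := (u, length u)))) 1
     (tapes_of (r(0 := k)) (s(0 := ([], 0), 1 := (u, length u))))"
    unfolding move_com_def by (intro exec_LoopF) (simp add: symb_def)
  moreover have "k + int (length []) = k" "u @ [] = u" "1 \<le> 6 * length [] + (1 :: nat)"
    by simp_all
  ultimately show ?case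
    by metis
next
  case (Cons x v)
  let ?C = "Cond 0 (\<lambda>s. s = 2) (Act 1 (\<lambda>_. 2) MoveRight) (Act 1 (\<lambda>_. 1) MoveRight)"
  define T where "T = tapes_of (r(0 := k)) (s(0 := (x # v, 0), 1 := (u, length u)))"
  define T1 where "T1 = T(1 := tape_of (r 1) (u @ [x], length (u @ [x])))"
  define T2 where "T2 = tapes_of (r(0 := k + 1)) (s(0 := (v, 0), 1 := (u @ [x], length (u @ [x]))))"
  have T0: "T 0 = tape_of k (x # v, 0)" and T_1: "T 1 = tape_of (r 1) (u, length u)"
    by (simp_all add: T_def)
  have rd: "read_tape (T 0) = bit_symbol x"
    by (simp add: T0 symb_def)
  have act: "exec (Act 1 (\<lambda>_. bit_symbol x) MoveRight) T 1 T1"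
    using exec_Act[of 1 "\<lambda>_. bit_symbol x" MoveRight T] act_app[of x "r 1" u]
    by (simp add: T1_def T_1[simplified])
  have 1: "\<exists>t \<le> 3. exec ?C T t T1"
  proof (cases x)
    case True
    then show ?thesis
      using exec_CondT[where P = "\<lambda>s. s = 2" and i = 0 and ts = T] act rd
      by (intro exI[of _ "1 + 2"]) (simp add: bit_symbol_def)
  next
    case False
    then show ?thesis
      using exec_CondF[where P = "\<lambda>s. s = 2" and i = 0 and ts = T] act rd
      by (intro exI[of _ "1 + 1"]) (simp add: bit_symbol_def)
  qed
  have "nat (y - k) - Suc 0 = nat (y - (k + 1))" for y
    by simp
  then have "act_tape (0, MoveRight) (tape_of k (x # v, 0)) = tape_of (k + 1) (v, 0)"
    by (auto simp: tape_of_def fun_eq_iff nth_Cons')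
  then have "T1(0 := act_tape (0, MoveRight) (T1 0)) = T2"
    by (auto simp: T1_def T2_def T_def tapes_of_def fun_eq_iff)
  then have 2: "exec (Act 0 (\<lambda>_. 0) MoveRight) T1 1 T2"
    using exec_Act[of 0 "\<lambda>_. 0" MoveRight T1] by simp
  obtain a where a: "a \<le> 3" "exec ?C T a T1"
    using 1 by blast
  obtain t where t: "t \<le> 6 * length v + 1" "exec move_com T2 t
     (tapes_of (r(0 := k + 1 + int (length v)))
       (s(0 := ([], 0), 1 := ((u @ [x]) @ v, length ((u @ [x]) @ v)))))"
    unfolding T2_def using Cons.IH[of "k + 1" "u @ [x]"] by blast
  have "exec move_com T ((a + 1) + t + 2) (tapes_of (r(0 := k + 1 + int (length v)))
       (s(0 := ([], 0), 1 := ((u @ [x]) @ v, length ((u @ [x]) @ v)))))"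
    using exec_LoopT[where P = "\<lambda>s. s \<noteq> 0", OF _ exec_Seq[OF a(2) 2] t(2)[unfolded move_com_def]] rd
    unfolding move_com_def by simp
  moreover have "k + 1 + int (length v) = k + int (length (x # v))" "(u @ [x]) @ v = u @ x # v"
    by simp_all
  moreover have "(a + 1) + t + 2 \<le> 6 * length (x # v) + 1"
    using a(1) t(1) by simp
  ultimately show ?case
    unfolding T_def by metis
qed

lemma feasible_polytime:
  assumes "feasible f"
  shows "polytime_computable (\<lambda>w. fst (f (\<lambda>i. if i = 1 then (w, length w) else ([], 0)) 0))"
proof -
  obtain c p where c: "com_ok c" "\<And>s N. wf_mem s \<Longrightarrow> \<forall>i. length (fst (s i)) \<le> N \<Longrightarrow>
      \<exists>t \<le> poly p N. execs c s t (f s)"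
    using feasibleE[OF assms] by blast
  show ?thesis
  \<comment> \<open>The move costs at most \<open>6 * length w + 1\<close>. Tape 0 is empty when the
    main program starts, so the output has at most as many letters as that program has steps, and
    the final rewind costs at most three times this number plus 3.\<close>
  proof (rule polytime_computableI[where c = "Seq move_com (Seq c (rew_com 0))" and p = "[:4, 6:] + smult 4 p"])
    show "com_ok (Seq move_com (Seq c (rew_com 0)))"
      using c(1) by (simp add: com_ok_rew move_com_def)
    fix w :: "bool list"
    define r :: "nat \<Rightarrow> int" where "r = (\<lambda>_. 0)"
    define r' :: "nat \<Rightarrow> int" where "r' = r(0 := int (length w))"
    define s :: mem where "s = (\<lambda>i. if i = 1 then (w, length w) else ([], 0))"
    let ?ts = "\<lambda>i::nat. if i = 0 then word_tape w else word_tape []"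
    have "?ts = tapes_of (r(0 := 0)) ((\<lambda>_. ([], 0))(0 := (w, 0), 1 := ([], length ([] :: bool list))))"
      by (auto simp: tapes_of_def r_def tape_of_def word_tape_def fun_eq_iff)
    moreover have "tapes_of (r(0 := 0 + int (length w)))
        ((\<lambda>_. ([], 0))(0 := ([], 0), 1 := ([] @ w, length ([] @ w)))) = tapes_of r' s"
      by (auto simp: tapes_of_def r'_def s_def fun_eq_iff)
    ultimately obtain a where a: "a \<le> 6 * length w + 1" "exec move_com ?ts a (tapes_of r' s)"
      using exec_move[of w r 0 "\<lambda>_. ([], 0)" "[]"] by metis
    have "wf_mem s" "\<forall>i. length (fst (s i)) \<le> length w"
      by (auto simp: s_def wf_mem_def)
    then obtain b where b: "b \<le> poly p (length w)" "execs c s b (f s)"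
      using c(2) by blast
    have wf: "wf_mem (f s)"
      by (rule execsD(2)[OF b(2)])
    then have "snd (f s 0) \<le> length (fst (f s 0))"
      by (simp add: wf_mem_def)
    also have "\<dots> \<le> b"
      using execsD(3)[OF b(2), of 0] by (simp add: s_def)
    finally have h: "snd (f s 0) \<le> b" .
    have rew: "execs (rew_com 0) (f s) (3 * snd (f s 0) + 3) (rew 0 (f s))"
      by (rule execs_rew[OF wf])
    let ?t = "a + (b + (3 * snd (f s 0) + 3))"
    have "exec (Seq move_com (Seq c (rew_com 0))) ?ts ?t (tapes_of r' (rew 0 (f s)))"
      by (intro exec_Seq[OF a(2)] exec_Seq[OF execsD(1)[OF b(2)]] execsD(1)[OF rew])
    moreover have "?t \<le> poly ([:4, 6:] + smult 4 p) (length w)"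
      using a(1) b(1) h by simp
    moreover have "tape_output (tapes_of r' (rew 0 (f s)) 0) (fst (f s 0))"
      by (auto simp: tape_output_def rew_def tape_of_def)
    ultimately show "\<exists>t ts. t \<le> poly ([:4, 6:] + smult 4 p) (length w) \<and>
        exec (Seq move_com (Seq c (rew_com 0))) ?ts t ts \<and>
        tape_output (ts 0) (fst (f (\<lambda>i. if i = 1 then (w, length w) else ([], 0)) 0))"
      unfolding s_def by blast
  qed
qed

section \<open>First-order tests on tables\<close>

text \<open>Memories are functions; without this, eta-expanded updates would be unfolded into conditionals.\<close>

declare fun_upd_apply [simp del] fun_upd_same [simp] fun_upd_other [simp]

section \<open>Loops as folds over abstract states\<close>

primrec fold_until :: "('a \<Rightarrow> 'm \<Rightarrow> 'm) \<Rightarrow> ('m \<Rightarrow> bool) \<Rightarrow> 'a list \<Rightarrow> 'm \<Rightarrow> 'm" where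
  "fold_until st br [] m = m"
| "fold_until st br (a # as) m = (if br (st a m) then st a m else fold_until st br as (st a m))"

lemma fold_until_never: "fold_until st (\<lambda>_. False) as m = fold st as m"
  by (induction as arbitrary: m) auto

text \<open>\<open>J\<close> represents an abstract state as a memory whose loop tape is rewound.
  The memory has to be examined for a single round at position \<open>a\<close> only; the whole loop
  is then a computation on abstract states. On a counter of length \<open>n\<close> the positions
  are exactly the elements of the domain.\<close>

lemma for_until_sim:
  assumes J: "\<And>m. J m i = (u, 0)"
    and st: "\<And>a m. a < length u \<Longrightarrow> f ((J m)(i := (u, a))) = (J (st a m))(i := (u, a))"
    and br: "\<And>a m. a < length u \<Longrightarrow> P (symb (((J m)(i := (u, a))) j)) \<longleftrightarrow> br m"
  shows "for_until i j P f (J m) = J (fold_until st br [0..<length u] m)"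
proof -
  let ?n = "length u" let ?B = "\<lambda>s :: mem. P (symb (s j))"
  \<comment> \<open>The induction is on the number of remaining positions; the head position
    \<open>x\<close> at the exit is forgotten by the final rewind.\<close>
  have "\<exists>x. loop_from i ?B f k ((J m)(i := (u, ?n - k))) =
      (J (fold_until st br [?n - k..<?n] m))(i := (u, x))" if "k \<le> ?n" for k m
    using that
  proof (induction k arbitrary: m)
    case 0
    then show ?case by auto
  next
    case (Suc k)
    let ?a = "?n - Suc k"
    have a: "?a < ?n" "Suc ?a = ?n - k"
      using Suc.prems by auto
    have upt: "[?a..<?n] = ?a # [?n - k..<?n]"
      using a by (simp add: upt_conv_Cons)
    have f: "f ((J m)(i := (u, ?a))) = (J (st ?a m))(i := (u, ?a))"
      using st[OF a(1)] .
    show ?case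
    proof (cases "br (st ?a m)")
      case True
      then have "?B (f ((J m)(i := (u, ?a))))"
        unfolding f using br[OF a(1)] by blast
      then have "loop_from i ?B f (Suc k) ((J m)(i := (u, ?a))) = (J (st ?a m))(i := (u, ?n))"
        unfolding loop_from.simps f by simp
      moreover have "fold_until st br [?a..<?n] m = st ?a m"
        using True upt by simp
      ultimately show ?thesis
        by metis
    next
      case False
      then have "\<not> ?B (f ((J m)(i := (u, ?a))))"
        unfolding f using br[OF a(1)] by blast
      then have "loop_from i ?B f (Suc k) ((J m)(i := (u, ?a))) =
          loop_from i ?B f k ((J (st ?a m))(i := (u, ?n - k)))"
        unfolding loop_from.simps f using a(2) by simp
      moreover have "fold_until st br [?a..<?n] m = fold_until st br [?n - k..<?n] (st ?a m)"
        using False upt by simp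
      ultimately show ?thesis
        using Suc.IH[of "st ?a m"] Suc.prems by (metis Suc_leD)
    qed
  qed
  from this[of ?n m] obtain x where x: "loop_from i ?B f ?n ((J m)(i := (u, 0))) =
      (J (fold_until st br [0..<?n] m))(i := (u, x))"
    by auto
  have "rew i (J m) = (J m)(i := (u, 0))"
    by (simp add: rew_def J)
  then have "for_until i j P f (J m) = rew i ((J (fold_until st br [0..<?n] m))(i := (u, x)))"
    unfolding for_until_def using x by (simp add: J)
  also have "\<dots> = J (fold_until st br [0..<?n] m)"
    by (simp add: rew_def J fun_upd_idem)
  finally show ?thesis .
qed

lemma for_all_sim:
  assumes "\<And>m. J m i = (u, 0)"
    and "\<And>a m. a < length u \<Longrightarrow> f ((J m)(i := (u, a))) = (J (st a m))(i := (u, a))"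
  shows "for_all i f (J m) = J (fold st [0..<length u] m)"
  unfolding for_all_def
  using for_until_sim[of J i u f st "\<lambda>_. False" i "\<lambda>_. False" m, OF assms]
  by (simp add: fold_until_never)

primrec nest :: "nat list \<Rightarrow> (mem \<Rightarrow> mem) \<Rightarrow> mem \<Rightarrow> mem" where
  "nest [] f = f"
| "nest (i # is) f = for_all i (nest is f)"

fun set_heads :: "bool list \<Rightarrow> nat list \<Rightarrow> nat list \<Rightarrow> mem \<Rightarrow> mem" where
  "set_heads u (i # is) (x # xs) s = set_heads u is xs (s(i := (u, x)))"
| "set_heads u _ _ s = s"

lemma set_heads_other: "j \<notin> set is \<Longrightarrow> set_heads u is xs s j = s j"
  by (induction u "is" xs s rule: set_heads.induct) auto

lemma set_heads_upd: "j \<notin> set is \<Longrightarrow> set_heads u is xs (s(j := y)) = (set_heads u is xs s)(j := y)"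
  by (induction u "is" xs s rule: set_heads.induct) (auto simp: fun_upd_twist)

lemma all_tuples_0 [simp]: "all_tuples n 0 = [[]]"
  by (simp add: all_tuples_def)

lemma all_tuples_Suc: "all_tuples n (Suc k) = concat (map (\<lambda>x. map (Cons x) (all_tuples n k)) [0..<n])"
  by (simp add: all_tuples_def)

lemma set_all_tuples: "set (all_tuples n k) = tuples {..<n} k"
proof (induction k)
  case (Suc k)
  then show ?case
    by (auto simp: all_tuples_Suc tuples_def length_Suc_conv)
qed (auto simp: tuples_def)

lemma fold_concat: "fold f (concat xss) = fold (fold f) xss"
  by (induction xss) auto

text \<open>Nested loops run through the positions in lexicographic order. This is the order of
  \<open>all_tuples\<close>, hence of the stored tables and of the encoding, so that a table can be
  read or written in step with the loops.\<close>

lemma nest_sim: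
  assumes "distinct is" and "\<And>m i. i \<in> set is \<Longrightarrow> J m i = (u, 0)"
    and "\<And>xs m. xs \<in> tuples {..<length u} (length is) \<Longrightarrow>
      f (set_heads u is xs (J m)) = set_heads u is xs (J (st xs m))"
  shows "nest is f (J m) = J (fold st (all_tuples (length u) (length is)) m)"
  using assms
proof (induction "is" arbitrary: J st m)
  case Nil
  then show ?case
    by (simp add: tuples_def)
next
  case (Cons i "is")
  have "nest is f ((J m)(i := (u, a))) =
      (J (fold (\<lambda>xs. st (a # xs)) (all_tuples (length u) (length is)) m))(i := (u, a))"
    if a: "a < length u" for a m
  proof (rule Cons.IH[where J = "\<lambda>m. (J m)(i := (u, a))"])
    show "((J m)(i := (u, a))) j = (u, 0)" if "j \<in> set is" for m j
      using Cons.prems(1,2) that by (auto simp: fun_upd_apply)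
    show "f (set_heads u is xs ((J m)(i := (u, a)))) = set_heads u is xs ((J (st (a # xs) m))(i := (u, a)))"
      if "xs \<in> tuples {..<length u} (length is)" for xs m
      using Cons.prems(3)[of "a # xs" m] a that by (auto simp: tuples_def)
  qed (use Cons.prems in auto)
  then have "nest (i # is) f (J m) = J (fold
      (\<lambda>a. fold (\<lambda>xs. st (a # xs)) (all_tuples (length u) (length is))) [0..<length u] m)"
    unfolding nest.simps using Cons.prems by (intro for_all_sim) auto
  also have "(\<lambda>a. fold (\<lambda>xs. st (a # xs)) (all_tuples (length u) (length is))) =
      fold st \<circ> (\<lambda>a. map (Cons a) (all_tuples (length u) (length is)))"
    by (simp add: fun_eq_iff fold_map o_def)
  finally show ?case
    by (simp add: all_tuples_Suc fold_concat fold_map o_def)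
qed

lemma keeps_comp: "keeps f x \<Longrightarrow> keeps g x \<Longrightarrow> keeps (\<lambda>s. g (f s)) x"
  by (simp add: keeps_def)

lemma keeps_if: "keeps f x \<Longrightarrow> keeps g x \<Longrightarrow> keeps (\<lambda>s. if b s then f s else g s) x"
  by (simp add: keeps_def)

lemma keeps_id: "keeps (\<lambda>s. s) x"
  by (simp add: keeps_def)

lemma keeps_prims: "x \<noteq> i \<Longrightarrow> keeps (mvr i) x" "x \<noteq> i \<Longrightarrow> keeps (rew i) x" "x \<noteq> i \<Longrightarrow> keeps (put i b) x"
  "x \<noteq> i \<Longrightarrow> keeps (app i b) x"
  by (simp_all add: keeps_def mvr_def rew_def put_def app_def)

lemma keeps_for_until:
  assumes "keeps f x" "x \<noteq> i"
  shows "keeps (for_until i j P f) x"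
proof -
  have "loop_from i B f k s x = s x" for B k s
    using assms by (induction k arbitrary: s) (simp_all add: keepsD)
  then show ?thesis
    using assms(2) by (simp add: keeps_def for_until_def rew_def)
qed

lemma keeps_for_all: "keeps f x \<Longrightarrow> x \<noteq> i \<Longrightarrow> keeps (for_all i f) x"
  by (simp add: for_all_def keeps_for_until)

lemma keeps_nest: "keeps f x \<Longrightarrow> x \<notin> set is \<Longrightarrow> keeps (nest is f) x"
  by (induction "is") (auto intro: keeps_for_all)

lemma keeps_while_true:
  assumes "keeps f x"
  shows "keeps (while_true i f) x"
proof -
  have "(f ^^ k) s x = s x" for k s
    using assms by (induction k) (simp_all add: keepsD)
  then show ?thesis
    by (simp add: keeps_def while_true_def)
qed

lemma realizable_nest:
  "realizable Z f \<Longrightarrow> set is \<subseteq> Z \<Longrightarrow> distinct is \<Longrightarrow> (\<And>i. i \<in> set is \<Longrightarrow> keeps f i) \<Longrightarrow>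
    realizable Z (nest is f)"
proof (induction "is")
  case (Cons i "is")
  then show ?case
    unfolding nest.simps by (intro realizable_for_all keeps_nest) auto
qed simp

text \<open>Tape 0 holds the output, tape 1 the input, tape 2 a one-letter flag with the result of the last
  test, and tape \<open>3 + t\<close> the characteristic table of a relation of arity \<open>ar ! t\<close>.  The other tapes are
  counters: their word is \<open>True\<close> repeated \<open>n\<close> times and the head position is the value.\<close>

locale layout =
  fixes ar :: "nat list"
begin

definition cn :: "nat \<Rightarrow> nat" where
  "cn j = 3 + length ar + j"

text \<open>\<open>v\<close> is the valuation of the variables in scope; the counters after them are
  rewound and free to serve as loop variables. \<open>K\<close> is the number of counters under
  control, which each program may choose as large as it needs.\<close>

definition good :: "nat \<Rightarrow> nat \<Rightarrow> (nat \<Rightarrow> nat list set) \<Rightarrow> nat list \<Rightarrow> mem \<Rightarrow> bool" where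
  "good K n I v s \<longleftrightarrow> (\<exists>b. s 2 = ([b], 0)) \<and>
     (\<forall>t < length ar. s (3 + t) = (map (\<lambda>xs. xs \<in> I t) (all_tuples n (ar ! t)), 0)) \<and>
     (\<forall>j < K. s (cn j) = (replicate n True, if j < length v then v ! j else 0))"

lemma cn_simps [simp]: "cn i = cn j \<longleftrightarrow> i = j" "cn i \<noteq> 0" "cn i \<noteq> 1" "cn i \<noteq> Suc 0" "cn i \<noteq> 2" "cn i \<noteq> Suc (Suc 0)"
  "0 \<noteq> cn i" "1 \<noteq> cn i" "Suc 0 \<noteq> cn i" "2 \<noteq> cn i"
  "t < length ar \<Longrightarrow> cn i \<noteq> 3 + t" "t < length ar \<Longrightarrow> 3 + t \<noteq> cn i"
  by (auto simp: cn_def)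

lemma goodD:
  assumes "good K n I v s"
  shows "\<exists>b. s 2 = ([b], 0)"
    and "t < length ar \<Longrightarrow> s (3 + t) = (map (\<lambda>xs. xs \<in> I t) (all_tuples n (ar ! t)), 0)"
    and "j < K \<Longrightarrow> s (cn j) = (replicate n True, if j < length v then v ! j else 0)"
  using assms by (auto simp: good_def)

lemma good_mono: "good K n I v s \<Longrightarrow> K' \<le> K \<Longrightarrow> good K' n I v s"
  by (auto simp: good_def)

lemma good_flag: "good K n I v s \<Longrightarrow> good K n I v (s(2 := ([b], 0)))"
  by (auto simp: good_def)

lemma good_push:
  assumes "good K n I v s"
  shows "good K n I (v @ [a]) (s(cn (length v) := (replicate n True, a)))"
  using assms by (auto simp: good_def nth_append fun_upd_apply)

lemma good_set_heads:
  assumes "good K n I v s"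
  shows "good K n I (v @ xs) (set_heads (replicate n True) (map cn [length v..<length v + length xs]) xs s)"
  using assms
proof (induction xs arbitrary: v s)
  case (Cons x xs)
  have "[length v..<length v + length (x # xs)] = length v # [length (v @ [x])..<length (v @ [x]) + length xs]"
    by (simp add: upt_conv_Cons del: upt_Suc)
  then show ?case
    using Cons.IH[OF good_push[OF Cons.prems, of x]] by (simp del: upt_Suc)
qed simp

lemma put_flag: "good K n I v s \<Longrightarrow> put 2 b s = s(2 := ([b], 0))"
  using goodD(1) by (fastforce simp: put_def)

text \<open>The first \<open>d\<close> counters are the free variables. They must be kept on all
  memories, not only on good ones, because the loops that may surround the test require this
  unconditionally. Tape 0 is excluded from the tapes of constant length so that tests can be
  combined with programs that append to the output.\<close>

definition tests :: "nat \<Rightarrow> (nat \<Rightarrow> (nat \<Rightarrow> nat list set) \<Rightarrow> nat list \<Rightarrow> bool) \<Rightarrow> (mem \<Rightarrow> mem) \<Rightarrow> nat \<Rightarrow> bool"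
  where "tests d P f K \<longleftrightarrow> realizable (- {0}) f \<and> (\<forall>j < d. keeps f (cn j)) \<and>
     (\<forall>s n I v. good K n I v s \<longrightarrow> v \<in> tuples {..<n} d \<longrightarrow> f s = s(2 := ([P n I v], 0)))"

definition testable :: "nat \<Rightarrow> (nat \<Rightarrow> (nat \<Rightarrow> nat list set) \<Rightarrow> nat list \<Rightarrow> bool) \<Rightarrow> bool" where
  "testable d P \<longleftrightarrow> (\<exists>f K. tests d P f K)"

lemma testableI:
  assumes "realizable (- {0}) f" "\<And>j. j < d \<Longrightarrow> keeps f (cn j)"
    and "\<And>s n I v. good K n I v s \<Longrightarrow> v \<in> tuples {..<n} d \<Longrightarrow> f s = s(2 := ([P n I v], 0))"
  shows "testable d P"
  unfolding testable_def tests_def using assms by blast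

lemma testsD:
  assumes "tests d P f K"
  shows "realizable (- {0}) f" "\<And>j. j < d \<Longrightarrow> keeps f (cn j)"
    and "\<And>s n I v. good K n I v s \<Longrightarrow> v \<in> tuples {..<n} d \<Longrightarrow> f s = s(2 := ([P n I v], 0))"
  using assms by (simp_all add: tests_def)

lemma testable_cong:
  assumes "testable d P" "\<And>n I v. v \<in> tuples {..<n} d \<Longrightarrow> P n I v = Q n I v"
  shows "testable d Q"
proof -
  obtain f K where "tests d P f K"
    using assms(1) unfolding testable_def by blast
  note f = testsD[OF this]
  show ?thesis
    by (rule testableI[OF f(1,2), of d K]) (use f(3) assms(2) in auto)
qed

section \<open>Testable properties are closed under the first-order connectives\<close>

lemma testable_const: "testable d (\<lambda>n I v. b)"
  by (rule testableI[of "put 2 b" _ 0]) (auto simp: realizable_put put_flag keeps_prims)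

lemma testable_not:
  assumes "testable d P"
  shows "testable d (\<lambda>n I v. \<not> P n I v)"
proof -
  obtain f K where "tests d P f K"
    using assms(1) unfolding testable_def by blast
  note f = testsD[OF this]
  show ?thesis
  proof (rule testableI[where K = K])
    show "realizable (- {0}) (\<lambda>s. (\<lambda>s. if symb (s 2) = 2 then put 2 False s else put 2 True s) (f s))"
      by (rule realizable_comp[OF f(1) realizable_symb[where P = "\<lambda>s. s = 2", OF realizable_put realizable_put]])
    show "keeps (\<lambda>s. (\<lambda>s. if symb (s 2) = 2 then put 2 False s else put 2 True s) (f s)) (cn j)" if "j < d" for j
      by (rule keeps_comp[OF f(2)[OF that] keeps_if]) (auto intro: keeps_prims)
  qed (auto simp: f(3) symb_def put_def)
qed

lemma testable_conj:
  assumes "testable d P" "testable d Q"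
  shows "testable d (\<lambda>n I v. P n I v \<and> Q n I v)"
proof -
  obtain f K where "tests d P f K"
    using assms(1) unfolding testable_def by blast
  note f = testsD[OF this]
  obtain g L where "tests d Q g L"
    using assms(2) unfolding testable_def by blast
  note g = testsD[OF this]
  show ?thesis
  proof (rule testableI[where K = "max K L"])
    show "realizable (- {0}) (\<lambda>s. (\<lambda>s. if symb (s 2) = 2 then g s else s) (f s))"
      by (rule realizable_comp[OF f(1) realizable_symb[where P = "\<lambda>s. s = 2", OF g(1) realizable_id]])
    show "keeps (\<lambda>s. (\<lambda>s. if symb (s 2) = 2 then g s else s) (f s)) (cn j)" if "j < d" for j
      by (rule keeps_comp[OF f(2)[OF that] keeps_if[OF g(2)[OF that] keeps_id]])
    fix s n I v assume s: "good (max K L) n I v s" "v \<in> tuples {..<n} d"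
    have fs: "f s = s(2 := ([P n I v], 0))"
      using f(3)[OF good_mono[OF s(1)] s(2)] by simp
    have gs: "g (s(2 := ([b], 0))) = s(2 := ([Q n I v], 0))" for b
      using g(3)[OF good_mono[OF good_flag[OF s(1)]] s(2)] by simp
    show "(\<lambda>s. if symb (s 2) = 2 then g s else s) (f s) = s(2 := ([P n I v \<and> Q n I v], 0))"
      by (cases "P n I v") (simp_all add: fs gs symb_def)
  qed
qed

lemma testable_disj:
  assumes "testable d P" "testable d Q"
  shows "testable d (\<lambda>n I v. P n I v \<or> Q n I v)"
  using testable_not[OF testable_conj[OF testable_not[OF assms(1)] testable_not[OF assms(2)]]] by simp

lemma testable_bex:
  "(\<And>x. x \<in> set xs \<Longrightarrow> testable d (P x)) \<Longrightarrow> testable d (\<lambda>n I v. \<exists>x\<in>set xs. P x n I v)"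
proof (induction xs)
  case (Cons x xs)
  then show ?case
    using testable_disj[of d "P x" "\<lambda>n I v. \<exists>x\<in>set xs. P x n I v"] by simp
qed (use testable_const[of d False] in simp)

lemma testable_ball:
  "(\<And>x. x \<in> set xs \<Longrightarrow> testable d (P x)) \<Longrightarrow> testable d (\<lambda>n I v. \<forall>x\<in>set xs. P x n I v)"
proof (induction xs)
  case (Cons x xs)
  then show ?case
    using testable_conj[of d "P x" "\<lambda>n I v. \<forall>x\<in>set xs. P x n I v"] by simp
qed (use testable_const[of d True] in simp)

lemma fold_until_found: "fold_until (\<lambda>a _. P a) (\<lambda>b. b) as b \<longleftrightarrow> (if as = [] then b else \<exists>a\<in>set as. P a)"
  by (induction as arbitrary: b) auto

text \<open>Counter \<open>d\<close>, the first one not in use, becomes the loop variable of a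
  search that stops at the first witness. The flag is cleared beforehand because on an empty domain
  the loop body never runs.\<close>

lemma testable_ex:
  assumes "testable (Suc d) P"
  shows "testable d (\<lambda>n I v. \<exists>a < n. P n I (v @ [a]))"
proof -
  obtain f K where "tests (Suc d) P f K"
    using assms(1) unfolding testable_def by blast
  note f = testsD[OF this]
  let ?g = "for_until (cn d) 2 (\<lambda>s. s = 2) f"
  show ?thesis
  proof (rule testableI[where K = "max K (Suc d)"])
    show "realizable (- {0}) (\<lambda>s. ?g (put 2 False s))"
      by (intro realizable_comp[OF realizable_put] realizable_for_until f) auto
    show "keeps (\<lambda>s. ?g (put 2 False s)) (cn j)" if "j < d" for j
      using that by (intro keeps_comp[OF keeps_prims(3) keeps_for_until] f) auto
    fix s n I v assume s: "good (max K (Suc d)) n I v s" "v \<in> tuples {..<n} d"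
    let ?J = "\<lambda>b. s(2 := ([b], 0))"
    let ?u = "replicate n True"
    have d: "length v = d"
      using s(2) by (simp add: tuples_def)
    have "?g (?J False) = ?J (fold_until (\<lambda>a _. P n I (v @ [a])) (\<lambda>b. b) [0..<length ?u] False)"
    proof (rule for_until_sim)
      show "?J b (cn d) = (?u, 0)" for b
        using goodD(3)[OF s(1), of d] d by simp
      show "f ((?J b)(cn d := (?u, a))) = (?J (P n I (v @ [a])))(cn d := (?u, a))"
        if "a < length ?u" for a b
      proof -
        have "good K n I (v @ [a]) ((?J b)(cn d := (?u, a)))"
          using good_push[OF good_flag[OF good_mono[OF s(1), of K]]] d by simp
        moreover have "v @ [a] \<in> tuples {..<n} (Suc d)"
          using s(2) that by (auto simp: tuples_def)
        ultimately show ?thesis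
          using f(3) by (simp add: fun_upd_twist)
      qed
    qed (simp add: symb_def)
    moreover have "fold_until (\<lambda>a _. P n I (v @ [a])) (\<lambda>b. b) [0..<length ?u] False \<longleftrightarrow>
        (\<exists>a < n. P n I (v @ [a]))"
      unfolding fold_until_found by auto
    ultimately show "?g (put 2 False s) = s(2 := ([\<exists>a < n. P n I (v @ [a])], 0))"
      unfolding put_flag[OF s(1)] by simp
  qed
qed

lemma testable_ex_tuple:
  "testable (d + k) P \<Longrightarrow> testable d (\<lambda>n I v. \<exists>ys\<in>tuples {..<n} k. P n I (v @ ys))"
proof (induction k arbitrary: d)
  case 0
  then show ?case
    by (simp add: tuples_def)
next
  case (Suc k)
  then have "testable (Suc d) (\<lambda>n I v. \<exists>ys\<in>tuples {..<n} k. P n I (v @ ys))"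
    by simp
  then have "testable d (\<lambda>n I v. \<exists>a < n. \<exists>ys\<in>tuples {..<n} k. P n I ((v @ [a]) @ ys))"
    by (rule testable_ex)
  moreover have "(\<exists>a < n. \<exists>ys\<in>tuples {..<n} k. P n I ((v @ [a]) @ ys)) \<longleftrightarrow>
      (\<exists>ys\<in>tuples {..<n} (Suc k). P n I (v @ ys))" for n I v
    by (auto simp: tuples_def length_Suc_conv) (metis insert_subset list.simps(15) lessThan_iff length_Cons append_Cons)+
  ultimately show ?case
    by simp
qed

lemma testable_eq:
  assumes "i < d" "j < d"
  shows "testable d (\<lambda>n I v. v ! i = v ! j)"
proof (cases "i = j")
  case True
  then show ?thesis
    using testable_const[of d True] by simp
next
  case False
  let ?f = "\<lambda>s. if snd (s (cn i)) = snd (s (cn j)) then put 2 True s else put 2 False s"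
  show ?thesis
  proof (rule testableI[where K = d])
    show "realizable (- {0}) ?f"
      using False by (intro realizable_if_eq realizable_put) auto
    show "keeps ?f (cn k)" for k
      by (intro keeps_if keeps_prims) auto
    show "?f s = s(2 := ([v ! i = v ! j], 0))" if "good d n I v s" "v \<in> tuples {..<n} d" for s n I v
      using goodD(3)[OF that(1) assms(1)] goodD(3)[OF that(1) assms(2)] assms that(2)
      by (auto simp: put_flag[OF that(1)] tuples_def)
  qed
qed

primrec if_match :: "(nat \<times> nat) list \<Rightarrow> (mem \<Rightarrow> mem) \<Rightarrow> mem \<Rightarrow> mem" where
  "if_match [] f = f"
| "if_match (p # ps) f = (\<lambda>s. if snd (s (cn (fst p))) = snd (s (cn (snd p))) then if_match ps f s else s)"

lemma if_match_eq: "if_match ps f s = (if \<forall>(i, j)\<in>set ps. snd (s (cn i)) = snd (s (cn j)) then f s else s)"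
  by (induction ps) auto

lemma realizable_if_match:
  "realizable Z f \<Longrightarrow> (\<And>i j. (i, j) \<in> set ps \<Longrightarrow> i \<noteq> j \<and> cn i \<in> Z \<and> cn j \<in> Z) \<Longrightarrow> realizable Z (if_match ps f)"
proof (induction ps)
  case (Cons p ps)
  then show ?case
    unfolding if_match.simps by (cases p) (intro realizable_if_eq realizable_id; auto)
qed simp

lemma keeps_if_match: "keeps f x \<Longrightarrow> keeps (if_match ps f) x"
  by (simp add: keeps_def if_match_eq)

lemma set_heads_match:
  assumes "good K n I v s" "d = length v" "d + k \<le> K" "xs \<in> tuples {..<n} k" "length js = k" "\<forall>j\<in>set js. j < d"
  shows "(\<forall>(i, j)\<in>set (zip [d..<d + k] js). snd (set_heads (replicate n True) (map cn [d..<d + k]) xs s (cn i)) =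
      snd (set_heads (replicate n True) (map cn [d..<d + k]) xs s (cn j))) \<longleftrightarrow> xs = map ((!) v) js"
proof -
  let ?s = "set_heads (replicate n True) (map cn [d..<d + k]) xs s"
  have len: "length xs = k"
    using assms(4) by (simp add: tuples_def)
  have g: "good K n I (v @ xs) ?s"
    using good_set_heads[OF assms(1), of xs] assms(2) len by simp
  have "snd (?s (cn (d + l))) = xs ! l" if "l < k" for l
    using goodD(3)[OF g, of "d + l"] that assms(2,3) len by (simp add: nth_append)
  moreover have "snd (?s (cn (js ! l))) = v ! (js ! l)" if "l < k" for l
  proof -
    have "js ! l < d"
      using assms(5,6) that by auto
    then show ?thesis
      using goodD(3)[OF g, of "js ! l"] assms(2,3) by (simp add: nth_append)
  qed
  moreover have "(\<forall>(i, j)\<in>set (zip [d..<d + k] js). snd (?s (cn i)) = snd (?s (cn j))) \<longleftrightarrow>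
      (\<forall>l<k. snd (?s (cn (d + l))) = snd (?s (cn (js ! l))))"
    using assms(5) by (auto simp: set_zip) (metis add_less_cancel_left nth_upt)+
  ultimately show ?thesis
    using len assms(5) by (auto simp: list_eq_iff_nth_eq)
qed

lemma fold_lookup:
  fixes Q :: "'a \<Rightarrow> bool"
  assumes "w = map Q (pre @ post)"
  shows "fold (\<lambda>x (h, b). (min (Suc h) (length w), b \<or> x = a \<and> h < length w \<and> w ! h)) post (length pre, b) =
    (length w, b \<or> a \<in> set post \<and> Q a)"
  using assms
proof (induction post arbitrary: pre b)
  case (Cons x post)
  have "w = map Q ((pre @ [x]) @ post)"
    using Cons.prems by simp
  from Cons.IH[OF this] show ?case
    using Cons.prems by (auto simp: nth_append min_def)
qed simp

text \<open>No address in the table is computed. The loops run through all tuples while the table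
  head advances one cell per tuple, and the bit under it is consulted only when the loop counters
  agree with the arguments. For a fixed arity this is polynomial.\<close>

lemma testable_rel:
  assumes t: "t < length ar" and "length js = ar ! t" and js: "\<forall>j\<in>set js. j < d"
  shows "testable d (\<lambda>n I v. map ((!) v) js \<in> I t)"
proof -
  define k where "k = length js"
  let ?is = "map cn [d..<d + k]"
  let ?put = "\<lambda>s. if symb (s (3 + t)) = 2 then put 2 True s else s"
  let ?m = "if_match (zip [d..<d + k] js) ?put"
  let ?body = "\<lambda>s. mvr (3 + t) (?m s)"
  let ?f = "\<lambda>s. rew (3 + t) (nest ?is ?body (put 2 False s))"
  have real_body: "realizable (- {0}) ?body"
    using js
    by (intro realizable_comp[OF _ realizable_mvr] realizable_if_match
        realizable_symb[where P = "\<lambda>s. s = 2"] realizable_put realizable_id) (auto elim!: in_set_zipE)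
  have keeps_body: "keeps ?body (cn j)" for j
    using t by (intro keeps_comp[OF keeps_if_match[OF keeps_if[OF keeps_prims(3) keeps_id]] keeps_prims(1)]) auto
  have inj: "distinct ?is"
    by (simp add: distinct_map inj_on_def)
  show ?thesis
  proof (rule testableI[where K = "d + k" and f = ?f])
    show "realizable (- {0}) ?f"
      by (intro realizable_comp[OF realizable_comp[OF realizable_put realizable_nest] realizable_rew]
          real_body inj) (auto simp: keeps_body)
    show "keeps ?f (cn j)" if "j < d" for j
      using t that
      by (intro keeps_comp[OF keeps_comp[OF keeps_prims(3) keeps_nest[OF keeps_body]] keeps_prims(2)]) auto
    fix s n I v assume s: "good (d + k) n I v s" "v \<in> tuples {..<n} d"
    let ?u = "replicate n True"
    define w where "w = map (\<lambda>xs. xs \<in> I t) (all_tuples n k)"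
    define a where "a = map ((!) v) js"
    let ?J = "\<lambda>(h, b). s(2 := ([b], 0), 3 + t := (w, h))"
    let ?st = "\<lambda>xs (h, b). (min (Suc h) (length w), b \<or> xs = a \<and> h < length w \<and> w ! h)"
    have d: "length v = d"
      using s(2) by (simp add: tuples_def)
    have a: "a \<in> set (all_tuples n k)"
      using js s(2) by (auto simp: set_all_tuples tuples_def a_def k_def in_set_conv_nth subset_iff) (metis nth_mem)
    have st: "s (3 + t) = (w, 0)"
      using goodD(2)[OF s(1) t] assms(2) by (simp add: w_def k_def)
    have "nest ?is ?body (?J (0, False)) = ?J (fold ?st (all_tuples (length ?u) (length ?is)) (0, False))"
    proof (rule nest_sim[OF inj])
      show "?J m i = (?u, 0)" if "i \<in> set ?is" for m i
        using that d t goodD(3)[OF s(1)] by (cases m) auto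
      fix xs and m :: "nat \<times> bool" assume xs: "xs \<in> tuples {..<length ?u} (length ?is)"
      obtain h b where m: "m = (h, b)"
        by (cases m)
      have sh: "set_heads ?u ?is xs (?J m) = (set_heads ?u ?is xs s)(2 := ([b], 0), 3 + t := (w, h))"
        if "m = (h, b)" for h b and m :: "nat \<times> bool"
        using t that by (simp add: set_heads_upd image_iff)
      let ?s = "(set_heads ?u ?is xs s)(2 := ([b], 0), 3 + t := (w, h))"
      have cn: "?s (cn i) = set_heads ?u ?is xs s (cn i)" for i
        using t by simp
      have xs': "xs \<in> tuples {..<n} k"
        using xs by simp
      have "(\<forall>(i, j)\<in>set (zip [d..<d + k] js). snd (?s (cn i)) = snd (?s (cn j))) \<longleftrightarrow> xs = a"
        unfolding a_def cn
        by (rule set_heads_match[OF s(1) d[symmetric] order_refl xs' k_def[symmetric] js])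
      then have "?m ?s = (if xs = a then ?put ?s else ?s)"
        unfolding if_match_eq by simp
      also have "\<dots> = (set_heads ?u ?is xs s)(2 := ([b \<or> xs = a \<and> h < length w \<and> w ! h], 0), 3 + t := (w, h))"
        by (auto simp: symb_def put_def fun_upd_twist)
      finally have "?body ?s = (set_heads ?u ?is xs s)(2 := ([b \<or> xs = a \<and> h < length w \<and> w ! h], 0),
          3 + t := (w, min (Suc h) (length w)))"
        by (simp add: mvr_def)
      then show "?body (set_heads ?u ?is xs (?J m)) = set_heads ?u ?is xs (?J (?st xs m))"
        using sh[OF m] sh[of "?st xs m"] m by simp
    qed
    also have "fold ?st (all_tuples (length ?u) (length ?is)) (0, False) =
        (length w, a \<in> set (all_tuples n k) \<and> a \<in> I t)"
      using fold_lookup[of w "\<lambda>xs. xs \<in> I t" "[]" "all_tuples n k" a False] by (simp add: w_def)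
    finally have "nest ?is ?body (?J (0, False)) = s(2 := ([a \<in> I t], 0), 3 + t := (w, length w))"
      using a by simp
    moreover have "put 2 False s = ?J (0, False)"
      using put_flag[OF s(1)] st by (simp add: fun_upd_idem)
    ultimately show "?f s = s(2 := ([map ((!) v) js \<in> I t], 0))"
      using st by (simp add: rew_def a_def fun_upd_idem)
  qed
qed

end

section \<open>Terms evaluated through graphs of operations\<close>

datatype oterm = Var nat | Op nat "oterm list"

primrec wf_oterm :: "nat list \<Rightarrow> nat \<Rightarrow> oterm \<Rightarrow> bool" where
  "wf_oterm as m (Var i) \<longleftrightarrow> i < m"
| "wf_oterm as m (Op f ts) \<longleftrightarrow> f < length as \<and> length ts = as ! f \<and> list_all (wf_oterm as m) ts"

text \<open>The values of a term when operations are only given by their graphs \<open>I f\<close>.\<close>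

primrec term_values :: "nat \<Rightarrow> (nat \<Rightarrow> nat list set) \<Rightarrow> nat list \<Rightarrow> oterm \<Rightarrow> nat set" where
  "term_values n I v (Var i) = {v ! i}"
| "term_values n I v (Op f ts) =
     {y. \<exists>ys\<in>tuples {..<n} (length ts). list_all2 (\<in>) ys (map (term_values n I v) ts) \<and> ys @ [y] \<in> I f}"

lemma fold_insert:
  fixes Q :: "'a \<Rightarrow> bool"
  shows "fold (\<lambda>x (w, h). (if x = a then w[h := True] else w, min (Suc h) (length w))) post
      (map (\<lambda>x. x = a \<or> Q x) pre @ map Q post, length pre) =
    (map (\<lambda>x. x = a \<or> Q x) (pre @ post), length (pre @ post))"
proof (induction post arbitrary: pre)
  case (Cons x post)
  let ?Q = "\<lambda>x. x = a \<or> Q x"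
  have "(if x = a then (map ?Q pre @ map Q (x # post))[length pre := True] else map ?Q pre @ map Q (x # post)) =
      map ?Q (pre @ [x]) @ map Q post"
    by (simp add: list_update_append)
  then show ?case
    using Cons.IH[of "pre @ [x]"] by (cases "x = a") (simp_all add: list_update_append)
qed simp

context layout
begin

text \<open>A nested term is flattened: the values of the arguments at the root are existentially
  quantified, and the recursion continues with these as further variables. Thus \<open>d\<close>
  grows along the recursion while \<open>is\<close> keeps pointing at the original
  variables.\<close>

lemma testable_term:
  assumes "wf_oterm as (length is) t" "y < d" "\<forall>i\<in>set is. i < d"
    and "length as \<le> length ar" "\<And>f. f < length as \<Longrightarrow> ar ! f = Suc (as ! f)"
  shows "testable d (\<lambda>n I v. v ! y \<in> term_values n I (map ((!) v) is) t)"
  using assms(1-3)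
proof (induction t arbitrary: d y)
  case (Var i)
  then have "testable d (\<lambda>n I v. v ! y = v ! (is ! i))"
    by (intro testable_eq) auto
  then show ?case
    using Var by simp
next
  case (Op f ts)
  let ?k = "length ts"
  let ?P = "\<lambda>n I w. (\<forall>j\<in>set [0..<?k]. w ! (d + j) \<in> term_values n I (map ((!) w) is) (ts ! j)) \<and>
    map ((!) w) ([d..<d + ?k] @ [y]) \<in> I f"
  have "testable (d + ?k) ?P"
  proof (intro testable_conj testable_ball testable_rel)
    fix j assume "j \<in> set [0..<?k]"
    then show "testable (d + ?k) (\<lambda>n I w. w ! (d + j) \<in> term_values n I (map ((!) w) is) (ts ! j))"
      using Op.prems by (intro Op.IH) (auto simp: list_all_iff)
  qed (use Op.prems assms(4,5) in \<open>auto simp: nth_append\<close>)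
  then have "testable d (\<lambda>n I v. \<exists>ys\<in>tuples {..<n} ?k. ?P n I (v @ ys))"
    by (rule testable_ex_tuple)
  then show ?case
  proof (rule testable_cong)
    fix n I v assume v: "v \<in> tuples {..<n :: nat} d"
    have "?P n I (v @ ys) \<longleftrightarrow> list_all2 (\<in>) ys (map (term_values n I (map ((!) v) is)) ts) \<and> ys @ [v ! y] \<in> I f"
      if ys: "ys \<in> tuples {..<n} ?k" for ys
    proof -
      have is_eq: "map ((!) (v @ ys)) is = map ((!) v) is"
        using v Op.prems(3) by (auto simp: tuples_def nth_append)
      have ys_eq: "map ((!) (v @ ys)) ([d..<d + ?k] @ [y]) = ys @ [v ! y]"
        using v ys Op.prems(2) by (auto simp: tuples_def nth_append intro!: nth_equalityI)
      show ?thesis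
        unfolding is_eq ys_eq using v ys by (auto simp: tuples_def nth_append list_all2_conv_all_nth)
    qed
    then show "(\<exists>ys\<in>tuples {..<n} ?k. ?P n I (v @ ys)) = (v ! y \<in> term_values n I (map ((!) v) is) (Op f ts))"
      by simp
  qed
qed

definition tab :: "nat \<Rightarrow> nat \<Rightarrow> nat list set \<Rightarrow> bool list \<times> nat" where
  "tab n t R = (map (\<lambda>xs. xs \<in> R) (all_tuples n (ar ! t)), 0)"

lemma good_table: "t < length ar \<Longrightarrow> good K n I v s \<Longrightarrow> good K n (I(t := R)) v (s(3 + t := tab n t R))"
  by (auto simp: good_def tab_def fun_upd_apply cn_def)

text \<open>The scan of \<open>testable_rel\<close> again, with the matching cell written instead of
  read. The length of the table does not change, so insertions may be repeated inside loops.\<close>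

lemma table_insert:
  assumes t: "t < length ar" and len: "length js = ar ! t" and js: "\<forall>j\<in>set js. j < d"
  shows "\<exists>f. realizable (- {0}) f \<and> (\<forall>j < d. keeps f (cn j)) \<and>
    (\<forall>s n I v. good (d + length js) n I v s \<longrightarrow> v \<in> tuples {..<n} d \<longrightarrow>
      f s = s(3 + t := tab n t (insert (map ((!) v) js) (I t))))"
proof -
  define k where "k = length js"
  let ?is = "map cn [d..<d + k]"
  let ?m = "if_match (zip [d..<d + k] js) (put (3 + t) True)"
  let ?body = "\<lambda>s. mvr (3 + t) (?m s)"
  let ?f = "\<lambda>s. rew (3 + t) (nest ?is ?body s)"
  have real_body: "realizable (- {0}) ?body"
    using js by (intro realizable_comp[OF _ realizable_mvr] realizable_if_match realizable_put)
      (auto elim!: in_set_zipE)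
  have keeps_body: "keeps ?body (cn j)" for j
    using t by (intro keeps_comp[OF keeps_if_match[OF keeps_prims(3)] keeps_prims(1)]) auto
  have inj: "distinct ?is"
    by (simp add: distinct_map inj_on_def)
  show ?thesis
  proof (intro exI[of _ ?f] conjI allI impI)
    show "realizable (- {0}) ?f"
      by (intro realizable_comp[OF realizable_nest realizable_rew] real_body inj) (auto simp: keeps_body)
    show "keeps ?f (cn j)" if "j < d" for j
      using t that by (intro keeps_comp[OF keeps_nest[OF keeps_body] keeps_prims(2)]) auto
    fix s n I v assume s: "good (d + length js) n I v s" "v \<in> tuples {..<n} d"
    let ?u = "replicate n True"
    let ?Q = "\<lambda>xs. xs \<in> I t"
    define a where "a = map ((!) v) js"
    let ?J = "\<lambda>(w, h). s(3 + t := (w, h))"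
    let ?st = "\<lambda>xs (w, h). (if xs = a then w[h := True] else w, min (Suc h) (length w))"
    have d: "length v = d"
      using s(2) by (simp add: tuples_def)
    have st: "s (3 + t) = (map ?Q (all_tuples n k), 0)"
      using goodD(2)[OF s(1) t] len by (simp add: k_def)
    have "nest ?is ?body (?J (map ?Q (all_tuples n k), 0)) =
        ?J (fold ?st (all_tuples (length ?u) (length ?is)) (map ?Q (all_tuples n k), 0))"
    proof (rule nest_sim[OF inj])
      show "?J m i = (?u, 0)" if "i \<in> set ?is" for m i
        using that d t goodD(3)[OF s(1)] by (cases m) (auto simp: k_def)
      fix xs and m :: "bool list \<times> nat" assume xs: "xs \<in> tuples {..<length ?u} (length ?is)"
      obtain w h where m: "m = (w, h)"
        by (cases m)
      have sh: "set_heads ?u ?is xs (?J m) = (set_heads ?u ?is xs s)(3 + t := (w, h))"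
        if "m = (w, h)" for w h and m :: "bool list \<times> nat"
        using t that by (simp add: set_heads_upd image_iff)
      let ?s = "(set_heads ?u ?is xs s)(3 + t := (w, h))"
      have cn: "?s (cn i) = set_heads ?u ?is xs s (cn i)" for i
        using t by simp
      have xs': "xs \<in> tuples {..<n} k"
        using xs by simp
      have "(\<forall>(i, j)\<in>set (zip [d..<d + k] js). snd (?s (cn i)) = snd (?s (cn j))) \<longleftrightarrow> xs = a"
        unfolding a_def cn
        by (rule set_heads_match[OF s(1) d[symmetric] _ xs' k_def[symmetric] js]) (simp add: k_def)
      then have "?m ?s = (if xs = a then put (3 + t) True ?s else ?s)"
        unfolding if_match_eq by simp
      also have "\<dots> = (set_heads ?u ?is xs s)(3 + t := (if xs = a then w[h := True] else w, h))"
        by (simp add: put_def)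
      finally have "?body ?s = (set_heads ?u ?is xs s)(3 + t :=
          (if xs = a then w[h := True] else w, min (Suc h) (length w)))"
        by (simp add: mvr_def)
      then show "?body (set_heads ?u ?is xs (?J m)) = set_heads ?u ?is xs (?J (?st xs m))"
        using sh[OF m] sh[of "?st xs m"] m by simp
    qed
    also have "fold ?st (all_tuples (length ?u) (length ?is)) (map ?Q (all_tuples n k), 0) =
        (map (\<lambda>xs. xs = a \<or> ?Q xs) (all_tuples n k), length (all_tuples n k))"
      using fold_insert[of a "all_tuples n k" ?Q "[]"] by simp
    finally have "nest ?is ?body (?J (map ?Q (all_tuples n k), 0)) =
        s(3 + t := (map (\<lambda>xs. xs = a \<or> ?Q xs) (all_tuples n k), length (all_tuples n k)))"
      by simp
    moreover have "?J (map ?Q (all_tuples n k), 0) = s"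
      using st by (simp add: fun_upd_idem)
    ultimately show "?f s = s(3 + t := tab n t (insert (map ((!) v) js) (I t)))"
      using st len by (simp add: rew_def a_def tab_def k_def)
  qed
qed

end

section \<open>Saturation of a binary relation\<close>

definition closure_round :: "(nat list set \<Rightarrow> nat list \<Rightarrow> bool) \<Rightarrow> nat \<Rightarrow> nat list set \<Rightarrow> nat list set" where
  "closure_round P n = fold (\<lambda>p E. if P E p then insert p E else E) (all_tuples n 2)"

text \<open>The list only serves as a clock: two nested counter loops repeat a round once for every
  pair of elements.\<close>

definition saturate :: "(nat list set \<Rightarrow> nat list \<Rightarrow> bool) \<Rightarrow> nat \<Rightarrow> nat list set \<Rightarrow> nat list set" where
  "saturate P n = fold (\<lambda>_. closure_round P n) (all_tuples n 2)"

lemma fst_fold: "(\<And>x m. fst (g x m) = h x (fst m)) \<Longrightarrow> fst (fold g xs m) = fold h xs (fst m)"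
  by (induction xs arbitrary: m) auto

context layout
begin

text \<open>Counters 0 and 1 count the rounds and counters 2 and 3 hold the candidate pair, so the
  condition has four variables and looks at the last two. The insertion needs two more counters,
  hence the 6 in the proof. The condition is evaluated on the table while it is being
  enlarged.\<close>

lemma realizable_saturate:
  assumes e: "e < length ar" "ar ! e = 2" and P: "testable 4 (\<lambda>n I v. P n I (drop 2 v))"
  shows "\<exists>f K. realizable (- {0}) f \<and> (\<forall>s n I. good K n I [] s \<longrightarrow>
    (\<exists>b. f s = s(2 := ([b], 0), 3 + e := tab n e (saturate (\<lambda>E. P n (I(e := E))) n (I e)))))"
proof -
  obtain f K where "tests 4 (\<lambda>n I v. P n I (drop 2 v)) f K"
    using P unfolding testable_def by blast
  note f = testsD[OF this]
  obtain g where g: "realizable (- {0}) g" "\<forall>j < 4. keeps g (cn j)"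
    "\<forall>s n I v. good (4 + length [2, 3]) n I v s \<longrightarrow> v \<in> tuples {..<n} 4 \<longrightarrow>
      g s = s(3 + e := tab n e (insert (map ((!) v) [2, 3]) (I e)))"
    using table_insert[OF e(1), of "[2, 3]" 4] e(2) by auto
  let ?c = "\<lambda>s. if symb (s 2) = 2 then g s else s"
  let ?body = "\<lambda>s. ?c (f s)"
  let ?is = "[cn 0, cn (Suc 0)]" and ?js = "[cn 2, cn 3]"
  let ?f = "nest ?is (nest ?js ?body)"
  have real_body: "realizable (- {0}) ?body"
    by (rule realizable_comp[OF f(1) realizable_symb[where P = "\<lambda>s. s = 2", OF g(1) realizable_id]])
  have keeps_body: "keeps ?body (cn j)" if "j < 4" for j
    using g(2) that by (intro keeps_comp[OF f(2) keeps_if[OF _ keeps_id]]) auto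
  have real: "realizable (- {0}) ?f"
    by (intro realizable_nest real_body) (auto simp del: nest.simps intro!: keeps_nest keeps_body)
  have sem: "\<exists>b. ?f s = s(2 := ([b], 0), 3 + e := tab n e (saturate (\<lambda>E. P n (I(e := E))) n (I e)))"
    if s: "good (max K 6) n I [] s" for s n I
  proof -
    let ?u = "replicate n True"
    let ?J = "\<lambda>(E, b). s(2 := ([b], 0), 3 + e := tab n e E)"
    let ?P = "\<lambda>E. P n (I(e := E))"
    let ?st = "\<lambda>p (E, b :: bool). (if ?P E p then insert p E else E, ?P E p)"
    have good_J: "good (max K 6) n (I(e := fst m)) [] (?J m)" for m
      using good_table[OF e(1) good_flag[OF s]] by (cases m) simp
    have J_cn: "?J m (cn j) = (?u, 0)" if "j < 6" for m j
      using goodD(3)[OF good_J[of m], of j] that by simp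
    have inner: "nest ?js ?body (set_heads ?u ?is q (?J m)) =
        set_heads ?u ?is q (?J (fold ?st (all_tuples n 2) m))" if q: "q \<in> tuples {..<n} 2" for q m
    proof -
      have "nest ?js ?body (set_heads ?u ?is q (?J m)) =
          set_heads ?u ?is q (?J (fold ?st (all_tuples (length ?u) (length ?js)) m))"
      proof (rule nest_sim[where J = "\<lambda>m. set_heads ?u ?is q (?J m)"])
        show "set_heads ?u ?is q (?J m) i = (?u, 0)" if "i \<in> set ?js" for m i
          using that J_cn[of 2 m] J_cn[of 3 m] by (auto simp: set_heads_other)
        fix p and m :: "nat list set \<times> bool" assume p: "p \<in> tuples {..<length ?u} (length ?js)"
        obtain E b where m: "m = (E, b)"
          by (cases m)
        let ?h = "\<lambda>s. set_heads ?u ?js p (set_heads ?u ?is q s)"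
        have pq: "q @ p \<in> tuples {..<n} 4" "drop 2 (q @ p) = p" "map ((!) (q @ p)) [2, 3] = p" "length q = 2" "length p = 2"
          using p q by (auto simp: tuples_def nth_append length_Suc_conv numeral_2_eq_2 eval_nat_numeral)
        have good_h: "good (max K 6) n (I(e := fst m)) (q @ p) (?h (?J m))" for m
        proof -
          have "good (max K 6) n (I(e := fst m)) q (set_heads ?u ?is q (?J m))"
            using good_set_heads[OF good_J, of m q] pq(4) by (simp add: numeral_2_eq_2)
          from good_set_heads[OF this, of p] show ?thesis
            using pq(4,5) by (simp add: eval_nat_numeral)
        qed
        have h_upd: "?h (t(x := y)) = (?h t)(x := y)" if "x = 2 \<or> x = 3 + e" for t x y
          using that e(1) by (auto simp: set_heads_upd)
        have 1: "f (?h (?J (E, b))) = ?h (?J (E, ?P E p))"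
        proof -
          have "good K n (I(e := E)) (q @ p) (?h (?J (E, b)))"
            using good_mono[OF good_h[of "(E, b)"], of K] by simp
          from f(3)[OF this pq(1)] have "f (?h (?J (E, b))) = (?h (?J (E, b)))(2 := ([?P E p], 0))"
            by (simp only: pq)
          also have "\<dots> = ?h ((?J (E, b))(2 := ([?P E p], 0)))"
            by (rule h_upd[symmetric]) simp
          also have "(?J (E, b))(2 := ([?P E p], 0)) = ?J (E, ?P E p)"
            by (auto simp: fun_eq_iff fun_upd_apply)
          finally show ?thesis .
        qed
        have 2: "?c (?h (?J (E, b'))) = ?h (?J (if b' then insert p E else E, b'))" for b'
        proof -
          have flag: "?h (?J (E, b')) 2 = ([b'], 0)"
            by (simp add: set_heads_other)
          have "good (4 + length [2, 3]) n (I(e := E)) (q @ p) (?h (?J (E, b')))"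
            using good_mono[OF good_h[of "(E, b')"], of 6] by simp
          then have "g (?h (?J (E, b'))) = (?h (?J (E, b')))(3 + e := tab n e (insert p E))"
            using g(3) pq(1,3) by (simp del: set_heads.simps)
          also have "\<dots> = ?h ((?J (E, b'))(3 + e := tab n e (insert p E)))"
            by (rule h_upd[symmetric]) simp
          also have "(?J (E, b'))(3 + e := tab n e (insert p E)) = ?J (insert p E, b')"
            by simp
          finally show ?thesis
            using flag by (cases b') (simp_all add: symb_def del: set_heads.simps)
        qed
        show "?body (?h (?J m)) = ?h (?J (?st p m))"
          unfolding m 1 2 by simp
      qed auto
      then show ?thesis
        by (simp add: numeral_2_eq_2)
    qed
    have run: "?f (?J m) = ?J (fold (\<lambda>_. fold ?st (all_tuples n 2)) (all_tuples (length ?u) (length ?is)) m)" for m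
    proof (rule nest_sim)
      show "?J m i = (?u, 0)" if "i \<in> set ?is" for m i
        using that J_cn[of 0 m] J_cn[of "Suc 0" m] by auto
      show "nest ?js ?body (set_heads ?u ?is xs (?J m)) = set_heads ?u ?is xs (?J (fold ?st (all_tuples n 2) m))"
        if "xs \<in> tuples {..<length ?u} (length ?is)" for xs m
        using inner[of xs m] that by (simp add: numeral_2_eq_2)
    qed auto
    have fold_fst: "fst (fold (\<lambda>_. fold ?st (all_tuples n 2)) (all_tuples n 2) m) = saturate ?P n (fst m)" for m
      unfolding saturate_def closure_round_def by (intro fst_fold) (auto simp: split_beta)
    obtain b where b: "s 2 = ([b], 0)"
      using goodD(1)[OF s] by blast
    define M where "M = fold (\<lambda>_. fold ?st (all_tuples n 2)) (all_tuples n 2) (I e, b)"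
    have len: "length ?u = n" "length ?is = 2"
      by simp_all
    have "s (3 + e) = tab n e (I e)"
      using goodD(2)[OF s e(1)] by (simp add: tab_def)
    then have J0: "?J (I e, b) = s"
      using b by (simp add: fun_upd_idem)
    have "?f s = ?J M"
      using run[of "(I e, b)"] unfolding J0 len M_def .
    also have "?J M = s(2 := ([snd M], 0), 3 + e := tab n e (fst M))"
      by (simp add: split_beta)
    also have "fst M = saturate ?P n (I e)"
      unfolding M_def fold_fst by simp
    finally show ?thesis
      by blast
  qed
  show ?thesis
    by (rule exI[of _ ?f], rule exI[of _ "max K 6"]) (use real sem in blast)
qed

end

section \<open>Reading and writing structures\<close>

definition full :: "bool list \<Rightarrow> bool list \<times> nat" where
  "full w = (w, length w)"

lemma app_full: "s i = full w \<Longrightarrow> app i b s = s(i := full (w @ [b]))"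
  by (simp add: app_def full_def)

lemma fold_until_count:
  assumes "\<And>a. a < l \<Longrightarrow> \<not> P a" "P l" "l < n" "i \<le> l"
  shows "fold_until (\<lambda>a (w, b). (if P a then w else w @ [True], P a)) snd [i..<n] (w, b) =
    (w @ replicate (l - i) True, True)"
  using assms(4)
proof (induction "l - i" arbitrary: i w b)
  case 0
  then show ?case
    using assms(2,3) by (simp add: upt_conv_Cons)
next
  case (Suc d)
  then have "\<not> P i" "i < n" "Suc i \<le> l" "d = l - Suc i" "l - i = Suc (l - Suc i)"
    using assms(1,3) by auto
  then show ?case
    using Suc.hyps(1)[of "Suc i" "w @ [True]" False] by (simp add: upt_conv_Cons replicate_app_Cons_same)
qed

lemma fold_append: "fold (\<lambda>x w. w @ g x) xs w = w @ concat (map g xs)"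
  by (induction xs arbitrary: w) auto

context layout
begin

section \<open>Writing the output\<close>

definition emits :: "(nat \<Rightarrow> (nat \<Rightarrow> nat list set) \<Rightarrow> bool) \<Rightarrow> (nat \<Rightarrow> (nat \<Rightarrow> nat list set) \<Rightarrow> bool list) \<Rightarrow> bool"
  where "emits C F \<longleftrightarrow> (\<exists>f K. realizable (- {0}) f \<and> (\<forall>s n I w. good K n I [] s \<longrightarrow> C n I \<longrightarrow>
    s 0 = full w \<longrightarrow> (\<exists>b. f s = s(2 := ([b], 0), 0 := full (w @ F n I)))))"

lemma emitsI:
  assumes "realizable (- {0}) f"
    and "\<And>s n I w. good K n I [] s \<Longrightarrow> C n I \<Longrightarrow> s 0 = full w \<Longrightarrow>
      \<exists>b. f s = s(2 := ([b], 0), 0 := full (w @ F n I))"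
  shows "emits C F"
  unfolding emits_def by (rule exI[of _ f], rule exI[of _ K]) (use assms in simp)

lemma emitsE:
  assumes "emits C F"
  obtains f K where "realizable (- {0}) f"
    and "\<And>s n I w. good K n I [] s \<Longrightarrow> C n I \<Longrightarrow> s 0 = full w \<Longrightarrow>
      \<exists>b. f s = s(2 := ([b], 0), 0 := full (w @ F n I))"
proof -
  obtain f K where "realizable (- {0}) f" "\<forall>s n I w. good K n I [] s \<longrightarrow> C n I \<longrightarrow>
    s 0 = full w \<longrightarrow> (\<exists>b. f s = s(2 := ([b], 0), 0 := full (w @ F n I)))"
    using assms unfolding emits_def by (elim exE conjE)
  then show ?thesis
    by (intro that[of f K]) simp_all
qed

lemma good_out: "good K n I v (s(0 := x)) \<longleftrightarrow> good K n I v s"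
  by (auto simp: good_def)

lemma emits_Nil: "emits C (\<lambda>n I. [])"
proof (rule emitsI[OF realizable_id, of 0])
  fix s n I w assume "good 0 n I [] s" "s 0 = full w"
  then show "\<exists>b. s = s(2 := ([b], 0), 0 := full (w @ []))"
    using goodD(1) by (metis append.right_neutral fun_upd_triv)
qed

lemma emits_append:
  assumes "emits C F" "emits C G"
  shows "emits C (\<lambda>n I. F n I @ G n I)"
proof -
  obtain f K where f: "realizable (- {0}) f"
    "\<And>s n I w. good K n I [] s \<Longrightarrow> C n I \<Longrightarrow> s 0 = full w \<Longrightarrow>
      \<exists>b. f s = s(2 := ([b], 0), 0 := full (w @ F n I))"
    using emitsE[OF assms(1)] by blast
  obtain g L where g: "realizable (- {0}) g"
    "\<And>s n I w. good L n I [] s \<Longrightarrow> C n I \<Longrightarrow> s 0 = full w \<Longrightarrow>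
      \<exists>b. g s = s(2 := ([b], 0), 0 := full (w @ G n I))"
    using emitsE[OF assms(2)] by blast
  show ?thesis
  proof (rule emitsI[OF realizable_comp[OF f(1) g(1)], of "max K L"])
    fix s n I w assume s: "good (max K L) n I [] s" "C n I" "s 0 = full w"
    obtain b where b: "f s = s(2 := ([b], 0), 0 := full (w @ F n I))"
      using f(2)[OF good_mono[OF s(1)] s(2,3)] by auto
    have "good L n I [] (f s)"
      unfolding b good_out by (rule good_flag[OF good_mono[OF s(1)]]) simp
    moreover have "f s 0 = full (w @ F n I)"
      by (simp add: b)
    ultimately obtain b' where "g (f s) = (f s)(2 := ([b'], 0), 0 := full ((w @ F n I) @ G n I))"
      using g(2) s(2) by metis
    moreover have "(f s)(2 := ([b'], 0), 0 := full ((w @ F n I) @ G n I)) =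
        s(2 := ([b'], 0), 0 := full (w @ F n I @ G n I))"
      by (auto simp: b fun_eq_iff fun_upd_apply)
    ultimately show "\<exists>b. g (f s) = s(2 := ([b], 0), 0 := full (w @ F n I @ G n I))"
      by metis
  qed
qed

lemma emits_concat:
  "(\<And>x. x \<in> set xs \<Longrightarrow> emits C (F x)) \<Longrightarrow> emits C (\<lambda>n I. concat (map (\<lambda>x. F x n I) xs))"
  by (induction xs) (auto intro: emits_Nil emits_append)

lemma emits_weaken: "emits C F \<Longrightarrow> (\<And>n I. C' n I \<Longrightarrow> C n I) \<Longrightarrow> emits C' F"
  unfolding emits_def by metis

lemma set_heads_tables:
  "x = 0 \<or> x = 1 \<or> x = 2 \<or> x = 3 + t \<and> t < length ar \<Longrightarrow>
    set_heads u (map cn js) xs (s(x := y)) = (set_heads u (map cn js) xs s)(x := y)"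
  by (rule set_heads_upd) auto

lemma set_heads_tables_eq:
  "x = 0 \<or> x = 1 \<or> x = 2 \<or> x = 3 + t \<and> t < length ar \<Longrightarrow> set_heads u (map cn js) xs s x = s x"
  by (rule set_heads_other) auto

lemma distinct_cn: "distinct (map cn [i..<j])"
  by (simp add: distinct_map inj_on_def)

lemma emits_bits:
  assumes "testable k Q"
  shows "emits C (\<lambda>n I. map (Q n I) (all_tuples n k))"
proof -
  obtain f K where "tests k Q f K"
    using assms unfolding testable_def by blast
  note f = testsD[OF this]
  let ?is = "map cn [0..<k]"
  let ?c = "\<lambda>s. if symb (s 2) = 2 then app 0 True s else app 0 False s"
  let ?body = "\<lambda>s. ?c (f s)"
  show ?thesis
  proof (rule emitsI[of "nest ?is ?body" "max K k"])
    have "realizable (- {0}) ?body"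
      by (rule realizable_comp[OF f(1) realizable_symb[where P = "\<lambda>s. s = 2"]]) (auto intro: realizable_app)
    moreover have "keeps ?body (cn j)" if "j < k" for j
      by (rule keeps_comp[OF f(2)[OF that] keeps_if[OF keeps_prims(4) keeps_prims(4)]]) simp_all
    ultimately show "realizable (- {0}) (nest ?is ?body)"
      by (intro realizable_nest distinct_cn) auto
    fix s n I w assume s: "good (max K k) n I [] s" "s 0 = full w"
    let ?u = "replicate n True"
    let ?J = "\<lambda>(w, b). s(2 := ([b], 0), 0 := full w)"
    let ?st = "\<lambda>xs (w, b :: bool). (w @ [Q n I xs], Q n I xs)"
    have good_J: "good (max K k) n I [] (?J m)" for m
      using good_flag[OF s(1)] by (cases m) (simp add: good_out)
    have run: "nest ?is ?body (?J m) = ?J (fold ?st (all_tuples (length ?u) (length ?is)) m)" for m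
    proof (rule nest_sim[OF distinct_cn])
      show "?J m i = (?u, 0)" if "i \<in> set ?is" for m i
        using that goodD(3)[OF good_J[of m]] by auto
      fix xs and m :: "bool list \<times> bool" assume xs: "xs \<in> tuples {..<length ?u} (length ?is)"
      obtain w b where m: "m = (w, b)"
        by (cases m)
      let ?h = "set_heads ?u ?is xs"
      have xs': "xs \<in> tuples {..<n} k"
        using xs by simp
      have "good (max K k) n I xs (?h (?J m))"
        using good_set_heads[OF good_J[of m], of xs] xs' by (simp add: tuples_def)
      then have "f (?h (?J m)) = (?h (?J m))(2 := ([Q n I xs], 0))"
        using f(3)[OF good_mono xs'] by simp
      also have "\<dots> = ?h ((?J m)(2 := ([Q n I xs], 0)))"
        by (simp add: set_heads_tables)
      also have "(?J m)(2 := ([Q n I xs], 0)) = ?J (w, Q n I xs)"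
        by (auto simp: m fun_eq_iff fun_upd_apply)
      finally have fh: "f (?h (?J m)) = ?h (?J (w, Q n I xs))" .
      have "?h (?J (w, Q n I xs)) 2 = ([Q n I xs], 0)" "?h (?J (w, Q n I xs)) 0 = full w"
        by (simp_all add: set_heads_tables_eq)
      then have "?c (?h (?J (w, Q n I xs))) = (?h (?J (w, Q n I xs)))(0 := full (w @ [Q n I xs]))"
        by (auto simp: symb_def app_full)
      also have "\<dots> = ?h ((?J (w, Q n I xs))(0 := full (w @ [Q n I xs])))"
        by (simp add: set_heads_tables)
      finally show "?body (?h (?J m)) = ?h (?J (?st xs m))"
        unfolding fh by (simp add: m)
    qed
    obtain b where b: "s 2 = ([b], 0)"
      using goodD(1)[OF s(1)] by blast
    define M where "M = fold ?st (all_tuples n k) (w, b)"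
    have len: "length ?u = n" "length ?is = k"
      by simp_all
    have J0: "?J (w, b) = s"
      using b s(2) by (simp add: fun_upd_idem)
    have "nest ?is ?body s = ?J M"
      using run[of "(w, b)"] unfolding J0 len M_def .
    also have "?J M = s(2 := ([snd M], 0), 0 := full (fst M))"
      by (simp add: split_beta)
    also have "fst M = fold (\<lambda>xs w. w @ [Q n I xs]) (all_tuples n k) w"
      unfolding M_def by (subst fst_fold[where h = "\<lambda>xs w. w @ [Q n I xs]"]) auto
    also have "\<dots> = w @ map (Q n I) (all_tuples n k)"
      by (simp add: fold_append[where g = "\<lambda>x. [Q n I x]"])
    finally show "\<exists>b. nest ?is ?body s = s(2 := ([b], 0), 0 := full (w @ map (Q n I) (all_tuples n k)))"
      by blast
  qed
qed

lemma emits_size: "emits C (\<lambda>n I. encode_nat n)"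
proof (rule emitsI[of "\<lambda>s. app 0 False (for_all (cn 0) (app 0 True) s)" 1])
  show "realizable (- {0}) (\<lambda>s. app 0 False (for_all (cn 0) (app 0 True) s))"
    by (intro realizable_comp[OF realizable_for_all realizable_app] realizable_app keeps_prims) auto
  fix s n I w assume s: "good 1 n I [] s" "s 0 = full w"
  let ?u = "replicate n True"
  let ?J = "\<lambda>w. s(0 := full w)"
  have "for_all (cn 0) (app 0 True) (?J w) = ?J (fold (\<lambda>a w. w @ [True]) [0..<length ?u] w)"
  proof (rule for_all_sim)
    show "?J w (cn 0) = (?u, 0)" for w
      using goodD(3)[OF s(1), of 0] by simp
    show "app 0 True ((?J w)(cn 0 := (?u, a))) = (?J (w @ [True]))(cn 0 := (?u, a))" for a w
      by (subst app_full[where w = w]) (auto simp: fun_upd_twist)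
  qed
  also have "fold (\<lambda>a w. w @ [True]) [0..<length ?u] w = w @ replicate n True"
    by (simp add: fold_append[where g = "\<lambda>_. [True]"] map_replicate_const concat_replicate_trivial)
  finally have "for_all (cn 0) (app 0 True) s = ?J (w @ replicate n True)"
    using s(2) by (simp add: fun_upd_idem)
  then have "app 0 False (for_all (cn 0) (app 0 True) s) = ?J (w @ encode_nat n)"
    by (simp add: app_full[where w = "w @ replicate n True"] encode_nat_def)
  moreover obtain b where "s 2 = ([b], 0)"
    using goodD(1)[OF s(1)] by blast
  ultimately show "\<exists>b. app 0 False (for_all (cn 0) (app 0 True) s) = s(2 := ([b], 0), 0 := full (w @ encode_nat n))"
    by (metis fun_upd_triv)
qed

text \<open>Searching and writing coincide: each failing candidate appends one letter
  \<open>True\<close>, so when the first witness stops the loop, its unary code lacks only the final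
  \<open>False\<close>. Without a witness the search would end with the code of \<open>n\<close>,
  whence the precondition.\<close>

lemma emits_numbers:
  assumes "testable (Suc k) (\<lambda>n I v. Q n I (take k v) (v ! k))"
  shows "emits (\<lambda>n I. \<forall>xs\<in>tuples {..<n} k. \<exists>y<n. Q n I xs y)
    (\<lambda>n I. concat (map (\<lambda>xs. encode_nat (LEAST y. Q n I xs y)) (all_tuples n k)))"
proof -
  obtain f K where "tests (Suc k) (\<lambda>n I v. Q n I (take k v) (v ! k)) f K"
    using assms unfolding testable_def by blast
  note f = testsD[OF this]
  let ?is = "map cn [0..<k]"
  let ?c = "\<lambda>s. if symb (s 2) = 2 then s else app 0 True s"
  let ?L = "for_until (cn k) 2 (\<lambda>s. s = 2) (\<lambda>s. ?c (f s))"
  let ?body = "\<lambda>s. app 0 False (?L s)"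
  show ?thesis
  proof (rule emitsI[of "nest ?is ?body" "max K (Suc k)"])
    have "realizable (- {0}) (\<lambda>s. ?c (f s))"
      by (rule realizable_comp[OF f(1) realizable_symb[where P = "\<lambda>s. s = 2", OF realizable_id realizable_app]]) simp
    moreover have keep: "keeps (\<lambda>s. ?c (f s)) (cn j)" if "j < Suc k" for j
      by (rule keeps_comp[OF f(2)[OF that] keeps_if[OF keeps_id keeps_prims(4)]]) simp
    ultimately have "realizable (- {0}) ?body"
      by (intro realizable_comp[OF realizable_for_until realizable_app]) auto
    moreover have "keeps ?body (cn j)" if "j < k" for j
      using that keep by (intro keeps_comp[OF keeps_for_until keeps_prims(4)]) auto
    ultimately show "realizable (- {0}) (nest ?is ?body)"
      by (intro realizable_nest distinct_cn) auto
    fix s n I w assume s: "good (max K (Suc k)) n I [] s" "s 0 = full w"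
      and ex: "\<forall>xs\<in>tuples {..<n} k. \<exists>y<n. Q n I xs y"
    let ?u = "replicate n True"
    let ?J = "\<lambda>(w, b). s(2 := ([b], 0), 0 := full w)"
    let ?l = "\<lambda>xs. LEAST y. Q n I xs y"
    let ?st = "\<lambda>xs (w, b :: bool). (w @ encode_nat (?l xs), True)"
    have good_J: "good (max K (Suc k)) n I [] (?J m)" for m
      using good_flag[OF s(1)] by (cases m) (simp add: good_out)
    have run: "nest ?is ?body (?J m) = ?J (fold ?st (all_tuples (length ?u) (length ?is)) m)" for m
    proof (rule nest_sim[OF distinct_cn])
      show "?J m i = (?u, 0)" if "i \<in> set ?is" for m i
        using that goodD(3)[OF good_J[of m]] by auto
      fix xs and m :: "bool list \<times> bool" assume xs: "xs \<in> tuples {..<length ?u} (length ?is)"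
      obtain w b where m: "m = (w, b)"
        by (cases m)
      let ?h = "set_heads ?u ?is xs"
      have xs': "xs \<in> tuples {..<n} k"
        using xs by simp
      then have lxs: "length xs = k"
        by (simp add: tuples_def)
      let ?q = "\<lambda>a (w, b :: bool). (if Q n I xs a then w else w @ [True], Q n I xs a)"
      have good_h: "good (max K (Suc k)) n I xs (?h (?J m))" for m
        using good_set_heads[OF good_J[of m], of xs] lxs by simp
      have "?L (?h (?J m)) = ?h (?J (fold_until ?q snd [0..<length ?u] m))"
      proof (rule for_until_sim[where J = "\<lambda>m. ?h (?J m)"])
        show "?h (?J m) (cn k) = (?u, 0)" for m
          using goodD(3)[OF good_h[of m], of k] lxs by simp
        show "symb (((?h (?J m))(cn k := (?u, a))) 2) = 2 \<longleftrightarrow> snd m" for a m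
          by (cases m) (simp add: symb_def set_heads_tables_eq)
        fix a and m :: "bool list \<times> bool" assume a: "a < length ?u"
        obtain w b where m: "m = (w, b)"
          by (cases m)
        let ?g = "\<lambda>t. (?h t)(cn k := (?u, a))"
        let ?b = "Q n I xs a"
        have g_upd: "?g (t(x := y)) = (?g t)(x := y)" if "x = 0 \<or> x = 2" for t x y
          using that by (auto simp: set_heads_tables fun_upd_twist)
        have tup: "xs @ [a] \<in> tuples {..<n} (Suc k)" "take k (xs @ [a]) = xs" "(xs @ [a]) ! k = a"
          using xs' a by (auto simp: tuples_def)
        have "good (max K (Suc k)) n I (xs @ [a]) (?g (?J m))"
          using good_push[OF good_h[of m], of a] lxs by simp
        from f(3)[OF good_mono[OF this] tup(1)] have "f (?g (?J m)) = (?g (?J m))(2 := ([?b], 0))"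
          unfolding tup(2,3) by simp
        also have "\<dots> = ?g ((?J m)(2 := ([?b], 0)))"
          by (rule g_upd[symmetric]) simp
        also have "(?J m)(2 := ([?b], 0)) = ?J (w, ?b)"
          by (auto simp: m fun_eq_iff fun_upd_apply)
        finally have fg: "f (?g (?J m)) = ?g (?J (w, ?b))" .
        have val: "?g (?J (w, ?b)) 2 = ([?b], 0)" "?g (?J (w, ?b)) 0 = full w"
          by (simp_all add: set_heads_tables_eq)
        have "?c (?g (?J (w, ?b))) = ?g (?J (?q a m))"
        proof (cases ?b)
          case True
          then show ?thesis
            using val by (simp add: symb_def m)
        next
          case False
          then have "?c (?g (?J (w, ?b))) = (?g (?J (w, ?b)))(0 := full (w @ [True]))"
            using val by (simp add: symb_def app_full[of _ 0 w])
          also have "\<dots> = ?g ((?J (w, ?b))(0 := full (w @ [True])))"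
            by (rule g_upd[symmetric]) simp
          finally show ?thesis
            using False by (simp add: m)
        qed
        then show "?c (f (?g (?J m))) = ?g (?J (?q a m))"
          unfolding fg .
      qed
      moreover have "fold_until ?q snd [0..<length ?u] m = (w @ replicate (?l xs) True, True)"
      proof -
        obtain y where y: "y < n" "Q n I xs y"
          using ex xs' by blast
        have "Q n I xs (?l xs)" "?l xs \<le> y"
          using y(2) by (auto intro: LeastI Least_le)
        then show ?thesis
          using fold_until_count[of "?l xs" "Q n I xs" n 0 w b] y(1) not_less_Least by (fastforce simp: m)
      qed
      ultimately have L: "?L (?h (?J m)) = ?h (?J (w @ replicate (?l xs) True, True))"
        by simp
      have "?h (?J (w @ replicate (?l xs) True, True)) 0 = full (w @ replicate (?l xs) True)"
        by (simp add: set_heads_tables_eq)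
      then have "?body (?h (?J m)) =
          (?h (?J (w @ replicate (?l xs) True, True)))(0 := full ((w @ replicate (?l xs) True) @ [False]))"
        unfolding L by (rule app_full)
      then show "?body (?h (?J m)) = ?h (?J (?st xs m))"
        by (simp add: m encode_nat_def set_heads_tables)
    qed
    obtain b where b: "s 2 = ([b], 0)"
      using goodD(1)[OF s(1)] by blast
    define M where "M = fold ?st (all_tuples n k) (w, b)"
    have len: "length ?u = n" "length ?is = k"
      by simp_all
    have J0: "?J (w, b) = s"
      using b s(2) by (simp add: fun_upd_idem)
    have "nest ?is ?body s = ?J M"
      using run[of "(w, b)"] unfolding J0 len M_def .
    also have "?J M = s(2 := ([snd M], 0), 0 := full (fst M))"
      by (simp add: split_beta)
    also have "fst M = fold (\<lambda>xs w. w @ encode_nat (?l xs)) (all_tuples n k) w"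
      unfolding M_def by (subst fst_fold[where h = "\<lambda>xs w. w @ encode_nat (?l xs)"]) auto
    also have "\<dots> = w @ concat (map (\<lambda>xs. encode_nat (?l xs)) (all_tuples n k))"
      by (rule fold_append)
    finally show "\<exists>b. nest ?is ?body s =
        s(2 := ([b], 0), 0 := full (w @ concat (map (\<lambda>xs. encode_nat (?l xs)) (all_tuples n k))))"
      by blast
  qed
qed

end

section \<open>Parsing the input\<close>

lemma count_true_encode: "count_true (pre @ encode_nat g @ rest, length pre) = g"
  by (simp add: count_true_def encode_nat_def takeWhile_append)

lemma encode_nat_eq: "encode_nat m @ r = encode_nat n @ r' \<Longrightarrow> m = n \<and> r = r'"
  using count_true_encode[of "[]" m r] count_true_encode[of "[]" n r'] by simp

text \<open>The minima mirror the clamping of the heads on the input tape and on the counter that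
  receives the number. They come from describing the program on all memories and are inactive on
  correct input.\<close>

lemma fold_parse_numbers:
  assumes "w = pre @ concat (map (\<lambda>x. encode_nat (g x)) xs) @ rest" "\<And>x. x \<in> set xs \<Longrightarrow> g x < n"
  shows "fold (\<lambda>x (h, u). (Suc (min h (length w) + count_true (w, min h (length w))),
      u @ map (\<lambda>y. min (count_true (w, min h (length w))) n = y) [0..<n])) xs (length pre, u) =
    (length (pre @ concat (map (\<lambda>x. encode_nat (g x)) xs)),
      u @ concat (map (\<lambda>x. map (\<lambda>y. g x = y) [0..<n]) xs))"
  using assms
proof (induction xs arbitrary: pre u)
  case (Cons x xs)
  have w: "w = pre @ encode_nat (g x) @ concat (map (\<lambda>x. encode_nat (g x)) xs) @ rest"
    using Cons.prems(1) by simp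
  then have c: "count_true (w, length pre) = g x"
    by (simp add: count_true_encode)
  have "w = (pre @ encode_nat (g x)) @ concat (map (\<lambda>x. encode_nat (g x)) xs) @ rest"
    using w by simp
  from Cons.IH[OF this, of "u @ map (\<lambda>y. g x = y) [0..<n]"] Cons.prems(2)
  have IH: "fold (\<lambda>x (h, u). (Suc (min h (length w) + count_true (w, min h (length w))),
      u @ map (\<lambda>y. min (count_true (w, min h (length w))) n = y) [0..<n])) xs
      (length (pre @ encode_nat (g x)), u @ map (\<lambda>y. g x = y) [0..<n]) =
    (length ((pre @ encode_nat (g x)) @ concat (map (\<lambda>x. encode_nat (g x)) xs)),
      (u @ map (\<lambda>y. g x = y) [0..<n]) @ concat (map (\<lambda>x. map (\<lambda>y. g x = y) [0..<n]) xs))"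
    by simp
  have "min (length pre) (length w) = length pre" "min (g x) n = g x"
    "length (pre @ encode_nat (g x)) = Suc (length pre + g x)"
    using w Cons.prems(2)[of x] by (simp_all add: encode_nat_def)
  then show ?case
    using IH c by simp
qed simp

lemma fold_parse_bits:
  assumes "w = pre @ map Q xs @ rest"
  shows "fold (\<lambda>x (h, u). (Suc h, u @ [h < length w \<and> w ! h])) xs (length pre, u) =
    (length (pre @ map Q xs), u @ map Q xs)"
  using assms
proof (induction xs arbitrary: pre u)
  case (Cons x xs)
  have "w = (pre @ [Q x]) @ map Q xs @ rest"
    using Cons.prems by simp
  from Cons.IH[OF this, of "u @ [Q x]"] show ?case
    using Cons.prems by (simp add: nth_append)
qed simp

lemma fold_rew: "fold rew is s = (\<lambda>i. if i \<in> set is then (fst (s i), 0) else s i)"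
proof (induction "is" arbitrary: s)
  case (Cons i "is")
  then show ?case
    by (auto simp: rew_def fun_eq_iff fun_upd_apply)
qed simp

lemma realizable_fold:
  "(\<And>x. x \<in> set xs \<Longrightarrow> realizable Z (g x)) \<Longrightarrow> realizable Z (fold g xs)"
proof (induction xs)
  case Nil
  then show ?case
    using realizable_id by (simp add: id_def)
next
  case (Cons x xs)
  then have "realizable Z (\<lambda>s. fold g xs (g x s))"
    by (intro realizable_comp[of Z "g x" "fold g xs"]) auto
  then show ?case
    by (simp add: o_def)
qed

lemma funpow_mvr_mvr:
  assumes "i \<noteq> j" "snd (s i) \<le> length (fst (s i))" "snd (s j) \<le> length (fst (s j))"
  shows "((\<lambda>s. mvr j (mvr i s)) ^^ c) s =
    s(i := (fst (s i), min (snd (s i) + c) (length (fst (s i)))),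
      j := (fst (s j), min (snd (s j) + c) (length (fst (s j)))))"
proof (induction c)
  case 0
  then show ?case
    using assms by (simp add: min_def fun_upd_idem)
next
  case (Suc c)
  then show ?case
    using assms(1) by (auto simp: mvr_def fun_eq_iff fun_upd_apply min_def)
qed

lemma funpow_mvr:
  assumes "snd (s i) \<le> length (fst (s i))"
  shows "(mvr i ^^ c) s = s(i := (fst (s i), min (snd (s i) + c) (length (fst (s i)))))"
  using assms by (induction c) (auto simp: mvr_def fun_eq_iff fun_upd_apply min_def)

lemma funpow_mvr_app:
  assumes "i \<noteq> j" "snd (s i) \<le> length (fst (s i))" "s j = full u"
  shows "((\<lambda>s. mvr i (app j b s)) ^^ c) s =
    s(i := (fst (s i), min (snd (s i) + c) (length (fst (s i)))), j := full (u @ replicate c b))"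
proof (induction c)
  case 0
  then show ?case
    using assms by (simp add: min_def fun_upd_idem)
next
  case (Suc c)
  then show ?case
    using assms(1)
    by (auto simp: mvr_def app_def full_def fun_eq_iff fun_upd_apply min_def replicate_append_same)
qed

context layout
begin

text \<open>Exactly the output tape and the tables are left out: loading appends to the tables, so
  the time bounds must not depend on their lengths.\<close>

definition input_tapes :: "nat set" where
  "input_tapes = {i. i \<noteq> 0 \<and> (3 \<le> i \<longrightarrow> 3 + length ar \<le> i)}"

lemma input_tapes_simps [simp]: "1 \<in> input_tapes" "Suc 0 \<in> input_tapes" "cn j \<in> input_tapes"
  "t < length ar \<Longrightarrow> 3 + t \<notin> input_tapes"
  by (auto simp: input_tapes_def cn_def)

lemma one_neq_table [simp]: "Suc 0 \<noteq> 3 + t" "1 \<noteq> 3 + t" "3 + t \<noteq> Suc 0" "3 + t \<noteq> 1"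
  by auto

text \<open>The unary value is read into counter \<open>k\<close>; counter \<open>k + 1\<close> then
  runs through the domain and appends for each \<open>y\<close> whether it equals that value. In
  this way a table of values becomes the characteristic table of the graph. The separate
  \<open>mvr 1\<close> skips the closing \<open>False\<close> of the code.\<close>

lemma load_operation:
  assumes t: "t < length ar"
  shows "\<exists>f. realizable input_tapes f \<and> (\<forall>s n pre g rest.
    (\<forall>j < k + 2. s (cn j) = (replicate n True, 0)) \<longrightarrow> (\<forall>xs\<in>tuples {..<n} k. g xs < n) \<longrightarrow>
    s (3 + t) = ([], 0) \<longrightarrow>
    s 1 = (pre @ concat (map (\<lambda>xs. encode_nat (g xs)) (all_tuples n k)) @ rest, length pre) \<longrightarrow>
    f s = s(1 := (fst (s 1), length (pre @ concat (map (\<lambda>xs. encode_nat (g xs)) (all_tuples n k)))),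
      3 + t := full (concat (map (\<lambda>xs. map (\<lambda>y. g xs = y) [0..<n]) (all_tuples n k)))))"
proof -
  let ?is = "map cn [0..<k]"
  let ?emit = "\<lambda>s. if snd (s (cn k)) = snd (s (cn (Suc k))) then app (3 + t) True s else app (3 + t) False s"
  let ?read = "while_true 1 (\<lambda>s. mvr (cn k) (mvr 1 s))"
  let ?body = "\<lambda>s. rew (cn k) (for_all (cn (Suc k)) ?emit (mvr 1 (?read s)))"
  have keep_emit: "keeps ?emit (cn j)" for j
    using t by (intro keeps_if[OF keeps_prims(4) keeps_prims(4)]) simp_all
  have real: "realizable input_tapes (nest ?is ?body)"
  proof (intro realizable_nest distinct_cn)
    have 1: "realizable input_tapes ?read"
      by (intro realizable_while_true realizable_comp[OF realizable_mvr realizable_mvr])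
        (simp_all add: mvr_def)
    have 2: "realizable input_tapes ?emit"
      using t by (intro realizable_if_eq realizable_app) simp_all
    have 3: "realizable input_tapes (for_all (cn (Suc k)) ?emit)"
      by (intro realizable_for_all 2 keep_emit) simp
    show "realizable input_tapes ?body"
      by (rule realizable_comp[OF realizable_comp[OF realizable_comp[OF 1 realizable_mvr] 3] realizable_rew]) simp
    show "keeps ?body i" if "i \<in> set ?is" for i
    proof -
      obtain j where j: "i = cn j" "j < k"
        using \<open>i \<in> set ?is\<close> by auto
      have 4: "keeps ?read i"
        unfolding j(1) using j(2)
        by (intro keeps_while_true keeps_comp[OF keeps_prims(1) keeps_prims(1)]) simp_all
      have 5: "keeps (for_all (cn (Suc k)) ?emit) i"
        unfolding j(1) using j(2) by (intro keeps_for_all keep_emit) simp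
      have 6: "keeps (mvr 1) i" "keeps (rew (cn k)) i"
        using j by (simp_all add: keeps_prims)
      show ?thesis
        by (rule keeps_comp[OF keeps_comp[OF keeps_comp[OF 4 6(1)] 5] 6(2)])
    qed
  qed auto
  have sem: "nest ?is ?body s = s(1 := (fst (s 1), length (pre @ concat (map (\<lambda>xs. encode_nat (g xs)) (all_tuples n k)))),
      3 + t := full (concat (map (\<lambda>xs. map (\<lambda>y. g xs = y) [0..<n]) (all_tuples n k))))"
    if cnt: "\<forall>j < k + 2. s (cn j) = (replicate n True, 0)" and g: "\<forall>xs\<in>tuples {..<n} k. g xs < n"
      and tab: "s (3 + t) = ([], 0)"
      and inp: "s 1 = (pre @ concat (map (\<lambda>xs. encode_nat (g xs)) (all_tuples n k)) @ rest, length pre)"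
    for s n pre g rest
  proof -
    let ?u = "replicate n True"
    define w where "w = pre @ concat (map (\<lambda>xs. encode_nat (g xs)) (all_tuples n k)) @ rest"
    let ?L = "length w"
    let ?J = "\<lambda>(h, v). s(1 := (w, min h ?L), 3 + t := full v)"
    let ?c = "\<lambda>h. count_true (w, min h ?L)"
    let ?st = "\<lambda>xs :: nat list. \<lambda>(h, v). (Suc (min h ?L + ?c h), v @ map (\<lambda>y. min (?c h) n = y) [0..<n])"
    have J_cn: "?J m (cn j) = (?u, 0)" if "j < k + 2" for m j
      using cnt that t by (cases m) simp
    have run: "nest ?is ?body (?J m) = ?J (fold ?st (all_tuples (length ?u) (length ?is)) m)" for m
    proof (rule nest_sim[OF distinct_cn])
      show "?J m i = (?u, 0)" if "i \<in> set ?is" for m i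
        using that J_cn[of _ m] by (cases m) auto
      fix xs and m :: "nat \<times> bool list" assume xs: "xs \<in> tuples {..<length ?u} (length ?is)"
      obtain h v where m: "m = (h, v)"
        by (cases m)
      let ?h = "set_heads ?u ?is xs"
      define S where "S = ?h (?J m)"
      have S: "S 1 = (w, min h ?L)" "S (3 + t) = full v" "S (cn k) = (?u, 0)" "S (cn (Suc k)) = (?u, 0)"
        using t J_cn[of k m] J_cn[of "Suc k" m]
        by (simp_all add: S_def m set_heads_tables_eq[where t = t] set_heads_other image_iff)
      have cnt: "count_true (S 1) = ?c h"
        by (simp only: S)
      define S1 where "S1 = S(1 := (w, min (min h ?L + ?c h) ?L), cn k := (?u, min (?c h) n))"
      have 1: "?read S = S1"
        unfolding while_true_def cnt using funpow_mvr_mvr[of 1 "cn k" S "?c h"] S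
        by (simp add: S1_def)
      define S2 where "S2 = S(1 := (w, min (Suc (min h ?L + ?c h)) ?L), cn k := (?u, min (?c h) n))"
      have 2: "mvr 1 S1 = S2"
        by (auto simp: mvr_def S1_def S2_def fun_eq_iff fun_upd_apply) linarith
      let ?K = "\<lambda>v. S2(3 + t := full v)"
      have 3: "for_all (cn (Suc k)) ?emit (?K v) =
          ?K (fold (\<lambda>y v. v @ [min (?c h) n = y]) [0..<length ?u] v)"
      proof (rule for_all_sim)
        show "?K v (cn (Suc k)) = (?u, 0)" for v
          using S t by (simp add: S2_def)
        fix y v
        let ?T = "(?K v)(cn (Suc k) := (?u, y))"
        have "?T (3 + t) = full v"
          using t by simp
        then have "app (3 + t) b ?T = ?T(3 + t := full (v @ [b]))" for b
          by (rule app_full)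
        moreover have "?T(3 + t := x) = (S2(3 + t := x))(cn (Suc k) := (?u, y))" for x
          using t by (auto simp: fun_eq_iff fun_upd_apply)
        moreover have "snd (?T (cn k)) = min (?c h) n" "snd (?T (cn (Suc k))) = y"
          using t by (simp_all add: S2_def)
        ultimately show "?emit ?T = (?K (v @ [min (?c h) n = y]))(cn (Suc k) := (?u, y))"
          by (cases "min (?c h) n = y") simp_all
      qed
      have S2_id: "?K v = S2"
        using S t by (simp add: S2_def fun_upd_idem)
      have "?body S = rew (cn k) (?K (v @ map (\<lambda>y. min (?c h) n = y) [0..<n]))"
        unfolding 1 2 using 3 unfolding S2_id
        by (simp add: fold_append[where g = "\<lambda>y. [min (?c h) n = y]"])
      also have "\<dots> = S(1 := (w, min (Suc (min h ?L + ?c h)) ?L),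
          3 + t := full (v @ map (\<lambda>y. min (?c h) n = y) [0..<n]))"
        using S(3) t by (auto simp: rew_def S2_def fun_eq_iff fun_upd_apply)
      also have "\<dots> = ?h ((?J m)(1 := (w, min (Suc (min h ?L + ?c h)) ?L),
          3 + t := full (v @ map (\<lambda>y. min (?c h) n = y) [0..<n])))"
        using t by (simp add: S_def set_heads_tables[where t = t])
      also have "\<dots> = ?h (?J (?st xs m))"
        by (auto simp: m intro!: arg_cong[where f = ?h] simp: fun_eq_iff fun_upd_apply)
      finally show "?body (?h (?J m)) = ?h (?J (?st xs m))"
        unfolding S_def .
    qed
    have J0: "?J (length pre, []) = s"
      using tab inp by (simp add: w_def full_def fun_upd_idem)
    have len: "length ?u = n" "length ?is = k"
      by simp_all
    have "nest ?is ?body s = ?J (fold ?st (all_tuples n k) (length pre, []))"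
      using run[of "(length pre, [])"] unfolding J0 len .
    also have "fold ?st (all_tuples n k) (length pre, []) =
        (length (pre @ concat (map (\<lambda>xs. encode_nat (g xs)) (all_tuples n k))),
         [] @ concat (map (\<lambda>xs. map (\<lambda>y. g xs = y) [0..<n]) (all_tuples n k)))"
      using g by (intro fold_parse_numbers[OF w_def]) (simp add: set_all_tuples)
    finally show ?thesis
      using inp by (simp add: w_def)
  qed
  show ?thesis
    by (rule exI[of _ "nest ?is ?body"]) (use real sem in blast)
qed

lemma load_relation:
  assumes t: "t < length ar"
  shows "\<exists>f. realizable input_tapes f \<and> (\<forall>s n pre Q rest.
    (\<forall>j < k. s (cn j) = (replicate n True, 0)) \<longrightarrow> s (3 + t) = ([], 0) \<longrightarrow>
    s 1 = (pre @ map Q (all_tuples n k) @ rest, length pre) \<longrightarrow>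
    f s = s(1 := (fst (s 1), length (pre @ map Q (all_tuples n k))), 3 + t := full (map Q (all_tuples n k))))"
proof -
  let ?is = "map cn [0..<k]"
  let ?copy = "\<lambda>s. if symb (s 1) = 2 then app (3 + t) True s else app (3 + t) False s"
  let ?body = "\<lambda>s. mvr 1 (?copy s)"
  have real: "realizable input_tapes (nest ?is ?body)"
  proof (intro realizable_nest distinct_cn)
    show "realizable input_tapes ?body"
      using t by (intro realizable_comp[OF realizable_symb[where P = "\<lambda>s. s = 2"] realizable_mvr] realizable_app) simp_all
    show "keeps ?body i" if "i \<in> set ?is" for i
      using that t by (intro keeps_comp[OF keeps_if[OF keeps_prims(4) keeps_prims(4)] keeps_prims(1)]) auto
  qed auto
  have sem: "nest ?is ?body s = s(1 := (fst (s 1), length (pre @ map Q (all_tuples n k))),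
      3 + t := full (map Q (all_tuples n k)))"
    if cnt: "\<forall>j < k. s (cn j) = (replicate n True, 0)" and tab: "s (3 + t) = ([], 0)"
      and inp: "s 1 = (pre @ map Q (all_tuples n k) @ rest, length pre)"
    for s n pre Q rest
  proof -
    let ?u = "replicate n True"
    define w where "w = pre @ map Q (all_tuples n k) @ rest"
    let ?L = "length w"
    let ?J = "\<lambda>(h, v). s(1 := (w, min h ?L), 3 + t := full v)"
    let ?st = "\<lambda>xs :: nat list. \<lambda>(h, v). (Suc h, v @ [h < ?L \<and> w ! h])"
    have run: "nest ?is ?body (?J m) = ?J (fold ?st (all_tuples (length ?u) (length ?is)) m)" for m
    proof (rule nest_sim[OF distinct_cn])
      show "?J m i = (?u, 0)" if "i \<in> set ?is" for m i
        using that cnt t by (cases m) auto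
      fix xs and m :: "nat \<times> bool list" assume xs: "xs \<in> tuples {..<length ?u} (length ?is)"
      obtain h v where m: "m = (h, v)"
        by (cases m)
      let ?h = "set_heads ?u ?is xs"
      define S where "S = ?h (?J m)"
      have S: "S 1 = (w, min h ?L)" "S (3 + t) = full v"
        using t by (simp_all add: S_def m set_heads_tables_eq[where t = t])
      have "symb (S 1) = 2 \<longleftrightarrow> h < ?L \<and> w ! h"
        unfolding S by (auto simp: symb_def min_def)
      then have "?copy S = S(3 + t := full (v @ [h < ?L \<and> w ! h]))"
        using app_full[of S "3 + t" v, OF S(2)] by auto
      then have "?body S = S(1 := (w, min (Suc h) ?L), 3 + t := full (v @ [h < ?L \<and> w ! h]))"
        using S by (auto simp: mvr_def fun_eq_iff fun_upd_apply min_def)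
      also have "\<dots> = ?h ((?J m)(1 := (w, min (Suc h) ?L), 3 + t := full (v @ [h < ?L \<and> w ! h])))"
        using t by (simp add: S_def set_heads_tables[where t = t])
      also have "\<dots> = ?h (?J (?st xs m))"
        by (auto simp: m intro!: arg_cong[where f = ?h] simp: fun_eq_iff fun_upd_apply)
      finally show "?body (?h (?J m)) = ?h (?J (?st xs m))"
        unfolding S_def .
    qed
    have J0: "?J (length pre, []) = s"
      using tab inp by (simp add: w_def full_def fun_upd_idem)
    have len: "length ?u = n" "length ?is = k"
      by simp_all
    have "nest ?is ?body s = ?J (fold ?st (all_tuples n k) (length pre, []))"
      using run[of "(length pre, [])"] unfolding J0 len .
    also have "fold ?st (all_tuples n k) (length pre, []) =
        (length (pre @ map Q (all_tuples n k)), [] @ map Q (all_tuples n k))"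
      by (rule fold_parse_bits[OF w_def])
    finally show ?thesis
      using inp by (simp add: w_def)
  qed
  show ?thesis
    by (rule exI[of _ "nest ?is ?body"]) (use real sem in blast)
qed

lemma load_empty:
  assumes t: "t < length ar"
  shows "\<exists>f. realizable input_tapes f \<and> (\<forall>s n.
    (\<forall>j < k. s (cn j) = (replicate n True, 0)) \<longrightarrow> s (3 + t) = ([], 0) \<longrightarrow>
    f s = s(3 + t := full (map (\<lambda>_. False) (all_tuples n k))))"
proof -
  let ?is = "map cn [0..<k]"
  let ?body = "app (3 + t) False"
  have real: "realizable input_tapes (nest ?is ?body)"
    using t by (intro realizable_nest distinct_cn realizable_app) (auto intro: keeps_prims)
  have sem: "nest ?is ?body s = s(3 + t := full (map (\<lambda>_. False) (all_tuples n k)))"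
    if cnt: "\<forall>j < k. s (cn j) = (replicate n True, 0)" and tab: "s (3 + t) = ([], 0)" for s n
  proof -
    let ?u = "replicate n True"
    let ?J = "\<lambda>v. s(3 + t := full v)"
    have "nest ?is ?body (?J []) = ?J (fold (\<lambda>_ v. v @ [False]) (all_tuples (length ?u) (length ?is)) [])"
    proof (rule nest_sim[OF distinct_cn])
      show "?J m i = (?u, 0)" if "i \<in> set ?is" for m i
        using that cnt t by auto
      show "?body (set_heads ?u ?is xs (?J v)) = set_heads ?u ?is xs (?J (v @ [False]))" for xs v
        using t app_full[of "set_heads ?u ?is xs (?J v)" "3 + t" v False]
        by (simp add: set_heads_tables[where t = t])
    qed
    moreover have "?J [] = s"
      using tab by (simp add: full_def fun_upd_idem)
    ultimately show ?thesis
      by (simp add: fold_append[where g = "\<lambda>_. [False]"])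
  qed
  show ?thesis
    by (rule exI[of _ "nest ?is ?body"]) (use real sem in blast)
qed

text \<open>The input head starts behind \<open>pre\<close> and stops behind the code just read, so
  loaders for consecutive tables can be chained. \<open>X\<close> is the object encoded by the
  input; it occurs only in the specification.\<close>

definition loads :: "nat \<Rightarrow> (nat \<Rightarrow> 'x \<Rightarrow> bool) \<Rightarrow> (nat \<Rightarrow> 'x \<Rightarrow> bool list) \<Rightarrow> (nat \<Rightarrow> 'x \<Rightarrow> bool list) \<Rightarrow> bool" where
  "loads t C enc tb \<longleftrightarrow> (\<exists>f K. realizable input_tapes f \<and> (\<forall>s n X pre rest.
     (\<forall>j < K. s (cn j) = (replicate n True, 0)) \<longrightarrow> C n X \<longrightarrow> s (3 + t) = ([], 0) \<longrightarrow>
     s 1 = (pre @ enc n X @ rest, length pre) \<longrightarrow>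
     f s = s(1 := (pre @ enc n X @ rest, length (pre @ enc n X)), 3 + t := full (tb n X))))"

lemma loads_all:
  assumes "m \<le> length ar" "\<And>t. t < m \<Longrightarrow> loads t C (enc t) (tb t)"
  shows "\<exists>f K. realizable input_tapes f \<and> (\<forall>s n X pre rest.
     (\<forall>j < K. s (cn j) = (replicate n True, 0)) \<longrightarrow> C n X \<longrightarrow> (\<forall>t < m. s (3 + t) = ([], 0)) \<longrightarrow>
     s 1 = (pre @ concat (map (\<lambda>t. enc t n X) [0..<m]) @ rest, length pre) \<longrightarrow>
     f s = (\<lambda>i. if i = 1 then (fst (s 1), length (pre @ concat (map (\<lambda>t. enc t n X) [0..<m])))
       else if 3 \<le> i \<and> i < 3 + m then full (tb (i - 3) n X) else s i))"
  using assms
proof (induction m)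
  case 0
  show ?case
    by (rule exI[of _ "\<lambda>s. s"], rule exI[of _ 0]) (auto simp: realizable_id fun_eq_iff)
next
  case (Suc m)
  have "\<exists>f K. realizable input_tapes f \<and> (\<forall>s n X pre rest.
     (\<forall>j < K. s (cn j) = (replicate n True, 0)) \<longrightarrow> C n X \<longrightarrow> (\<forall>t < m. s (3 + t) = ([], 0)) \<longrightarrow>
     s 1 = (pre @ concat (map (\<lambda>t. enc t n X) [0..<m]) @ rest, length pre) \<longrightarrow>
     f s = (\<lambda>i. if i = 1 then (fst (s 1), length (pre @ concat (map (\<lambda>t. enc t n X) [0..<m])))
       else if 3 \<le> i \<and> i < 3 + m then full (tb (i - 3) n X) else s i))"
    by (rule Suc.IH) (use Suc.prems in auto)
  then obtain f K where f1: "realizable input_tapes f" and f2: "\<forall>s n X pre rest.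
     (\<forall>j < K. s (cn j) = (replicate n True, 0)) \<longrightarrow> C n X \<longrightarrow> (\<forall>t < m. s (3 + t) = ([], 0)) \<longrightarrow>
     s 1 = (pre @ concat (map (\<lambda>t. enc t n X) [0..<m]) @ rest, length pre) \<longrightarrow>
     f s = (\<lambda>i. if i = 1 then (fst (s 1), length (pre @ concat (map (\<lambda>t. enc t n X) [0..<m])))
       else if 3 \<le> i \<and> i < 3 + m then full (tb (i - 3) n X) else s i)"
    by (elim exE conjE)
  have "loads m C (enc m) (tb m)"
    by (rule Suc.prems(2)) simp
  then obtain g L where g1: "realizable input_tapes g" and g2: "\<forall>s n X pre rest.
     (\<forall>j < L. s (cn j) = (replicate n True, 0)) \<longrightarrow> C n X \<longrightarrow> s (3 + m) = ([], 0) \<longrightarrow>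
     s 1 = (pre @ enc m n X @ rest, length pre) \<longrightarrow>
     g s = s(1 := (pre @ enc m n X @ rest, length (pre @ enc m n X)), 3 + m := full (tb m n X))"
    unfolding loads_def by (elim exE conjE)
  have sem: "g (f s) = (\<lambda>i. if i = 1 then (fst (s 1), length (pre @ concat (map (\<lambda>t. enc t n X) [0..<Suc m])))
       else if 3 \<le> i \<and> i < 3 + Suc m then full (tb (i - 3) n X) else s i)"
    if cnt: "\<forall>j < max K L. s (cn j) = (replicate n True, 0)" and C: "C n X"
      and tab: "\<forall>t < Suc m. s (3 + t) = ([], 0)"
      and inp: "s 1 = (pre @ concat (map (\<lambda>t. enc t n X) [0..<Suc m]) @ rest, length pre)" for s n X pre rest
  proof -
    let ?pre = "pre @ concat (map (\<lambda>t. enc t n X) [0..<m])"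
    have fs: "f s = (\<lambda>i. if i = 1 then (fst (s 1), length ?pre)
       else if 3 \<le> i \<and> i < 3 + m then full (tb (i - 3) n X) else s i)"
      using cnt C tab inp by (intro f2[rule_format, where rest = "enc m n X @ rest"]) auto
    have "g (f s) = (f s)(1 := (?pre @ enc m n X @ rest, length (?pre @ enc m n X)), 3 + m := full (tb m n X))"
    proof (rule g2[rule_format])
      show "f s (cn j) = (replicate n True, 0)" if "j < L" for j
        using cnt that Suc.prems(1) by (auto simp: fs) (auto simp: cn_def)
    qed (use C tab inp in \<open>auto simp: fs\<close>)
    then show ?thesis
      using inp by (auto simp: fs fun_eq_iff fun_upd_apply)
  qed
  show ?case
    by (rule exI[of _ "\<lambda>s. g (f s)"], rule exI[of _ "max K L"]) (use realizable_comp[OF f1 g1] sem in blast)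
qed

definition start_mem :: "bool list \<Rightarrow> mem" where
  "start_mem w = (\<lambda>i. if i = 1 then (w, length w) else ([], 0))"

text \<open>Two phases with different tapes of constant length. While the counters are filled from
  the unary size in front of the input, only tape 1 is used as constant. Rewinding a tape requires
  that it counts as constant, so the counters are rewound in a second phase, in which no length
  changes.\<close>

lemma feasible_counters:
  "\<exists>f. feasible f \<and> (\<forall>n rest. f (start_mem (encode_nat n @ rest)) =
     (\<lambda>i. if i = 1 then (encode_nat n @ rest, Suc n) else if i = 2 then ([False], 0)
       else if i \<in> set (map cn [0..<K]) then (replicate n True, 0) else ([], 0)))"
proof -
  let ?fill = "\<lambda>j s. rew 1 (while_true 1 (\<lambda>s. mvr 1 (app (cn j) True s)) s)"
  let ?f1 = "\<lambda>s. fold ?fill [0..<K] (app 2 False (rew 1 s))"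
  let ?f2 = "\<lambda>s. mvr 1 (while_true 1 (mvr 1) (fold rew (2 # map cn [0..<K]) s))"
  have "realizable {1} ?f1"
  proof (intro realizable_comp[OF realizable_comp[OF realizable_rew realizable_app] realizable_fold])
    show "realizable {1} (?fill j)" for j
      by (intro realizable_comp[OF realizable_while_true[OF realizable_comp[OF realizable_app realizable_mvr]]
            realizable_rew]) (auto simp: mvr_def app_def)
  qed auto
  moreover have "realizable UNIV ?f2"
    by (intro realizable_comp[OF realizable_comp[OF realizable_fold realizable_while_true[OF realizable_mvr]]
          realizable_mvr] realizable_rew) auto
  ultimately have feas: "feasible (\<lambda>s. ?f2 (?f1 s))"
    by (rule feasible_comp[OF realizable_feasible realizable_feasible])
  have sem: "?f2 (?f1 (start_mem (encode_nat n @ rest))) =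
     (\<lambda>i. if i = 1 then (encode_nat n @ rest, Suc n) else if i = 2 then ([False], 0)
       else if i \<in> set (map cn [0..<K]) then (replicate n True, 0) else ([], 0))" for n rest
  proof -
    define w where "w = encode_nat n @ rest"
    have c: "count_true (w, 0) = n" and n: "n < length w"
      using count_true_encode[of "[]" n rest] by (auto simp: w_def encode_nat_def)
    define S where "S = (\<lambda>j i. if i = 1 then (w, 0) else if i = 2 then full [False]
       else if i \<in> set (map cn [0..<j]) then full (replicate n True) else ([], 0))"
    have "fold ?fill [0..<j] (S 0) = S j" for j
    proof (induction j)
      case (Suc j)
      have S1: "S j 1 = (w, 0)" and Sj: "S j (cn j) = full []"
        by (auto simp: S_def full_def)
      have "while_true 1 (\<lambda>s. mvr 1 (app (cn j) True s)) (S j) =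
          (S j)(1 := (w, min n (length w)), cn j := full (replicate n True))"
        unfolding while_true_def S1 c
        using funpow_mvr_app[of 1 "cn j" "S j" "[]" n True] S1 Sj by simp
      then have "?fill j (S j) = S (Suc j)"
        using S1 by (auto simp: rew_def S_def fun_eq_iff fun_upd_apply)
      then show ?case
        using Suc.IH by simp
    qed simp
    moreover have "app 2 False (rew 1 (start_mem w)) = S 0"
      by (auto simp: app_def rew_def start_mem_def S_def full_def fun_eq_iff fun_upd_apply)
    ultimately have 1: "?f1 (start_mem w) = S K"
      by simp
    define S' where "S' = fold rew (2 # map cn [0..<K]) (S K)"
    have S': "S' = (\<lambda>i. if i = 1 then (w, 0) else if i = 2 then ([False], 0)
       else if i \<in> set (map cn [0..<K]) then (replicate n True, 0) else ([], 0))"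
      unfolding S'_def fold_rew by (auto simp: S_def full_def fun_eq_iff)
    have S1: "S' 1 = (w, 0)"
      by (simp add: S')
    have "while_true 1 (mvr 1) S' = S'(1 := (w, n))"
      unfolding while_true_def S1 c using funpow_mvr[where s = S' and i = 1 and c = n] S1 n by simp
    then have 2: "?f2 (S K) = S'(1 := (w, Suc n))"
      using n unfolding S'_def[symmetric] by (simp add: mvr_def)
    show ?thesis
      unfolding w_def[symmetric] 1 2 by (auto simp: S' fun_eq_iff fun_upd_apply)
  qed
  show ?thesis
    by (rule exI[of _ "\<lambda>s. ?f2 (?f1 s)"]) (use feas sem in blast)
qed

lemma feasible_load:
  assumes "\<And>t. t < length ar \<Longrightarrow>
    loads t C (enc t) (\<lambda>n X. map (\<lambda>xs. xs \<in> R n X t) (all_tuples n (ar ! t)))"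
  shows "\<exists>f. feasible f \<and> (\<forall>n X rest. C n X \<longrightarrow>
    good K n (R n X) [] (f (start_mem (encode_nat n @ concat (map (\<lambda>t. enc t n X) [0..<length ar]) @ rest))) \<and>
    f (start_mem (encode_nat n @ concat (map (\<lambda>t. enc t n X) [0..<length ar]) @ rest)) 0 = ([], 0))"
proof -
  have "\<exists>f L. realizable input_tapes f \<and> (\<forall>s n X pre rest.
     (\<forall>j < L. s (cn j) = (replicate n True, 0)) \<longrightarrow> C n X \<longrightarrow> (\<forall>t < length ar. s (3 + t) = ([], 0)) \<longrightarrow>
     s 1 = (pre @ concat (map (\<lambda>t. enc t n X) [0..<length ar]) @ rest, length pre) \<longrightarrow>
     f s = (\<lambda>i. if i = 1 then (fst (s 1), length (pre @ concat (map (\<lambda>t. enc t n X) [0..<length ar])))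
       else if 3 \<le> i \<and> i < 3 + length ar then full (map (\<lambda>xs. xs \<in> R n X (i - 3)) (all_tuples n (ar ! (i - 3)))) else s i))"
    by (rule loads_all[OF order_refl assms])
  then obtain f L where f1: "realizable input_tapes f" and f2: "\<forall>s n X pre rest.
     (\<forall>j < L. s (cn j) = (replicate n True, 0)) \<longrightarrow> C n X \<longrightarrow> (\<forall>t < length ar. s (3 + t) = ([], 0)) \<longrightarrow>
     s 1 = (pre @ concat (map (\<lambda>t. enc t n X) [0..<length ar]) @ rest, length pre) \<longrightarrow>
     f s = (\<lambda>i. if i = 1 then (fst (s 1), length (pre @ concat (map (\<lambda>t. enc t n X) [0..<length ar])))
       else if 3 \<le> i \<and> i < 3 + length ar then full (map (\<lambda>xs. xs \<in> R n X (i - 3)) (all_tuples n (ar ! (i - 3)))) else s i)"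
    by (elim exE conjE)
  define M where "M = max K L"
  obtain g where g: "feasible g" "\<And>n rest. g (start_mem (encode_nat n @ rest)) =
     (\<lambda>i. if i = 1 then (encode_nat n @ rest, Suc n) else if i = 2 then ([False], 0)
       else if i \<in> set (map cn [0..<M]) then (replicate n True, 0) else ([], 0))"
    using feasible_counters[of M] by blast
  \<comment> \<open>The finished tables are rewound in a phase of their own, since they grow during
    loading and \<open>realizable_rew\<close> asks for a tape of constant length.\<close>
  let ?r = "fold rew (map ((+) 3) [0..<length ar])"
  have r: "realizable UNIV ?r"
    by (intro realizable_fold realizable_rew) simp
  have feas: "feasible (\<lambda>s. ?r (f (g s)))"
    by (rule feasible_comp[OF feasible_comp[OF g(1) realizable_feasible[OF f1]] realizable_feasible[OF r]])
  have sem: "good K n (R n X) [] (?r (f (g (start_mem w)))) \<and> ?r (f (g (start_mem w))) 0 = ([], 0)"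
    if C: "C n X" and w: "w = encode_nat n @ concat (map (\<lambda>t. enc t n X) [0..<length ar]) @ rest" for n X w rest
  proof -
    let ?s = "g (start_mem w)"
    have s: "?s = (\<lambda>i. if i = 1 then (w, Suc n) else if i = 2 then ([False], 0)
       else if i \<in> set (map cn [0..<M]) then (replicate n True, 0) else ([], 0))"
      unfolding w g(2) ..
    have fs: "f ?s = (\<lambda>i. if i = 1 then (fst (?s 1), length (encode_nat n @ concat (map (\<lambda>t. enc t n X) [0..<length ar])))
       else if 3 \<le> i \<and> i < 3 + length ar then full (map (\<lambda>xs. xs \<in> R n X (i - 3)) (all_tuples n (ar ! (i - 3)))) else ?s i)"
    proof (rule f2[rule_format])
      show "?s (cn j) = (replicate n True, 0)" if "j < L" for j
        using that by (auto simp: s M_def)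
      show "?s (3 + t) = ([], 0)" if "t < length ar" for t
        using that by (auto simp: s)
      show "?s 1 = (encode_nat n @ concat (map (\<lambda>t. enc t n X) [0..<length ar]) @ rest, length (encode_nat n))"
        unfolding s by (simp add: w encode_nat_def)
    qed (rule C)
    have "cn j \<notin> set (map ((+) 3) [0..<length ar])" "cn j < 3 + length ar \<longleftrightarrow> False" for j
      by (auto simp: cn_def)
    then show ?thesis
      unfolding fold_rew fs by (auto simp: good_def s M_def full_def)
  qed
  show ?thesis
    by (rule exI[of _ "\<lambda>s. ?r (f (g s))"]) (use feas sem in blast)
qed

end

section \<open>Terms, atomic definitions and the translated structure\<close>

primrec term_eval :: "('a list \<Rightarrow> 'a) list \<Rightarrow> 'a list \<Rightarrow> oterm \<Rightarrow> 'a" where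
  "term_eval fs v (Var i) = v ! i"
| "term_eval fs v (Op f ts) = (fs ! f) (map (term_eval fs v) ts)"

primrec subst :: "oterm list \<Rightarrow> oterm \<Rightarrow> oterm" where
  "subst us (Var i) = us ! i"
| "subst us (Op f ts) = Op f (map (subst us) ts)"

lemma term_eval_subst:
  "wf_oterm as (length us) t \<Longrightarrow> term_eval fs v (subst us t) = term_eval fs (map (term_eval fs v) us) t"
  by (induction t) (auto simp: list_all_iff intro!: arg_cong[where f = "fs ! _"])

lemma wf_subst:
  "wf_oterm as (length us) t \<Longrightarrow> list_all (wf_oterm as m) us \<Longrightarrow> wf_oterm as m (subst us t)"
  by (induction t) (auto simp: list_all_iff)

lemma tuples_nth: "xs \<in> tuples D k \<Longrightarrow> i < k \<Longrightarrow> xs ! i \<in> D"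
  by (auto simp: tuples_def)

lemma tuples_length: "xs \<in> tuples D k \<Longrightarrow> length xs = k"
  by (simp add: tuples_def)

lemma structure_op:
  "is_structure S A \<Longrightarrow> i < length (op_arities S) \<Longrightarrow> xs \<in> tuples (universe A) (op_arities S ! i) \<Longrightarrow>
    (operations A ! i) xs \<in> universe A"
  by (simp add: is_structure_def)

lemma structure_rel:
  "is_structure S A \<Longrightarrow> i < length (rel_arities S) \<Longrightarrow> relations A ! i \<subseteq> tuples (universe A) (rel_arities S ! i)"
  by (simp add: is_structure_def)

lemma term_eval_closed:
  assumes "is_structure S A" "wf_oterm (op_arities S) m t" "v \<in> tuples (universe A) m"
  shows "term_eval (operations A) v t \<in> universe A"
  using assms(2)
proof (induction t)
  case (Var i)
  then show ?case
    using assms(3) by (simp add: tuples_nth)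
next
  case (Op f ts)
  then show ?case
    by (auto simp: list_all_iff tuples_def intro!: structure_op[OF assms(1)])
qed

text \<open>Composition in the clone is substitution of terms. Closure of the universe under terms
  enters because the operations of the clone are compared with terms only on tuples over the
  universe.\<close>

lemma clone_term:
  assumes "is_structure S A" "(m, g) \<in> clone (universe A) (basic_operations S A)"
  shows "\<exists>t. wf_oterm (op_arities S) m t \<and> (\<forall>v\<in>tuples (universe A) m. term_eval (operations A) v t = g v)"
  using assms(2)
proof (induction rule: clone.induct)
  case (basic n f)
  then obtain i where i: "i < length (op_arities S)" "n = op_arities S ! i" "f = operations A ! i"
    using assms(1) by (auto simp: basic_operations_def in_set_zip)
  show ?case
  proof (intro exI conjI ballI)
    show "wf_oterm (op_arities S) n (Op i (map Var [0..<n]))"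
      using i by (simp add: list_all_iff)
    fix v assume "v \<in> tuples (universe A) n"
    moreover from this have "map (\<lambda>i. v ! i) [0..<n] = v"
      by (auto simp: tuples_def map_nth)
    ultimately show "term_eval (operations A) v (Op i (map Var [0..<n])) = restrict f (tuples (universe A) n) v"
      using i by (simp add: o_def)
  qed
next
  case (proj i n)
  then show ?case
    by (intro exI[of _ "Var i"]) auto
next
  case (comp gs f n)
  obtain t where t: "wf_oterm (op_arities S) (length gs) t"
    "\<And>v. v \<in> tuples (universe A) (length gs) \<Longrightarrow> term_eval (operations A) v t = f v"
    using comp.IH(1) by blast
  have "\<forall>g\<in>set gs. \<exists>t. wf_oterm (op_arities S) n t \<and>
      (\<forall>v\<in>tuples (universe A) n. term_eval (operations A) v t = g v)"
    using comp.IH(2) by blast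
  then obtain u where u: "\<And>g. g \<in> set gs \<Longrightarrow> wf_oterm (op_arities S) n (u g)"
    "\<And>g v. g \<in> set gs \<Longrightarrow> v \<in> tuples (universe A) n \<Longrightarrow> term_eval (operations A) v (u g) = g v"
    by metis
  show ?case
  proof (intro exI conjI ballI)
    show "wf_oterm (op_arities S) n (subst (map u gs) t)"
      using t(1) u(1) by (intro wf_subst) (auto simp: list_all_iff)
    fix v assume v: "v \<in> tuples (universe A) n"
    have eq: "map (term_eval (operations A) v) (map u gs) = map (\<lambda>g. g v) gs"
      using u(2) v by simp
    have "map (term_eval (operations A) v) (map u gs) \<in> tuples (universe A) (length gs)"
      using u(1) term_eval_closed[OF assms(1) _ v] by (auto simp: tuples_def)
    then have "map (\<lambda>g. g v) gs \<in> tuples (universe A) (length gs)"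
      unfolding eq .
    moreover have "wf_oterm (op_arities S) (length (map u gs)) t"
      using t(1) by simp
    ultimately show "term_eval (operations A) v (subst (map u gs) t) =
        (\<lambda>xs\<in>tuples (universe A) n. f (map (\<lambda>g. g xs) gs)) v"
      using v t(2) by (simp only: term_eval_subst eq restrict_apply' if_True)
  qed
qed

section \<open>Homomorphisms and translated terms\<close>

lemma hom_tuples: "is_hom S X A h \<Longrightarrow> v \<in> tuples (universe X) m \<Longrightarrow> map h v \<in> tuples (universe A) m"
  by (auto simp: is_hom_def tuples_def)

lemma hom_op: "is_hom S X A h \<Longrightarrow> i < length (op_arities S) \<Longrightarrow> xs \<in> tuples (universe X) (op_arities S ! i) \<Longrightarrow>
    h ((operations X ! i) xs) = (operations A ! i) (map h xs)"
  by (simp add: is_hom_def)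

lemma hom_rel: "is_hom S X A h \<Longrightarrow> i < length (rel_arities S) \<Longrightarrow> xs \<in> relations X ! i \<Longrightarrow>
    map h xs \<in> relations A ! i"
  by (simp add: is_hom_def)

lemma hom_term:
  assumes "is_structure S X" "is_hom S X A h" "wf_oterm (op_arities S) m t" "v \<in> tuples (universe X) m"
  shows "h (term_eval (operations X) v t) = term_eval (operations A) (map h v) t"
  using assms(3)
proof (induction t)
  case (Var i)
  then show ?case
    using assms(4) by (simp add: tuples_length)
next
  case (Op f ts)
  have "map (term_eval (operations X) v) ts \<in> tuples (universe X) (op_arities S ! f)"
    using Op.prems term_eval_closed[OF assms(1) _ assms(4)] by (auto simp: tuples_def list_all_iff)
  then have "h (term_eval (operations X) v (Op f ts)) =
      (operations A ! f) (map h (map (term_eval (operations X) v) ts))"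
    using Op.prems hom_op[OF assms(2)] by simp
  also have "map h (map (term_eval (operations X) v) ts) = map (term_eval (operations A) (map h v)) ts"
    using Op by (auto simp: list_all_iff)
  finally show ?case
    by simp
qed

primrec translate :: "(nat \<Rightarrow> oterm) \<Rightarrow> oterm \<Rightarrow> oterm" where
  "translate tt (Var i) = Var i"
| "translate tt (Op f ts) = subst (map (translate tt) ts) (tt f)"

lemma wf_translate:
  assumes "\<And>j. j < length bs \<Longrightarrow> wf_oterm as (bs ! j) (tt j)" "wf_oterm bs m t"
  shows "wf_oterm as m (translate tt t)"
  using assms(2)
proof (induction t)
  case (Op f ts)
  have "wf_oterm as (length (map (translate tt) ts)) (tt f)"
    using assms(1)[of f] Op.prems by simp
  then show ?case
    using Op by (auto simp: list_all_iff intro!: wf_subst)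
qed simp

text \<open>The partial operation that maps the columns of an enumeration of \<open>R\<close> to the entries of \<open>s\<close>
  preserves every relation of \<open>\<Gamma>\<close> once \<open>s\<close> satisfies the atomic constraints implied by \<open>R\<close>; as it is
  then a partial polymorphism of \<open>R\<close> as well, \<open>s\<close> belongs to \<open>R\<close>.\<close>

lemma relation_atomic_definition:
  assumes "finite D" "R \<subseteq> tuples D k" "s \<in> tuples D k"
    and \<Gamma>: "\<And>l Q. (l, Q) \<in> \<Gamma> \<Longrightarrow> Q \<subseteq> tuples D l"
    and pol: "\<And>p. p \<in> partial_polymorphisms D \<Gamma> \<Longrightarrow> preserves p (k, R)"
    and rels: "\<And>l Q js. (l, Q) \<in> \<Gamma> \<Longrightarrow> js \<in> tuples {..<k} l \<Longrightarrow> (\<forall>t\<in>R. map ((!) t) js \<in> Q) \<Longrightarrow>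
      map ((!) s) js \<in> Q"
    and eqs: "\<And>i j. i < k \<Longrightarrow> j < k \<Longrightarrow> (\<forall>t\<in>R. t ! i = t ! j) \<Longrightarrow> s ! i = s ! j"
  shows "s \<in> R"
proof -
  have "tuples D k = {xs. set xs \<subseteq> D \<and> length xs = k}"
    by (auto simp: tuples_def)
  then have "finite R"
    using finite_lists_length_eq[OF assms(1), of k] assms(2) finite_subset by metis
  \<comment> \<open>If \<open>R\<close> is empty, so is the list, and the operation below is
    nullary; preservation of \<open>R\<close> then asserts that \<open>R\<close> has a member, a
    contradiction. This is where partial operations of arity 0 are used.\<close>
  then obtain ts where ts: "set ts = R"
    using finite_list by blast
  define col where "col = (\<lambda>j. map (\<lambda>t. t ! j) ts)"
  \<comment> \<open>The choice of an index is harmless: coinciding columns express an equality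
    implied by \<open>R\<close>, which \<open>s\<close> satisfies by \<open>eqs\<close>.\<close>
  define h where "h = (\<lambda>c. if \<exists>j<k. c = col j then Some (s ! (SOME j. j < k \<and> c = col j)) else None)"
  have h_col: "h (col j) = Some (s ! j)" if "j < k" for j
  proof -
    define i where "i = (SOME i. i < k \<and> col j = col i)"
    have "i < k \<and> col j = col i"
      unfolding i_def by (rule someI[of _ j]) (simp add: that)
    moreover from this have "\<forall>t\<in>R. t ! i = t ! j"
      using ts by (auto simp: col_def)
    ultimately have "s ! i = s ! j"
      using eqs that by blast
    then show ?thesis
      using that by (auto simp: h_def i_def)
  qed
  have dom_h: "c \<in> dom h \<longleftrightarrow> (\<exists>j<k. c = col j)" for c
    by (auto simp: h_def split: if_splits)
  have len: "length t = k" if "t \<in> R" for t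
    using that assms(2) by (auto simp: tuples_def)
  have "dom h \<subseteq> tuples D (length ts)"
  proof
    fix c assume "c \<in> dom h"
    then obtain j where "j < k" "c = col j"
      unfolding dom_h by blast
    moreover from this have "t ! j \<in> D" if "t \<in> R" for t
      using tuples_nth[of t D k j] assms(2) that by blast
    ultimately show "c \<in> tuples D (length ts)"
      using ts by (auto simp: col_def tuples_def)
  qed
  moreover have "ran h \<subseteq> D"
  proof
    fix y assume "y \<in> ran h"
    then obtain c where c: "h c = Some y"
      by (auto simp: ran_def)
    then obtain j where "j < k" "c = col j"
      using dom_h by blast
    then show "y \<in> D"
      using c h_col[of j] assms(3) by (auto simp: tuples_nth)
  qed
  ultimately have part: "(length ts, h) \<in> partial_operations D"
    by (simp add: partial_operations_def)
  have "preserves (length ts, h) (l, Q)" if Q: "(l, Q) \<in> \<Gamma>" for l Q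
    unfolding preserves_def prod.case
  proof (intro allI impI, elim conjE)
    fix us assume us: "length us = length ts" "set us \<subseteq> Q" "\<forall>c<l. map (\<lambda>t. t ! c) us \<in> dom h"
    then have "\<forall>c<l. \<exists>j<k. map (\<lambda>t. t ! c) us = col j"
      by (simp add: dom_h)
    \<comment> \<open>Each column of \<open>us\<close> is a column of the enumeration, so the rows
      of \<open>us\<close> are the elements of \<open>R\<close> read along \<open>J\<close>. That
      all of them lie in \<open>Q\<close> is an atom implied by \<open>R\<close>, and
      \<open>s\<close> satisfies it.\<close>
    then obtain J where J: "\<And>c. c < l \<Longrightarrow> J c < k \<and> map (\<lambda>t. t ! c) us = col (J c)"
      by metis
    let ?js = "map J [0..<l]"
    have "map ((!) (ts ! a)) ?js = us ! a" if "a < length ts" for a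
    proof (rule nth_equalityI)
      have "us ! a \<in> tuples D l"
        using us(1,2) that \<Gamma>[OF Q] by (metis nth_mem subsetD)
      then show "length (map ((!) (ts ! a)) ?js) = length (us ! a)"
        by (simp add: tuples_def)
      fix c assume "c < length (map ((!) (ts ! a)) ?js)"
      then have c: "c < l"
        by simp
      have "map (\<lambda>t. t ! c) us ! a = col (J c) ! a"
        using J[OF c] by simp
      then show "map ((!) (ts ! a)) ?js ! c = us ! a ! c"
        using that us(1) c by (simp add: col_def)
    qed
    then have "\<forall>t\<in>R. map ((!) t) ?js \<in> Q"
      using us(1,2) ts by (metis in_set_conv_nth nth_mem subsetD)
    moreover have "?js \<in> tuples {..<k} l"
      using J by (auto simp: tuples_def)
    ultimately have "map ((!) s) ?js \<in> Q"
      using rels[OF Q] by blast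
    moreover have "map (\<lambda>c. the (h (map (\<lambda>t. t ! c) us))) [0..<l] = map ((!) s) ?js"
      using J h_col by auto
    ultimately show "map (\<lambda>c. the (h (map (\<lambda>t. t ! c) us))) [0..<l] \<in> Q"
      by (simp only:)
  qed
  then have "preserves (length ts, h) (k, R)"
    using part by (intro pol) (auto simp: partial_polymorphisms_def)
  then have "map (\<lambda>j. the (h (map (\<lambda>t. t ! j) ts))) [0..<k] \<in> R"
    unfolding preserves_def prod.case using ts h_col by (auto simp: dom_h col_def)
  moreover have "map (\<lambda>j. the (h (map (\<lambda>t. t ! j) ts))) [0..<k] = s"
    using h_col assms(3) by (auto simp: tuples_def col_def intro!: nth_equalityI)
  ultimately show ?thesis
    by (simp only:)
qed

text \<open>This is the one-sided information that a reduction from A to B uses; the other reduction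
  is a second instance with the roles exchanged. \<open>atomic\<close> will come from
  \<open>relation_atomic_definition\<close>, applied to the basic relations of B.\<close>

locale csp_translation =
  fixes S T :: signature and A B :: "'a struct" and tt ss :: "nat \<Rightarrow> oterm"
  assumes struct_A: "is_structure S A" and struct_B: "is_structure T B"
    and universe_B: "universe B = universe A"
    and tt_wf: "\<And>j. j < length (op_arities T) \<Longrightarrow> wf_oterm (op_arities S) (op_arities T ! j) (tt j)"
    and tt_eval: "\<And>j v. j < length (op_arities T) \<Longrightarrow> v \<in> tuples (universe A) (op_arities T ! j) \<Longrightarrow>
      term_eval (operations A) v (tt j) = (operations B ! j) v"
    and ss_wf: "\<And>i. i < length (op_arities S) \<Longrightarrow> wf_oterm (op_arities T) (op_arities S ! i) (ss i)"
    and ss_eval: "\<And>i v. i < length (op_arities S) \<Longrightarrow> v \<in> tuples (universe A) (op_arities S ! i) \<Longrightarrow>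
      term_eval (operations B) v (ss i) = (operations A ! i) v"
    and atomic: "\<And>i s. i < length (rel_arities S) \<Longrightarrow> s \<in> tuples (universe A) (rel_arities S ! i) \<Longrightarrow>
      (\<And>r js. r < length (rel_arities T) \<Longrightarrow> js \<in> tuples {..<rel_arities S ! i} (rel_arities T ! r) \<Longrightarrow>
        (\<forall>t\<in>relations A ! i. map ((!) t) js \<in> relations B ! r) \<Longrightarrow> map ((!) s) js \<in> relations B ! r) \<Longrightarrow>
      (\<And>j j'. j < rel_arities S ! i \<Longrightarrow> j' < rel_arities S ! i \<Longrightarrow>
        (\<forall>t\<in>relations A ! i. t ! j = t ! j') \<Longrightarrow> s ! j = s ! j') \<Longrightarrow> s \<in> relations A ! i"
begin

section \<open>Implied atoms, the generated congruence and the translated structure\<close>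

definition atoms :: "nat \<Rightarrow> (nat \<times> nat list) list" where
  "atoms r = concat (map (\<lambda>i. map (Pair i) (filter (\<lambda>js. \<forall>t\<in>relations A ! i. map ((!) t) js \<in> relations B ! r)
     (all_tuples (rel_arities S ! i) (rel_arities T ! r)))) [0..<length (rel_arities S)])"

text \<open>Like \<open>atoms\<close>, this depends on the signatures and templates alone, so the
  list is built into the machine and not computed from the instance.\<close>

definition equalities :: "(nat \<times> nat \<times> nat) list" where
  "equalities = concat (map (\<lambda>i. map (\<lambda>js. (i, js ! 0, js ! 1)) (filter (\<lambda>js. \<forall>t\<in>relations A ! i. t ! (js ! 0) = t ! (js ! 1))
     (all_tuples (rel_arities S ! i) 2))) [0..<length (rel_arities S)])"

lemma atoms_iff: "(i, js) \<in> set (atoms r) \<longleftrightarrow> i < length (rel_arities S) \<and>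
    js \<in> tuples {..<rel_arities S ! i} (rel_arities T ! r) \<and>
    (\<forall>t\<in>relations A ! i. map ((!) t) js \<in> relations B ! r)"
  by (auto simp: atoms_def set_all_tuples)

lemma equalities_iff: "(i, j, j') \<in> set equalities \<longleftrightarrow> i < length (rel_arities S) \<and>
    j < rel_arities S ! i \<and> j' < rel_arities S ! i \<and> (\<forall>t\<in>relations A ! i. t ! j = t ! j')"
proof
  assume R: "i < length (rel_arities S) \<and>
    j < rel_arities S ! i \<and> j' < rel_arities S ! i \<and> (\<forall>t\<in>relations A ! i. t ! j = t ! j')"
  then have "[j, j'] \<in> set (all_tuples (rel_arities S ! i) 2)"
    by (auto simp: set_all_tuples tuples_def)
  then show "(i, j, j') \<in> set equalities"
    using R by (auto simp: equalities_def intro!: image_eqI[of _ _ "[j, j']"] bexI[of _ i])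
qed (auto simp: equalities_def set_all_tuples dest: tuples_nth[of _ "{..<_}" 2 0] tuples_nth[of _ "{..<_}" 2 "Suc 0"])

text \<open>All rules that generate the congruence are collected in one monotone operator. Its
  closed relations can be compared with kernels of homomorphisms, and a single application is a
  first-order condition that can be tested on tables.\<close>

definition step :: "nat struct \<Rightarrow> (nat \<Rightarrow> nat \<Rightarrow> bool) \<Rightarrow> nat \<Rightarrow> nat \<Rightarrow> bool" where
  "step X E x y \<longleftrightarrow> x = y \<or> E y x \<or> (\<exists>z\<in>universe X. E x z \<and> E z y) \<or>
     (\<exists>i < length (op_arities S). \<exists>xs\<in>tuples (universe X) (op_arities S ! i).
        x = (operations X ! i) xs \<and> y = term_eval (operations X) xs (translate tt (ss i))) \<or>
     (\<exists>(i, j, j')\<in>set equalities. \<exists>xs\<in>relations X ! i. x = xs ! j \<and> y = xs ! j') \<or>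
     (\<exists>i < length (op_arities S). \<exists>xs\<in>tuples (universe X) (op_arities S ! i).
        \<exists>ys\<in>tuples (universe X) (op_arities S ! i). (\<forall>j < op_arities S ! i. E (xs ! j) (ys ! j)) \<and>
        x = (operations X ! i) xs \<and> y = (operations X ! i) ys)"

lemma step_mono: "step X E x y \<Longrightarrow> (\<And>x y. E x y \<Longrightarrow> E' x y) \<Longrightarrow> step X E' x y"
  unfolding step_def by blast

definition target :: "nat struct \<Rightarrow> (nat \<Rightarrow> nat \<Rightarrow> bool) \<Rightarrow> nat struct" where
  "target X E = \<lparr>universe = universe X,
     operations = map (\<lambda>j xs. LEAST y. E (term_eval (operations X) xs (tt j)) y) [0..<length (op_arities T)],
     relations = map (\<lambda>r. {ys \<in> tuples (universe X) (rel_arities T ! r). \<exists>(i, js)\<in>set (atoms r). \<exists>xs\<in>relations X ! i.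
       \<forall>c < rel_arities T ! r. E (xs ! (js ! c)) (ys ! c)}) [0..<length (rel_arities T)]\<rparr>"

text \<open>On \<open>X\<close> an operation may differ from its double translation, but on A the
  two agree, and this puts the resulting pairs into the kernel. In the same way the implied
  equalities hold in A for the images of related tuples. The other rules hold for the kernel of any
  map that commutes with the operations.\<close>

lemma hom_kernel:
  assumes X: "is_structure S X" and h: "is_hom S X A h" and st: "step X (\<lambda>x y. h x = h y) x y"
  shows "h x = h y"
  using st unfolding step_def
proof (elim disjE)
  assume "\<exists>i < length (op_arities S). \<exists>xs\<in>tuples (universe X) (op_arities S ! i).
        x = (operations X ! i) xs \<and> y = term_eval (operations X) xs (translate tt (ss i))"
  then obtain i xs where i: "i < length (op_arities S)" "xs \<in> tuples (universe X) (op_arities S ! i)"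
    "x = (operations X ! i) xs" "y = term_eval (operations X) xs (translate tt (ss i))"
    by blast
  have eval: "term_eval (operations A) v (translate tt t) = term_eval (operations B) v t"
    if "wf_oterm (op_arities T) m t" "v \<in> tuples (universe A) m" for m t v
    using that(1)
  proof (induction t)
    case (Op f ts)
    have wf: "wf_oterm (op_arities S) (length (map (translate tt) ts)) (tt f)"
      using Op.prems tt_wf[of f] by simp
    have "map (term_eval (operations A) v) (map (translate tt) ts) = map (term_eval (operations B) v) ts"
      using Op by (auto simp: list_all_iff)
    moreover have "map (term_eval (operations B) v) ts \<in> tuples (universe A) (op_arities T ! f)"
      using Op.prems that(2) term_eval_closed[OF struct_B, of m _ v]
      by (auto simp: list_all_iff tuples_def universe_B)
    ultimately show ?case
      using Op.prems tt_eval[of f] by (simp add: term_eval_subst[OF wf] del: map_map)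
  qed simp
  have hv: "map h xs \<in> tuples (universe A) (op_arities S ! i)"
    by (rule hom_tuples[OF h i(2)])
  have "h y = term_eval (operations A) (map h xs) (translate tt (ss i))"
    unfolding i(4) by (rule hom_term[OF X h wf_translate[OF tt_wf ss_wf[OF i(1)]] i(2)])
  also have "\<dots> = (operations A ! i) (map h xs)"
    using eval[OF ss_wf[OF i(1)] hv] ss_eval[OF i(1) hv] by simp
  finally show ?thesis
    using hom_op[OF h i(1,2)] i(3) by simp
next
  assume "\<exists>(i, j, j')\<in>set equalities. \<exists>xs\<in>relations X ! i. x = xs ! j \<and> y = xs ! j'"
  then obtain i j j' xs where i: "i < length (rel_arities S)" "j < rel_arities S ! i" "j' < rel_arities S ! i"
    "\<forall>t\<in>relations A ! i. t ! j = t ! j'" "xs \<in> relations X ! i" "x = xs ! j" "y = xs ! j'"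
    by (auto simp: equalities_iff)
  have "map h xs ! j = map h xs ! j'"
    using i(4) hom_rel[OF h i(1,5)] by blast
  then show ?thesis
    using i structure_rel[OF X i(1)] by (auto simp: tuples_def)
next
  assume "\<exists>i < length (op_arities S). \<exists>xs\<in>tuples (universe X) (op_arities S ! i).
        \<exists>ys\<in>tuples (universe X) (op_arities S ! i). (\<forall>j < op_arities S ! i. h (xs ! j) = h (ys ! j)) \<and>
        x = (operations X ! i) xs \<and> y = (operations X ! i) ys"
  then obtain i xs ys where i: "i < length (op_arities S)" "xs \<in> tuples (universe X) (op_arities S ! i)"
    "ys \<in> tuples (universe X) (op_arities S ! i)" "\<forall>j < op_arities S ! i. h (xs ! j) = h (ys ! j)"
    "x = (operations X ! i) xs" "y = (operations X ! i) ys"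
    by blast
  have "map h xs = map h ys"
    using i(2-4) by (auto simp: tuples_def intro!: nth_equalityI)
  then show ?thesis
    using i hom_op[OF h] by simp
qed auto

text \<open>\<open>E\<close> enters through closedness, its range and soundness only, so its
  construction is kept apart. A homomorphism to A is itself one from the target to B, since
  \<open>E\<close> lies in its kernel. Conversely, a homomorphism \<open>g\<close> on the target
  need not be constant on classes; it is composed with the choice \<rho> of least
  representatives.\<close>

theorem target_correct:
  assumes X: "X \<in> finite_structures S"
    and closed: "\<And>x y. x \<in> universe X \<Longrightarrow> y \<in> universe X \<Longrightarrow> step X E x y \<Longrightarrow> E x y"
    and E_universe: "\<And>x y. E x y \<Longrightarrow> x \<in> universe X \<and> y \<in> universe X"
    and sound: "\<And>h x y. is_hom S X A h \<Longrightarrow> E x y \<Longrightarrow> h x = h y"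
  shows "target X E \<in> finite_structures T"
    and "(\<exists>h. is_hom S X A h) \<longleftrightarrow> (\<exists>h. is_hom T (target X E) B h)"
proof -
  let ?Y = "target X E" and ?U = "universe X" and ?f = "operations X"
  have X': "is_structure S X"
    using X by (simp add: finite_structures_def)
  have refl: "E x x" if "x \<in> ?U" for x
    using closed[OF that that] by (simp add: step_def)
  have sym: "E y x" if "E x y" for x y
    using closed[of y x] E_universe[OF that] that by (auto simp: step_def)
  have trans: "E x y" if "E x z" "E z y" for x y z
  proof (rule closed)
    show "step X E x y"
      unfolding step_def using E_universe[OF that(1)] that by blast
  qed (use E_universe that in blast)+
  define \<rho> where "\<rho> x = (LEAST y. E x y)" for x
  have \<rho>: "E x (\<rho> x)" if "x \<in> ?U" for x
    unfolding \<rho>_def using refl[OF that] by (rule LeastI)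
  have \<rho>_U: "\<rho> x \<in> ?U" if "x \<in> ?U" for x
    using \<rho>[OF that] E_universe by blast
  have \<rho>_cong: "\<rho> x = \<rho> y" if "E x y" for x y
  proof -
    have "E x = E y"
      using that sym trans by blast
    then show ?thesis
      by (simp add: \<rho>_def)
  qed
  have E_term: "E (term_eval ?f v t) (term_eval ?f v' t)"
    if "wf_oterm (op_arities S) m t" "v \<in> tuples ?U m" "v' \<in> tuples ?U m" "\<And>j. j < m \<Longrightarrow> E (v ! j) (v' ! j)"
    for m t v v'
    using that(1)
  proof (induction t)
    case (Var i)
    then show ?case
      using that(4) by simp
  next
    case (Op g ts)
    let ?a = "map (term_eval ?f v) ts" and ?b = "map (term_eval ?f v') ts"
    have tup: "?a \<in> tuples ?U (op_arities S ! g)" "?b \<in> tuples ?U (op_arities S ! g)"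
      using Op.prems term_eval_closed[OF X' _ that(2)] term_eval_closed[OF X' _ that(3)]
      by (auto simp: list_all_iff tuples_def)
    have g: "g < length (op_arities S)"
      using Op.prems by simp
    have "\<forall>j < op_arities S ! g. E (?a ! j) (?b ! j)"
      using Op by (auto simp: list_all_iff)
    then have "step X E ((?f ! g) ?a) ((?f ! g) ?b)"
      using g tup unfolding step_def by blast
    then show ?case
      using closed structure_op[OF X' g] tup by simp
  qed
  have U_Y: "universe ?Y = ?U"
    by (simp add: target_def)
  have op_Y: "(operations ?Y ! j) xs = \<rho> (term_eval ?f xs (tt j))" if "j < length (op_arities T)" for j xs
    using that by (simp add: target_def \<rho>_def)
  have rel_Y: "ys \<in> relations ?Y ! r \<longleftrightarrow> ys \<in> tuples ?U (rel_arities T ! r) \<and>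
      (\<exists>(i, js)\<in>set (atoms r). \<exists>xs\<in>relations X ! i. \<forall>c < rel_arities T ! r. E (xs ! (js ! c)) (ys ! c))"
    if "r < length (rel_arities T)" for r ys
    using that by (simp add: target_def)
  have Y: "is_structure T ?Y"
    unfolding is_structure_def
  proof (intro conjI allI impI ballI)
    fix j xs assume j: "j < length (op_arities T)" "xs \<in> tuples (universe ?Y) (op_arities T ! j)"
    then show "(operations ?Y ! j) xs \<in> universe ?Y"
      unfolding op_Y[OF j(1)] U_Y using term_eval_closed[OF X' tt_wf[OF j(1)]] by (intro \<rho>_U) blast
  qed (auto simp: rel_Y U_Y, auto simp: target_def)
  then show "?Y \<in> finite_structures T"
    using X by (auto simp: finite_structures_def U_Y)
  show "(\<exists>h. is_hom S X A h) \<longleftrightarrow> (\<exists>h. is_hom T ?Y B h)"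
  proof (intro iffI; elim exE)
    fix h assume h: "is_hom S X A h"
    have "is_hom T ?Y B h"
      unfolding is_hom_def
    proof (intro conjI allI impI ballI)
      show "h \<in> universe ?Y \<rightarrow> universe B"
        using h by (simp add: is_hom_def U_Y universe_B)
    next
      fix j xs assume j: "j < length (op_arities T)" and "xs \<in> tuples (universe ?Y) (op_arities T ! j)"
      then have xs: "xs \<in> tuples ?U (op_arities T ! j)"
        by (simp add: U_Y)
      have "h ((operations ?Y ! j) xs) = h (term_eval ?f xs (tt j))"
        unfolding op_Y[OF j] using sound[OF h \<rho>[OF term_eval_closed[OF X' tt_wf[OF j] xs]]] by simp
      also have "\<dots> = term_eval (operations A) (map h xs) (tt j)"
        by (rule hom_term[OF X' h tt_wf[OF j] xs])
      also have "\<dots> = (operations B ! j) (map h xs)"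
        by (rule tt_eval[OF j hom_tuples[OF h xs]])
      finally show "h ((operations ?Y ! j) xs) = (operations B ! j) (map h xs)" .
    next
      fix r ys assume r: "r < length (rel_arities T)" and "ys \<in> relations ?Y ! r"
      then obtain i js xs where ys: "ys \<in> tuples ?U (rel_arities T ! r)" and a: "(i, js) \<in> set (atoms r)"
        and xs: "xs \<in> relations X ! i" "\<forall>c < rel_arities T ! r. E (xs ! (js ! c)) (ys ! c)"
        unfolding rel_Y[OF r] by blast
      have i: "i < length (rel_arities S)" and js: "js \<in> tuples {..<rel_arities S ! i} (rel_arities T ! r)"
        and impl: "\<forall>t\<in>relations A ! i. map ((!) t) js \<in> relations B ! r"
        using a by (simp_all add: atoms_iff)
      have "length xs = rel_arities S ! i"
        using structure_rel[OF X' i] xs(1) by (auto simp: tuples_def)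
      then have "map ((!) (map h xs)) js = map h ys"
        using ys js xs(2) sound[OF h] by (auto simp: tuples_def subset_iff in_set_conv_nth intro!: nth_equalityI)
          (metis nth_map)
      then show "map h ys \<in> relations B ! r"
        using impl hom_rel[OF h i xs(1)] by metis
    qed
    then show "\<exists>h. is_hom T ?Y B h"
      by blast
  next
    fix g assume g: "is_hom T ?Y B g"
    define h where "h x = g (\<rho> x)" for x
    have \<rho>_tuples: "map \<rho> v \<in> tuples ?U m" if "v \<in> tuples ?U m" for v m
      using that \<rho>_U by (auto simp: tuples_def)
    \<comment> \<open>The operations of the target return representatives. Feeding representatives
      into a term changes its value only within its class, because \<open>E\<close> is compatible
      with all terms over \<open>X\<close>.\<close>
    have term_Y: "term_eval (operations ?Y) (map \<rho> v) t = \<rho> (term_eval ?f v (translate tt t))"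
      if "wf_oterm (op_arities T) m t" "v \<in> tuples ?U m" for m t v
      using that(1)
    proof (induction t)
      case (Var i)
      then show ?case
        using that(2) by (simp add: tuples_length)
    next
      case (Op j ts)
      let ?a = "map (term_eval ?f v) (map (translate tt) ts)"
      have j: "j < length (op_arities T)" "length ts = op_arities T ! j"
        using Op.prems by simp_all
      have wf: "wf_oterm (op_arities S) (length (map (translate tt) ts)) (tt j)"
        using tt_wf[OF j(1)] j(2) by simp
      have a: "?a \<in> tuples ?U (op_arities T ! j)"
        using Op.prems term_eval_closed[OF X' wf_translate[OF tt_wf] that(2)]
        by (auto simp: list_all_iff tuples_def)
      have "map (term_eval (operations ?Y) (map \<rho> v)) ts = map \<rho> ?a"
        using Op by (auto simp: list_all_iff)
      then have "term_eval (operations ?Y) (map \<rho> v) (Op j ts) = \<rho> (term_eval ?f (map \<rho> ?a) (tt j))"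
        by (simp add: op_Y[OF j(1)] del: map_map)
      also have "\<dots> = \<rho> (term_eval ?f ?a (tt j))"
      proof (rule \<rho>_cong, rule E_term[OF tt_wf[OF j(1)] \<rho>_tuples[OF a] a])
        fix c assume c: "c < op_arities T ! j"
        then have "c < length ?a"
          unfolding tuples_length[OF a] .
        then have "map \<rho> ?a ! c = \<rho> (?a ! c)" "?a ! c \<in> ?U"
          using tuples_nth[OF a c] by (simp_all only: nth_map)
        then show "E (map \<rho> ?a ! c) (?a ! c)"
          using sym[OF \<rho>] by simp
      qed
      finally show ?case
        by (simp add: term_eval_subst[OF wf] del: map_map)
    qed
    have hom_g: "g \<in> ?U \<rightarrow> universe A"
      using g by (simp add: is_hom_def U_Y universe_B)
    have "is_hom S X A h"
      unfolding is_hom_def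
    proof (intro conjI allI impI ballI)
      show h_fun: "h \<in> ?U \<rightarrow> universe A"
        using hom_g \<rho>_U by (auto simp: h_def)
      fix i xs assume i: "i < length (op_arities S)" and xs: "xs \<in> tuples ?U (op_arities S ! i)"
      \<comment> \<open>Here the identification of an operation with its double translation is used:
        it replaces the operation by a term that the target can evaluate.\<close>
      have "step X E ((?f ! i) xs) (term_eval ?f xs (translate tt (ss i)))"
        using i xs unfolding step_def by blast
      then have "E ((?f ! i) xs) (term_eval ?f xs (translate tt (ss i)))"
        using structure_op[OF X' i xs] term_eval_closed[OF X' wf_translate[OF tt_wf ss_wf[OF i]] xs]
        by (intro closed)
      then have "h ((?f ! i) xs) = g (\<rho> (term_eval ?f xs (translate tt (ss i))))"
        by (simp add: h_def \<rho>_cong)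
      also have "\<dots> = g (term_eval (operations ?Y) (map \<rho> xs) (ss i))"
        by (simp add: term_Y[OF ss_wf[OF i] xs])
      also have "\<dots> = term_eval (operations B) (map g (map \<rho> xs)) (ss i)"
        using \<rho>_tuples[OF xs] by (intro hom_term[OF Y g ss_wf[OF i]]) (simp add: U_Y)
      also have "map g (map \<rho> xs) = map h xs"
        by (simp add: h_def)
      also have "term_eval (operations B) (map h xs) (ss i) = (operations A ! i) (map h xs)"
        using xs h_fun by (intro ss_eval[OF i]) (auto simp: tuples_def)
      finally show "h ((?f ! i) xs) = (operations A ! i) (map h xs)" .
    next
      fix i xs assume i: "i < length (rel_arities S)" and xs: "xs \<in> relations X ! i"
      have xs_tup: "xs \<in> tuples ?U (rel_arities S ! i)"
        using structure_rel[OF X' i] xs by blast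
      show "map h xs \<in> relations A ! i"
      proof (rule atomic[OF i])
        show "map h xs \<in> tuples (universe A) (rel_arities S ! i)"
          using xs_tup hom_g \<rho>_U by (auto simp: tuples_def h_def)
      next
        fix r js assume r: "r < length (rel_arities T)" and js: "js \<in> tuples {..<rel_arities S ! i} (rel_arities T ! r)"
          and impl: "\<forall>t\<in>relations A ! i. map ((!) t) js \<in> relations B ! r"
        \<comment> \<open>The representatives of the selected entries form a tuple of the target
          relation because that relation is saturated under \<open>E\<close>.\<close>
        let ?ys = "map (\<lambda>j. \<rho> (xs ! j)) js"
        have js': "xs ! j \<in> ?U" "j < length xs" if "j \<in> set js" for j
          using that js tuples_nth[OF xs_tup, of j] tuples_length[OF xs_tup] by (auto simp: tuples_def)
        have "?ys \<in> tuples ?U (rel_arities T ! r)"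
          using js js' \<rho>_U by (auto simp: tuples_def)
        moreover have "(i, js) \<in> set (atoms r)"
          using i js impl by (simp add: atoms_iff)
        moreover have "\<forall>c < rel_arities T ! r. E (xs ! (js ! c)) (?ys ! c)"
          using js js' \<rho> by (auto simp: tuples_def)
        ultimately have "?ys \<in> relations ?Y ! r"
          unfolding rel_Y[OF r] using xs by blast
        then have "map g ?ys \<in> relations B ! r"
          by (rule hom_rel[OF g r])
        moreover have "map g ?ys = map ((!) (map h xs)) js"
          using js' by (auto simp: h_def)
        ultimately show "map ((!) (map h xs)) js \<in> relations B ! r"
          by (simp only:)
      next
        fix j j' assume j: "j < rel_arities S ! i" "j' < rel_arities S ! i" "\<forall>t\<in>relations A ! i. t ! j = t ! j'"
        then have "(i, j, j') \<in> set equalities"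
          using i by (simp add: equalities_iff)
        then have "step X E (xs ! j) (xs ! j')"
          using xs unfolding step_def by blast
        then have "E (xs ! j) (xs ! j')"
          using tuples_nth[OF xs_tup] j by (intro closed) auto
        then show "map h xs ! j = map h xs ! j'"
          using j tuples_length[OF xs_tup] by (simp add: h_def \<rho>_cong)
      qed
    qed
    then show "\<exists>h. is_hom S X A h"
      by blast
  qed
qed

end

lemma csp_translation_exists:
  fixes A B :: "'a struct"
  assumes A: "is_structure S A" and B: "is_structure T B"
    and fin: "finite (universe A)" and univ: "universe A = universe B"
    and clones: "clone (universe A) (basic_operations S A) = clone (universe B) (basic_operations T B)"
    and pols: "partial_polymorphisms (universe A) (basic_relations S A) =
         partial_polymorphisms (universe B) (basic_relations T B)"
  shows "\<exists>tt ss. csp_translation S T A B tt ss"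
proof -
  \<comment> \<open>The structures are generalized because the fact is applied in both directions,
    to obtain \<open>tt\<close> and \<open>ss\<close>.\<close>
  have terms: "\<exists>t. wf_oterm (op_arities S) (op_arities T ! j) t \<and>
      (\<forall>v\<in>tuples (universe A) (op_arities T ! j). term_eval (operations A) v t = (operations B ! j) v)"
    if A: "is_structure S A" and B: "is_structure T B"
      and clones: "clone (universe A) (basic_operations S A) = clone (universe A) (basic_operations T B)"
      and j: "j < length (op_arities T)" for S T and A B :: "'a struct" and j
  proof -
    have "(op_arities T ! j, operations B ! j) \<in> basic_operations T B"
      using B j by (auto simp: basic_operations_def is_structure_def in_set_zip)
    then have "(op_arities T ! j, restrict (operations B ! j) (tuples (universe A) (op_arities T ! j))) \<in>
        clone (universe A) (basic_operations S A)"
      unfolding clones by (rule clone.basic)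
    from clone_term[OF A this] show ?thesis
      by auto
  qed
  obtain tt where tt: "\<And>j. j < length (op_arities T) \<Longrightarrow> wf_oterm (op_arities S) (op_arities T ! j) (tt j)"
    "\<And>j v. j < length (op_arities T) \<Longrightarrow> v \<in> tuples (universe A) (op_arities T ! j) \<Longrightarrow>
      term_eval (operations A) v (tt j) = (operations B ! j) v"
    using terms[OF A B clones[folded univ]] by metis
  obtain ss where ss: "\<And>i. i < length (op_arities S) \<Longrightarrow> wf_oterm (op_arities T) (op_arities S ! i) (ss i)"
    "\<And>i v. i < length (op_arities S) \<Longrightarrow> v \<in> tuples (universe A) (op_arities S ! i) \<Longrightarrow>
      term_eval (operations B) v (ss i) = (operations A ! i) v"
    using terms[OF B A, folded univ, OF clones[folded univ, symmetric]] by metis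
  have "csp_translation S T A B tt ss"
  proof unfold_locales
    fix i s assume i: "i < length (rel_arities S)" and s: "s \<in> tuples (universe A) (rel_arities S ! i)"
      and rels: "\<And>r js. r < length (rel_arities T) \<Longrightarrow> js \<in> tuples {..<rel_arities S ! i} (rel_arities T ! r) \<Longrightarrow>
        (\<forall>t\<in>relations A ! i. map ((!) t) js \<in> relations B ! r) \<Longrightarrow> map ((!) s) js \<in> relations B ! r"
      and eqs: "\<And>j j'. j < rel_arities S ! i \<Longrightarrow> j' < rel_arities S ! i \<Longrightarrow>
        (\<forall>t\<in>relations A ! i. t ! j = t ! j') \<Longrightarrow> s ! j = s ! j'"
    have idx: "\<exists>r < length (rel_arities T). l = rel_arities T ! r \<and> Q = relations B ! r"
      if "(l, Q) \<in> basic_relations T B" for l Q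
      using that B by (auto simp: basic_relations_def is_structure_def in_set_zip)
    show "s \<in> relations A ! i"
    proof (rule relation_atomic_definition[OF fin structure_rel[OF A i] s, of "basic_relations T B"])
      show "Q \<subseteq> tuples (universe A) l" if "(l, Q) \<in> basic_relations T B" for l Q
        using idx[OF that] structure_rel[OF B] univ by auto
      show "preserves p (rel_arities S ! i, relations A ! i)"
        if "p \<in> partial_polymorphisms (universe A) (basic_relations T B)" for p
      proof -
        have "p \<in> partial_polymorphisms (universe A) (basic_relations S A)"
          using that pols univ by simp
        moreover have "(rel_arities S ! i, relations A ! i) \<in> basic_relations S A"
          using A i by (auto simp: basic_relations_def is_structure_def in_set_zip)
        ultimately show ?thesis
          by (auto simp: partial_polymorphisms_def)
      qed
      show "map ((!) s) js \<in> Q" if "(l, Q) \<in> basic_relations T B" "js \<in> tuples {..<rel_arities S ! i} l"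
        "\<forall>t\<in>relations A ! i. map ((!) t) js \<in> Q" for l Q js
        using idx[OF that(1)] that(2,3) rels by blast
    qed (use eqs in blast)
  qed (use A B univ tt ss in auto)
  then show ?thesis
    by blast
qed

section \<open>Injectivity of the encoding\<close>

lemma encode_numbers_inject:
  "concat (map (\<lambda>x. encode_nat (f x)) xs) @ r = concat (map (\<lambda>x. encode_nat (g x)) xs) @ r' \<Longrightarrow>
    (\<forall>x\<in>set xs. f x = g x) \<and> r = r'"
proof (induction xs)
  case (Cons x xs)
  have "encode_nat (f x) @ (concat (map (\<lambda>x. encode_nat (f x)) xs) @ r) =
      encode_nat (g x) @ (concat (map (\<lambda>x. encode_nat (g x)) xs) @ r')"
    using Cons.prems by simp
  from encode_nat_eq[OF this] have "f x = g x"
    and rest: "concat (map (\<lambda>x. encode_nat (f x)) xs) @ r = concat (map (\<lambda>x. encode_nat (g x)) xs) @ r'"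
    by blast+
  with Cons.IH[OF rest] show ?case
    by simp
qed simp

lemma encode_operations_inject:
  assumes "length fs = length as" "length gs = length as"
    and "concat (map (encode_operation n) (zip as fs)) @ r = concat (map (encode_operation n) (zip as gs)) @ r'"
  shows "(\<forall>i < length as. \<forall>xs\<in>tuples {..<n} (as ! i). (fs ! i) xs = (gs ! i) xs) \<and> r = r'"
  using assms
proof (induction as arbitrary: fs gs)
  case (Cons a as)
  obtain f fs' g gs' where fg: "fs = f # fs'" "gs = g # gs'"
    using Cons.prems by (metis length_Suc_conv)
  have "concat (map (\<lambda>x. encode_nat (f x)) (all_tuples n a)) @ (concat (map (encode_operation n) (zip as fs')) @ r) =
      concat (map (\<lambda>x. encode_nat (g x)) (all_tuples n a)) @ (concat (map (encode_operation n) (zip as gs')) @ r')"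
    using Cons.prems(3) by (simp add: fg encode_operation_def)
  from encode_numbers_inject[OF this] have 1: "\<forall>xs\<in>tuples {..<n} a. f xs = g xs"
    "concat (map (encode_operation n) (zip as fs')) @ r = concat (map (encode_operation n) (zip as gs')) @ r'"
    by (auto simp: set_all_tuples)
  have "(\<forall>i < length as. \<forall>xs\<in>tuples {..<n} (as ! i). (fs' ! i) xs = (gs' ! i) xs) \<and> r = r'"
    using Cons.prems(1,2) by (intro Cons.IH 1) (auto simp: fg)
  then show ?case
    using 1(1) by (auto simp: fg nth_Cons split: nat.split)
qed simp

lemma encode_relations_inject:
  assumes "length Rs = length as" "length Qs = length as"
    and "concat (map (encode_relation n) (zip as Rs)) = concat (map (encode_relation n) (zip as Qs))"
  shows "\<forall>i < length as. \<forall>xs\<in>tuples {..<n} (as ! i). xs \<in> Rs ! i \<longleftrightarrow> xs \<in> Qs ! i"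
  using assms
proof (induction as arbitrary: Rs Qs)
  case (Cons a as)
  obtain R Rs' Q Qs' where RQ: "Rs = R # Rs'" "Qs = Q # Qs'"
    using Cons.prems by (metis length_Suc_conv)
  have "map (\<lambda>xs. xs \<in> R) (all_tuples n a) @ concat (map (encode_relation n) (zip as Rs')) =
      map (\<lambda>xs. xs \<in> Q) (all_tuples n a) @ concat (map (encode_relation n) (zip as Qs'))"
    using Cons.prems(3) by (simp add: RQ encode_relation_def)
  then have 1: "\<forall>xs\<in>tuples {..<n} a. xs \<in> R \<longleftrightarrow> xs \<in> Q"
    "concat (map (encode_relation n) (zip as Rs')) = concat (map (encode_relation n) (zip as Qs'))"
    by (auto simp flip: set_all_tuples)
  have "\<forall>i < length as. \<forall>xs\<in>tuples {..<n} (as ! i). xs \<in> Rs' ! i \<longleftrightarrow> xs \<in> Qs' ! i"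
    using Cons.prems(1,2) by (intro Cons.IH 1) (auto simp: RQ)
  then show ?case
    using 1(1) by (auto simp: RQ nth_Cons split: nat.split)
qed simp

text \<open>One word can encode several structures, since operations are functions that may differ
  outside the universe. On the universe the encoding determines everything, so the existence of a
  homomorphism depends on the word only.\<close>

lemma encode_structure_hom:
  assumes X: "X \<in> finite_structures S" and Y: "Y \<in> finite_structures S"
    and eq: "encode_structure S X = encode_structure S Y" and h: "is_hom S X A h"
  shows "is_hom S Y A h"
proof -
  obtain n m where n: "universe X = {..<n}" and m: "universe Y = {..<m}"
    using X Y by (auto simp: finite_structures_def)
  have sX: "is_structure S X" and sY: "is_structure S Y"
    using X Y by (auto simp: finite_structures_def)
  have nm: "n = m" and ops: "concat (map (encode_operation n) (zip (op_arities S) (operations X))) @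
      concat (map (encode_relation n) (zip (rel_arities S) (relations X))) =
    concat (map (encode_operation n) (zip (op_arities S) (operations Y))) @
      concat (map (encode_relation n) (zip (rel_arities S) (relations Y)))"
    using encode_nat_eq[of n _ m] eq by (fastforce simp: encode_structure_def n m)+
  have len: "length (operations X) = length (op_arities S)" "length (operations Y) = length (op_arities S)"
    "length (relations X) = length (rel_arities S)" "length (relations Y) = length (rel_arities S)"
    using sX sY by (simp_all add: is_structure_def)
  from encode_operations_inject[OF len(1,2) ops]
  have o: "\<And>i xs. i < length (op_arities S) \<Longrightarrow> xs \<in> tuples {..<n} (op_arities S ! i) \<Longrightarrow>
      (operations X ! i) xs = (operations Y ! i) xs"
    and r: "concat (map (encode_relation n) (zip (rel_arities S) (relations X))) =
      concat (map (encode_relation n) (zip (rel_arities S) (relations Y)))"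
    by blast+
  have "relations X ! i = relations Y ! i" if "i < length (rel_arities S)" for i
    using encode_relations_inject[OF len(3,4) r] that structure_rel[OF sX that] structure_rel[OF sY that]
    by (auto simp: n m nm subset_iff)
  then show ?thesis
    using h o by (auto simp: is_hom_def n m nm)
qed

section \<open>The reduction\<close>

lemma ball_set_upt: "(\<forall>c\<in>set [0..<m]. P c) \<longleftrightarrow> (\<forall>c<m. P c)"
  by auto

lemma concat_map_concat: "concat (map f (concat xss)) = concat (map (\<lambda>xs. concat (map f xs)) xss)"
  by (induction xss) auto

text \<open>The recursion from the right splits the table of a graph into one block of
  \<open>n\<close> bits for each argument tuple, the form in which \<open>load_operation\<close>
  writes it.\<close>

lemma all_tuples_snoc: "all_tuples n (Suc k) = concat (map (\<lambda>xs. map (\<lambda>y. xs @ [y]) [0..<n]) (all_tuples n k))"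
proof (induction k)
  case (Suc k)
  have "all_tuples n (Suc (Suc k)) = concat (map (\<lambda>x. map (Cons x) (all_tuples n (Suc k))) [0..<n])"
    by (rule all_tuples_Suc)
  also have "\<dots> = concat (map (\<lambda>x. concat (map (\<lambda>xs. map (\<lambda>y. (x # xs) @ [y]) [0..<n]) (all_tuples n k))) [0..<n])"
    unfolding Suc.IH by (simp add: map_concat o_def)
  also have "\<dots> = concat (map (\<lambda>xs. map (\<lambda>y. xs @ [y]) [0..<n]) (all_tuples n (Suc k)))"
    by (simp add: all_tuples_Suc[of n k] concat_map_concat o_def)
  finally show ?case .
qed (simp add: all_tuples_Suc)

text \<open>A round that changes nothing has reached a closed set, and any other round adds a pair.
  After as many rounds as there are pairs, either a fixed point was met or every pair is present;
  both are closed. By monotonicity no insertion leads out of a closed \<open>Q\<close>, which gives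
  leastness.\<close>

lemma saturate_least:
  assumes mono: "\<And>E E' p. p \<in> tuples {..<n} 2 \<Longrightarrow> P E p \<Longrightarrow> E \<subseteq> E' \<Longrightarrow> P E' p"
  shows "saturate P n {} \<subseteq> tuples {..<n} 2"
    and "\<And>p. p \<in> tuples {..<n} 2 \<Longrightarrow> P (saturate P n {}) p \<Longrightarrow> p \<in> saturate P n {}"
    and "\<And>Q. (\<And>p. p \<in> tuples {..<n} 2 \<Longrightarrow> P Q p \<Longrightarrow> p \<in> Q) \<Longrightarrow> saturate P n {} \<subseteq> Q"
proof -
  let ?T = "tuples {..<n} 2" and ?r = "closure_round P n"
  let ?g = "\<lambda>p E. if P E p then insert p E else E"
  have incr: "E \<subseteq> fold ?g xs E" for xs E
    by (induction xs arbitrary: E) (auto, blast)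
  have below: "fold ?g xs E \<subseteq> Q"
    if "E \<subseteq> Q" "\<And>p. p \<in> set xs \<Longrightarrow> P Q p \<Longrightarrow> p \<in> Q" "set xs \<subseteq> ?T" for xs E Q
    using that
  proof (induction xs arbitrary: E)
    case (Cons p xs)
    have "?g p E \<subseteq> Q"
      using Cons.prems mono[of p E Q] by auto
    then show ?case
      using Cons.IH Cons.prems(2,3) by simp
  qed simp
  \<comment> \<open>If a round ends where it began, no insertion on the way had an effect, so every
    test was made against \<open>E\<close> itself.\<close>
  have fixp: "p \<in> E" if "fold ?g xs E = E" "p \<in> set xs" "P E p" for xs E p
    using that
  proof (induction xs)
    case (Cons a xs)
    have "?g a E \<subseteq> E"
      using incr[of "?g a E" xs] Cons.prems(1) by simp
    then have a: "?g a E = E"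
      by auto
    then have "fold ?g xs E = E"
      using Cons.prems(1) by simp
    then show ?case
      using Cons a by (auto split: if_splits)
  qed simp
  define S where "S m E = fold (\<lambda>_. ?r) m E" for m :: "nat list list" and E
  have r_incr: "E \<subseteq> ?r E" for E
    unfolding closure_round_def by (rule incr)
  have r_below: "?r E \<subseteq> Q" if "E \<subseteq> Q" "\<And>p. p \<in> ?T \<Longrightarrow> P Q p \<Longrightarrow> p \<in> Q" for E Q
    unfolding closure_round_def using that by (intro below) (simp_all add: set_all_tuples)
  have S_below: "S m E \<subseteq> Q" if "E \<subseteq> Q" "\<And>p. p \<in> ?T \<Longrightarrow> P Q p \<Longrightarrow> p \<in> Q" for m E Q
    using that(1) unfolding S_def
  proof (induction m arbitrary: E)
    case (Cons a m)
    then show ?case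
      using r_below[OF Cons.prems that(2)] by simp
  qed simp
  have "finite ?T"
    unfolding set_all_tuples[symmetric] by simp
  have S_fix: "S m E = E" if "?r E = E" for m E
    using that unfolding S_def by (induction m) auto
  have grow: "?r (S m E) = S m E \<or> card E + length m \<le> card (S m E)" if "E \<subseteq> ?T" for m E
    using that
  proof (induction m arbitrary: E)
    case Nil
    then show ?case
      by (simp add: S_def)
  next
    case (Cons a m)
    have S_Cons: "S (a # m) E = S m (?r E)"
      by (simp add: S_def)
    have rT: "?r E \<subseteq> ?T"
      using Cons.prems by (rule r_below)
    show ?case
    proof (cases "?r E = E")
      case True
      then show ?thesis
        by (simp add: S_Cons S_fix)
    next
      case False
      then have "card E < card (?r E)"
        using r_incr[of E] rT \<open>finite ?T\<close> by (metis finite_subset psubsetI psubset_card_mono)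
      then show ?thesis
        using Cons.IH[OF rT] by (auto simp: S_Cons)
    qed
  qed
  let ?S = "S (all_tuples n 2) {}"
  have sat: "saturate P n {} = ?S"
    by (simp add: saturate_def S_def)
  show sub: "saturate P n {} \<subseteq> ?T"
    unfolding sat by (rule S_below) auto
  show "saturate P n {} \<subseteq> Q" if "\<And>p. p \<in> ?T \<Longrightarrow> P Q p \<Longrightarrow> p \<in> Q" for Q
    unfolding sat using that by (intro S_below) auto
  fix p assume p: "p \<in> ?T" "P (saturate P n {}) p"
  have "?r ?S = ?S \<or> ?S = ?T"
  proof -
    have "card ?T \<le> length (all_tuples n 2)"
      unfolding set_all_tuples[symmetric] by (rule card_length)
    then have "?r ?S = ?S \<or> card ?T \<le> card ?S"
      using grow[of "{}" "all_tuples n 2"] by auto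
    then show ?thesis
      using card_seteq[OF \<open>finite ?T\<close>] sub unfolding sat by blast
  qed
  then show "p \<in> saturate P n {}"
  proof
    assume "?r ?S = ?S"
    then show ?thesis
      using fixp[of "all_tuples n 2" ?S p] p unfolding sat closure_round_def by (simp add: set_all_tuples)
  qed (use p sat in simp)
qed

lemma map_nth_append: "length v = d \<Longrightarrow> length xs = k \<Longrightarrow> map ((!) (v @ xs)) [d..<d + k] = xs"
  by (auto intro!: nth_equalityI)

lemma term_values_eval:
  assumes X: "is_structure S X" and n: "universe X = {..<n}"
    and I: "\<And>i. i < length (op_arities S) \<Longrightarrow>
      I i = {xs @ [(operations X ! i) xs] | xs. xs \<in> tuples {..<n} (op_arities S ! i)}"
    and t: "wf_oterm (op_arities S) m t" and v: "v \<in> tuples {..<n} m"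
  shows "term_values n I v t = {term_eval (operations X) v t}"
  using t
proof (induction t)
  case (Op f ts)
  let ?a = "map (term_eval (operations X) v) ts"
  have f: "f < length (op_arities S)" "length ts = op_arities S ! f"
    using Op.prems by simp_all
  have a: "?a \<in> tuples {..<n} (length ts)"
    using Op.prems term_eval_closed[OF X, of m _ v] v n by (auto simp: list_all_iff tuples_def)
  have "map (term_values n I v) ts = map (\<lambda>t. {term_eval (operations X) v t}) ts"
    using Op by (auto simp: list_all_iff)
  then have "list_all2 (\<in>) ys (map (term_values n I v) ts) \<longleftrightarrow> ys = ?a" for ys
    by (auto simp: list_all2_conv_all_nth list_eq_iff_nth_eq)
  then have "term_values n I v (Op f ts) = {y. ?a @ [y] \<in> I f}"
    using a by auto
  also have "\<dots> = {(operations X ! f) ?a}"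
    using a f by (auto simp: I)
  finally show ?case
    by simp
qed simp

section \<open>The congruence and the target as first-order formulas over tables\<close>

context csp_translation
begin

text \<open>Operations are stored as graphs, hence \<open>Suc\<close>; the last table holds the
  congruence and is not part of the input.\<close>

definition table_arities :: "nat list" where
  "table_arities = map Suc (op_arities S) @ rel_arities S @ [2]"

definition eq_table :: nat where
  "eq_table = length (op_arities S) + length (rel_arities S)"

sublocale layout table_arities .

lemma table_arity:
  "i < length (op_arities S) \<Longrightarrow> table_arities ! i = Suc (op_arities S ! i)"
  "i < length (rel_arities S) \<Longrightarrow> table_arities ! (length (op_arities S) + i) = rel_arities S ! i"
  "table_arities ! eq_table = 2"
  "length (op_arities S) \<le> length table_arities" "eq_table < length table_arities"
  "i < length (op_arities S) \<Longrightarrow> i < length table_arities"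
  "i < length (rel_arities S) \<Longrightarrow> length (op_arities S) + i < length table_arities"
  by (auto simp: table_arities_def eq_table_def nth_append)

text \<open>This is \<open>step\<close> with operations replaced by their graphs. Ranges that depend
  on signature and templates alone are written as sets of lists because \<open>testable_bex\<close>
  and \<open>testable_ball\<close> turn them into finite disjunctions and conjunctions.\<close>

definition step_formula :: "nat \<Rightarrow> (nat \<Rightarrow> nat list set) \<Rightarrow> nat list \<Rightarrow> bool" where
  "step_formula n I v \<longleftrightarrow> v ! 0 = v ! 1 \<or> [v ! 1, v ! 0] \<in> I eq_table \<or>
     (\<exists>z<n. [v ! 0, z] \<in> I eq_table \<and> [z, v ! 1] \<in> I eq_table) \<or>
     (\<exists>i\<in>set [0..<length (op_arities S)]. \<exists>xs\<in>tuples {..<n} (op_arities S ! i).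
        xs @ [v ! 0] \<in> I i \<and> v ! 1 \<in> term_values n I xs (translate tt (ss i))) \<or>
     (\<exists>a\<in>set equalities. \<exists>xs\<in>tuples {..<n} (rel_arities S ! fst a).
        xs \<in> I (length (op_arities S) + fst a) \<and> xs ! fst (snd a) = v ! 0 \<and> xs ! snd (snd a) = v ! 1) \<or>
     (\<exists>i\<in>set [0..<length (op_arities S)]. \<exists>xs\<in>tuples {..<n} (op_arities S ! i).
        \<exists>ys\<in>tuples {..<n} (op_arities S ! i).
        (\<forall>j\<in>set [0..<op_arities S ! i]. [xs ! j, ys ! j] \<in> I eq_table) \<and> xs @ [v ! 0] \<in> I i \<and> ys @ [v ! 1] \<in> I i)"

lemma testable_translated_term:
  assumes "wf_oterm (op_arities S) (length is) t" "y < d" "\<forall>i\<in>set is. i < d"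
  shows "testable d (\<lambda>n I v. v ! y \<in> term_values n I (map ((!) v) is) t)"
  using assms by (intro testable_term) (auto simp: table_arity)

text \<open>Positions 2 and 3 hold the pair, after the two round counters of
  \<open>realizable_saturate\<close>; quantified elements and tuples occupy the positions from 4 on.
  The quantified disjuncts are first proved with explicit positions, the form that the closure
  lemmas produce, and then rewritten.\<close>

lemma testable_step: "testable 4 (\<lambda>n I v. step_formula n I (drop 2 v))"
proof -
  let ?e = eq_table
  have eq: "testable d (\<lambda>n I v. [v ! i, v ! j] \<in> I ?e)" if "i < d" "j < d" for i j d
    using testable_rel[of ?e "[i, j]" d] that by (simp add: table_arity)
  have 1: "testable 4 (\<lambda>n I v. v ! 2 = v ! 3)"
    by (rule testable_eq) simp_all
  have 2: "testable 4 (\<lambda>n I v. [v ! 3, v ! 2] \<in> I ?e)"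
    by (rule eq) simp_all
  have 3: "testable 4 (\<lambda>n I v. \<exists>z<n. [v ! 2, z] \<in> I ?e \<and> [z, v ! 3] \<in> I ?e)"
  proof (rule testable_cong)
    show "testable 4 (\<lambda>n I v. \<exists>z<n. [(v @ [z]) ! 2, (v @ [z]) ! 4] \<in> I ?e \<and> [(v @ [z]) ! 4, (v @ [z]) ! 3] \<in> I ?e)"
      by (rule testable_ex[OF testable_conj[OF eq eq]]) simp_all
  qed (simp add: tuples_def nth_append)
  have 4: "testable 4 (\<lambda>n I v. \<exists>xs\<in>tuples {..<n} (op_arities S ! i).
      xs @ [v ! 2] \<in> I i \<and> v ! 3 \<in> term_values n I xs (translate tt (ss i)))"
    if i: "i < length (op_arities S)" for i
  proof (rule testable_cong)
    let ?k = "op_arities S ! i"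
    show "testable 4 (\<lambda>n I v. \<exists>xs\<in>tuples {..<n} ?k. map ((!) (v @ xs)) ([4..<4 + ?k] @ [2]) \<in> I i \<and>
      (v @ xs) ! 3 \<in> term_values n I (map ((!) (v @ xs)) [4..<4 + ?k]) (translate tt (ss i)))"
      using i by (intro testable_ex_tuple testable_conj testable_rel testable_translated_term)
        (auto simp: table_arity intro!: wf_translate[OF tt_wf ss_wf])
    fix n I v assume v: "v \<in> tuples {..<n :: nat} 4"
    have "map ((!) (v @ xs)) [4..<4 + ?k] = xs" if "xs \<in> tuples {..<n} ?k" for xs
      using v that by (intro map_nth_append) (auto simp: tuples_def)
    then show "(\<exists>xs\<in>tuples {..<n} ?k. map ((!) (v @ xs)) ([4..<4 + ?k] @ [2]) \<in> I i \<and>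
      (v @ xs) ! 3 \<in> term_values n I (map ((!) (v @ xs)) [4..<4 + ?k]) (translate tt (ss i))) =
      (\<exists>xs\<in>tuples {..<n} ?k. xs @ [v ! 2] \<in> I i \<and> v ! 3 \<in> term_values n I xs (translate tt (ss i)))"
      using v by (simp add: tuples_length nth_append)
  qed
  have 5: "testable 4 (\<lambda>n I v. \<exists>xs\<in>tuples {..<n} (rel_arities S ! fst a).
        xs \<in> I (length (op_arities S) + fst a) \<and> xs ! fst (snd a) = v ! 2 \<and> xs ! snd (snd a) = v ! 3)"
    if "a \<in> set equalities" for a
  proof (rule testable_cong)
    obtain i j j' where a: "a = (i, j, j')"
      by (cases a)
    let ?k = "rel_arities S ! fst a" let ?t = "length (op_arities S) + fst a"
    have ij: "fst a < length (rel_arities S)" "fst (snd a) < ?k" "snd (snd a) < ?k"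
      using that unfolding a by (simp_all add: equalities_iff)
    show "testable 4 (\<lambda>n I v. \<exists>xs\<in>tuples {..<n} ?k. map ((!) (v @ xs)) [4..<4 + ?k] \<in> I ?t \<and>
      (v @ xs) ! (4 + fst (snd a)) = (v @ xs) ! 2 \<and> (v @ xs) ! (4 + snd (snd a)) = (v @ xs) ! 3)"
      using ij by (intro testable_ex_tuple testable_conj testable_rel testable_eq) (auto simp: table_arity)
    fix n I v assume v: "v \<in> tuples {..<n :: nat} 4"
    have "map ((!) (v @ xs)) [4..<4 + ?k] = xs" if "xs \<in> tuples {..<n} ?k" for xs
      using v that by (intro map_nth_append) (auto simp: tuples_def)
    then show "(\<exists>xs\<in>tuples {..<n} ?k. map ((!) (v @ xs)) [4..<4 + ?k] \<in> I ?t \<and>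
      (v @ xs) ! (4 + fst (snd a)) = (v @ xs) ! 2 \<and> (v @ xs) ! (4 + snd (snd a)) = (v @ xs) ! 3) =
      (\<exists>xs\<in>tuples {..<n} ?k. xs \<in> I ?t \<and> xs ! fst (snd a) = v ! 2 \<and> xs ! snd (snd a) = v ! 3)"
      using v by (simp add: tuples_length nth_append)
  qed
  have 6: "testable 4 (\<lambda>n I v. \<exists>xs\<in>tuples {..<n} (op_arities S ! i). \<exists>ys\<in>tuples {..<n} (op_arities S ! i).
        (\<forall>j\<in>set [0..<op_arities S ! i]. [xs ! j, ys ! j] \<in> I ?e) \<and> xs @ [v ! 2] \<in> I i \<and> ys @ [v ! 3] \<in> I i)"
    if i: "i < length (op_arities S)" for i
  proof (rule testable_cong)
    let ?k = "op_arities S ! i"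
    show "testable 4 (\<lambda>n I v. \<exists>xs\<in>tuples {..<n} ?k. \<exists>ys\<in>tuples {..<n} ?k.
      (\<forall>j\<in>set [0..<?k]. [((v @ xs) @ ys) ! (4 + j), ((v @ xs) @ ys) ! (4 + ?k + j)] \<in> I ?e) \<and>
      map ((!) ((v @ xs) @ ys)) ([4..<4 + ?k] @ [2]) \<in> I i \<and>
      map ((!) ((v @ xs) @ ys)) ([4 + ?k..<4 + ?k + ?k] @ [3]) \<in> I i)"
      using i by (intro testable_ex_tuple testable_conj testable_ball testable_rel eq) (auto simp: table_arity)
    fix n I v assume v: "v \<in> tuples {..<n :: nat} 4"
    have "map ((!) ((v @ xs) @ ys)) [4..<4 + ?k] = xs" "map ((!) ((v @ xs) @ ys)) [4 + ?k..<4 + ?k + ?k] = ys"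
      if "xs \<in> tuples {..<n} ?k" "ys \<in> tuples {..<n} ?k" for xs ys
    proof -
      have "map ((!) ((v @ xs) @ ys)) [4..<4 + ?k] = map ((!) (v @ xs)) [4..<4 + ?k]"
        using v that by (auto simp: nth_append tuples_def)
      also have "\<dots> = xs"
        using v that by (intro map_nth_append) (auto simp: tuples_def)
      finally show "map ((!) ((v @ xs) @ ys)) [4..<4 + ?k] = xs" .
      show "map ((!) ((v @ xs) @ ys)) [4 + ?k..<4 + ?k + ?k] = ys"
        using v that by (intro map_nth_append) (auto simp: tuples_def)
    qed
    then show "(\<exists>xs\<in>tuples {..<n} ?k. \<exists>ys\<in>tuples {..<n} ?k.
      (\<forall>j\<in>set [0..<?k]. [((v @ xs) @ ys) ! (4 + j), ((v @ xs) @ ys) ! (4 + ?k + j)] \<in> I ?e) \<and>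
      map ((!) ((v @ xs) @ ys)) ([4..<4 + ?k] @ [2]) \<in> I i \<and>
      map ((!) ((v @ xs) @ ys)) ([4 + ?k..<4 + ?k + ?k] @ [3]) \<in> I i) =
      (\<exists>xs\<in>tuples {..<n} ?k. \<exists>ys\<in>tuples {..<n} ?k.
        (\<forall>j\<in>set [0..<?k]. [xs ! j, ys ! j] \<in> I ?e) \<and> xs @ [v ! 2] \<in> I i \<and> ys @ [v ! 3] \<in> I i)"
      using v by (simp add: tuples_length nth_append)
  qed
  have "testable 4 (\<lambda>n I v. v ! 2 = v ! 3 \<or> [v ! 3, v ! 2] \<in> I ?e \<or>
     (\<exists>z<n. [v ! 2, z] \<in> I ?e \<and> [z, v ! 3] \<in> I ?e) \<or>
     (\<exists>i\<in>set [0..<length (op_arities S)]. \<exists>xs\<in>tuples {..<n} (op_arities S ! i).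
        xs @ [v ! 2] \<in> I i \<and> v ! 3 \<in> term_values n I xs (translate tt (ss i))) \<or>
     (\<exists>a\<in>set equalities. \<exists>xs\<in>tuples {..<n} (rel_arities S ! fst a).
        xs \<in> I (length (op_arities S) + fst a) \<and> xs ! fst (snd a) = v ! 2 \<and> xs ! snd (snd a) = v ! 3) \<or>
     (\<exists>i\<in>set [0..<length (op_arities S)]. \<exists>xs\<in>tuples {..<n} (op_arities S ! i).
        \<exists>ys\<in>tuples {..<n} (op_arities S ! i).
        (\<forall>j\<in>set [0..<op_arities S ! i]. [xs ! j, ys ! j] \<in> I ?e) \<and> xs @ [v ! 2] \<in> I i \<and> ys @ [v ! 3] \<in> I i))"
    by (intro testable_disj 1 2 3 testable_bex 4 5 6) auto
  then show ?thesis
    by (rule testable_cong) (simp add: step_formula_def tuples_length numeral_3_eq_3 numeral_2_eq_2)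
qed

definition tables :: "nat \<Rightarrow> nat struct \<Rightarrow> nat \<Rightarrow> nat list set" where
  "tables n X t =
     (if t < length (op_arities S) then {xs @ [(operations X ! t) xs] | xs. xs \<in> tuples {..<n} (op_arities S ! t)}
      else if t < eq_table then relations X ! (t - length (op_arities S)) else {})"

lemma step_formula_iff:
  assumes X: "is_structure S X" and n: "universe X = {..<n}" and x: "x < n" and y: "y < n"
  shows "step_formula n ((tables n X)(eq_table := E)) [x, y] \<longleftrightarrow> step X (\<lambda>x y. [x, y] \<in> E) x y"
proof -
  let ?I = "(tables n X)(eq_table := E)"
  have e: "?I eq_table = E"
    by simp
  have op: "?I i = {xs @ [(operations X ! i) xs] | xs. xs \<in> tuples {..<n} (op_arities S ! i)}"
    if "i < length (op_arities S)" for i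
    using that by (auto simp: tables_def eq_table_def fun_upd_apply)
  have rel: "?I (length (op_arities S) + i) = relations X ! i" if "i < length (rel_arities S)" for i
    using that by (auto simp: tables_def eq_table_def fun_upd_apply)
  have op_iff: "xs @ [x] \<in> ?I i \<longleftrightarrow> x = (operations X ! i) xs"
    if "i < length (op_arities S)" "xs \<in> tuples {..<n} (op_arities S ! i)" for i xs x
    unfolding op[OF that(1)] using that(2) by auto
  have tm: "term_values n ?I xs (translate tt (ss i)) = {term_eval (operations X) xs (translate tt (ss i))}"
    if "i < length (op_arities S)" "xs \<in> tuples {..<n} (op_arities S ! i)" for i xs
    using that by (intro term_values_eval[OF X n op wf_translate[OF tt_wf ss_wf]])
  have 4: "(\<exists>i\<in>set [0..<length (op_arities S)]. \<exists>xs\<in>tuples {..<n} (op_arities S ! i).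
        xs @ [x] \<in> ?I i \<and> y \<in> term_values n ?I xs (translate tt (ss i))) \<longleftrightarrow>
      (\<exists>i < length (op_arities S). \<exists>xs\<in>tuples (universe X) (op_arities S ! i).
        x = (operations X ! i) xs \<and> y = term_eval (operations X) xs (translate tt (ss i)))"
    using op_iff tm by (auto simp: n simp del: fun_upd_apply)
  have 5: "(\<exists>a\<in>set equalities. \<exists>xs\<in>tuples {..<n} (rel_arities S ! fst a).
        xs \<in> ?I (length (op_arities S) + fst a) \<and> xs ! fst (snd a) = x \<and> xs ! snd (snd a) = y) \<longleftrightarrow>
      (\<exists>(i, j, j')\<in>set equalities. \<exists>xs\<in>relations X ! i. x = xs ! j \<and> y = xs ! j')"
  proof (intro bex_cong refl)
    fix a assume "a \<in> set equalities"
    moreover obtain i j j' where a: "a = (i, j, j')"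
      by (cases a)
    ultimately have i: "i < length (rel_arities S)"
      by (simp add: equalities_iff)
    show "(\<exists>xs\<in>tuples {..<n} (rel_arities S ! fst a).
        xs \<in> ?I (length (op_arities S) + fst a) \<and> xs ! fst (snd a) = x \<and> xs ! snd (snd a) = y) \<longleftrightarrow>
      (case a of (i, j, j') \<Rightarrow> \<exists>xs\<in>relations X ! i. x = xs ! j \<and> y = xs ! j')"
      unfolding a fst_conv snd_conv prod.case rel[OF i] using structure_rel[OF X i] n by auto
  qed
  have 6: "(\<exists>i\<in>set [0..<length (op_arities S)]. \<exists>xs\<in>tuples {..<n} (op_arities S ! i).
        \<exists>ys\<in>tuples {..<n} (op_arities S ! i).
        (\<forall>j\<in>set [0..<op_arities S ! i]. [xs ! j, ys ! j] \<in> E) \<and> xs @ [x] \<in> ?I i \<and> ys @ [y] \<in> ?I i) \<longleftrightarrow>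
      (\<exists>i < length (op_arities S). \<exists>xs\<in>tuples (universe X) (op_arities S ! i).
        \<exists>ys\<in>tuples (universe X) (op_arities S ! i). (\<forall>j < op_arities S ! i. [xs ! j, ys ! j] \<in> E) \<and>
        x = (operations X ! i) xs \<and> y = (operations X ! i) ys)"
    by (simp add: n op_iff Ball_def cong: conj_cong) (auto simp: Bex_def)
  have nth: "[x, y] ! 0 = x" "[x, y] ! 1 = y"
    by simp_all
  show ?thesis
    unfolding step_formula_def step_def nth e 4 5 6 n by auto
qed

definition eq_closure :: "nat \<Rightarrow> nat struct \<Rightarrow> nat list set" where
  "eq_closure n X = saturate (\<lambda>E. step_formula n ((tables n X)(eq_table := E))) n {}"

text \<open>Every member of the class of the term value satisfies this, so the \<open>LEAST\<close>
  taken on output picks the representative used by \<open>target\<close>.\<close>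

definition op_formula :: "nat \<Rightarrow> nat \<Rightarrow> (nat \<Rightarrow> nat list set) \<Rightarrow> nat list \<Rightarrow> nat \<Rightarrow> bool" where
  "op_formula j n I xs y \<longleftrightarrow> (\<exists>z<n. z \<in> term_values n I xs (tt j) \<and> [z, y] \<in> I eq_table)"

definition rel_formula :: "nat \<Rightarrow> nat \<Rightarrow> (nat \<Rightarrow> nat list set) \<Rightarrow> nat list \<Rightarrow> bool" where
  "rel_formula r n I ys \<longleftrightarrow> (\<exists>a\<in>set (atoms r). \<exists>xs\<in>tuples {..<n} (rel_arities S ! fst a).
     xs \<in> I (length (op_arities S) + fst a) \<and>
     (\<forall>c\<in>set [0..<rel_arities T ! r]. [xs ! (snd a ! c), ys ! c] \<in> I eq_table))"

lemma testable_op_formula: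
  assumes j: "j < length (op_arities T)"
  shows "testable (Suc (op_arities T ! j)) (\<lambda>n I v. op_formula j n I (take (op_arities T ! j) v) (v ! (op_arities T ! j)))"
proof (rule testable_cong)
  let ?k = "op_arities T ! j"
  show "testable (Suc ?k) (\<lambda>n I v. \<exists>z<n. (v @ [z]) ! Suc ?k \<in> term_values n I (map ((!) (v @ [z])) [0..<?k]) (tt j) \<and>
      map ((!) (v @ [z])) [Suc ?k, ?k] \<in> I eq_table)"
    using tt_wf[OF j] by (intro testable_ex testable_conj testable_translated_term testable_rel)
      (auto simp: table_arity)
  fix n I v assume v: "v \<in> tuples {..<n :: nat} (Suc ?k)"
  have "map ((!) (v @ [z])) [0..<?k] = take ?k v" for z
    using v by (auto simp: tuples_def nth_append intro!: nth_equalityI)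
  then show "(\<exists>z<n. (v @ [z]) ! Suc ?k \<in> term_values n I (map ((!) (v @ [z])) [0..<?k]) (tt j) \<and>
      map ((!) (v @ [z])) [Suc ?k, ?k] \<in> I eq_table) = op_formula j n I (take ?k v) (v ! ?k)"
    using v by (simp add: op_formula_def tuples_length nth_append)
qed

lemma testable_rel_formula:
  assumes r: "r < length (rel_arities T)"
  shows "testable (rel_arities T ! r) (rel_formula r)"
  unfolding rel_formula_def
proof (intro testable_bex)
  fix a assume "a \<in> set (atoms r)"
  moreover obtain i js where a: "a = (i, js)"
    by (cases a)
  ultimately have i: "fst a < length (rel_arities S)" and js: "snd a \<in> tuples {..<rel_arities S ! fst a} (rel_arities T ! r)"
    by (simp_all add: atoms_iff)
  let ?d = "rel_arities T ! r" and ?k = "rel_arities S ! fst a" and ?t = "length (op_arities S) + fst a"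
  show "testable ?d (\<lambda>n I ys. \<exists>xs\<in>tuples {..<n} ?k. xs \<in> I ?t \<and>
     (\<forall>c\<in>set [0..<?d]. [xs ! (snd a ! c), ys ! c] \<in> I eq_table))"
  proof (rule testable_cong)
    show "testable ?d (\<lambda>n I ys. \<exists>xs\<in>tuples {..<n} ?k. map ((!) (ys @ xs)) [?d..<?d + ?k] \<in> I ?t \<and>
       (\<forall>c\<in>set [0..<?d]. map ((!) (ys @ xs)) [?d + snd a ! c, c] \<in> I eq_table))"
      using i js by (intro testable_ex_tuple testable_conj testable_ball testable_rel)
        (auto simp: table_arity dest: tuples_nth)
    fix n I v assume v: "v \<in> tuples {..<n :: nat} ?d"
    have "map ((!) (v @ xs)) [?d..<?d + ?k] = xs" if "xs \<in> tuples {..<n} ?k" for xs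
      using v that by (intro map_nth_append) (auto simp: tuples_def)
    then show "(\<exists>xs\<in>tuples {..<n} ?k. map ((!) (v @ xs)) [?d..<?d + ?k] \<in> I ?t \<and>
       (\<forall>c\<in>set [0..<?d]. map ((!) (v @ xs)) [?d + snd a ! c, c] \<in> I eq_table)) =
      (\<exists>xs\<in>tuples {..<n} ?k. xs \<in> I ?t \<and> (\<forall>c\<in>set [0..<?d]. [xs ! (snd a ! c), v ! c] \<in> I eq_table))"
      using v by (simp add: tuples_length nth_append)
  qed
qed

definition related :: "nat \<Rightarrow> nat struct \<Rightarrow> nat \<Rightarrow> nat \<Rightarrow> bool" where
  "related n X x y \<longleftrightarrow> [x, y] \<in> eq_closure n X"

lemma related_props:
  assumes X: "is_structure S X" and n: "universe X = {..<n}"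
  shows "related n X x y \<Longrightarrow> x < n \<and> y < n"
    and "x < n \<Longrightarrow> y < n \<Longrightarrow> step X (related n X) x y \<Longrightarrow> related n X x y"
    and "is_hom S X A h \<Longrightarrow> related n X x y \<Longrightarrow> h x = h y"
proof -
  let ?P = "\<lambda>E. step_formula n ((tables n X)(eq_table := E))"
  have P: "?P E p \<longleftrightarrow> step X (\<lambda>x y. [x, y] \<in> E) (p ! 0) (p ! 1)" if "p \<in> tuples {..<n} 2" for E p
  proof -
    have "p = [p ! 0, p ! 1]" "p ! 0 < n" "p ! 1 < n"
      using that by (auto simp: tuples_def length_Suc_conv numeral_2_eq_2)
    then show ?thesis
      using step_formula_iff[OF X n] by metis
  qed
  have mono: "?P E' p" if "p \<in> tuples {..<n} 2" "?P E p" "E \<subseteq> E'" for E E' p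
    using that(2,3) unfolding P[OF that(1)] by (auto elim: step_mono)
  have least: "saturate ?P n {} \<subseteq> tuples {..<n} 2"
    "\<And>p. p \<in> tuples {..<n} 2 \<Longrightarrow> ?P (saturate ?P n {}) p \<Longrightarrow> p \<in> saturate ?P n {}"
    "\<And>Q. (\<And>p. p \<in> tuples {..<n} 2 \<Longrightarrow> ?P Q p \<Longrightarrow> p \<in> Q) \<Longrightarrow> saturate ?P n {} \<subseteq> Q"
    by (rule saturate_least[where P = ?P and n = n]; (rule mono; assumption)?; blast)+
  have pair: "[x, y] \<in> tuples {..<n} 2 \<longleftrightarrow> x < n \<and> y < n" for x y
    by (auto simp: tuples_def)
  show "x < n \<and> y < n" if "related n X x y"
  proof -
    have "[x, y] \<in> tuples {..<n} 2"
      using subsetD[OF least(1)] that unfolding related_def eq_closure_def .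
    then show ?thesis
      unfolding pair .
  qed
  show "related n X x y" if "x < n" "y < n" "step X (related n X) x y"
  proof -
    have "?P (eq_closure n X) [x, y]"
      using that P[of "[x, y]" "eq_closure n X"] pair by (simp add: related_def[abs_def])
    moreover have "[x, y] \<in> tuples {..<n} 2"
      unfolding pair using that by simp
    ultimately show ?thesis
      unfolding related_def eq_closure_def by (intro least(2))
  qed
  assume h: "is_hom S X A h"
  \<comment> \<open>The kernel of \<open>h\<close>, as a set of lists, is closed by
    \<open>hom_kernel\<close> and therefore contains the least closed set.\<close>
  let ?Q = "{p. h (p ! 0) = h (p ! 1)}"
  have "p \<in> ?Q" if "p \<in> tuples {..<n} 2" "?P ?Q p" for p
    using that(2) hom_kernel[OF X h, of "p ! 0" "p ! 1"] unfolding P[OF that(1)] by simp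
  then have "eq_closure n X \<subseteq> ?Q"
    unfolding eq_closure_def by (rule least(3))
  then show "related n X x y \<Longrightarrow> h x = h y"
    by (auto simp: related_def)
qed

definition closed_tables :: "nat \<Rightarrow> nat struct \<Rightarrow> nat \<Rightarrow> nat list set" where
  "closed_tables n X = (tables n X)(eq_table := eq_closure n X)"

lemma target_tables:
  assumes X: "is_structure S X" and n: "universe X = {..<n}"
  shows "j < length (op_arities T) \<Longrightarrow> xs \<in> tuples {..<n} (op_arities T ! j) \<Longrightarrow>
      op_formula j n (closed_tables n X) xs y \<longleftrightarrow> related n X (term_eval (operations X) xs (tt j)) y"
    and "r < length (rel_arities T) \<Longrightarrow> ys \<in> tuples {..<n} (rel_arities T ! r) \<Longrightarrow>
      rel_formula r n (closed_tables n X) ys \<longleftrightarrow> ys \<in> relations (target X (related n X)) ! r"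
proof -
  have op: "closed_tables n X i = {xs @ [(operations X ! i) xs] | xs. xs \<in> tuples {..<n} (op_arities S ! i)}"
    if "i < length (op_arities S)" for i
    using that by (auto simp: closed_tables_def tables_def eq_table_def fun_upd_apply)
  have rel: "closed_tables n X (length (op_arities S) + i) = relations X ! i" if "i < length (rel_arities S)" for i
    using that by (auto simp: closed_tables_def tables_def eq_table_def fun_upd_apply)
  have e: "[x, y] \<in> closed_tables n X eq_table \<longleftrightarrow> related n X x y" for x y
    by (simp add: closed_tables_def related_def)
  show "op_formula j n (closed_tables n X) xs y \<longleftrightarrow> related n X (term_eval (operations X) xs (tt j)) y"
    if j: "j < length (op_arities T)" "xs \<in> tuples {..<n} (op_arities T ! j)"
    using term_values_eval[OF X n op tt_wf[OF j(1)] j(2)] related_props(1)[OF X n]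
    by (auto simp: op_formula_def e)
  assume r: "r < length (rel_arities T)" "ys \<in> tuples {..<n} (rel_arities T ! r)"
  have atom: "(\<exists>xs\<in>tuples {..<n} (rel_arities S ! i). xs \<in> closed_tables n X (length (op_arities S) + i) \<and>
      (\<forall>c\<in>set [0..<rel_arities T ! r]. [xs ! (js ! c), ys ! c] \<in> closed_tables n X eq_table)) \<longleftrightarrow>
    (\<exists>xs\<in>relations X ! i. \<forall>c < rel_arities T ! r. related n X (xs ! (js ! c)) (ys ! c))"
    if "(i, js) \<in> set (atoms r)" for i js
  proof -
    have i: "i < length (rel_arities S)"
      using that by (simp add: atoms_iff)
    show ?thesis
      unfolding rel[OF i] e ball_set_upt using structure_rel[OF X i] n by auto
  qed
  have "rel_formula r n (closed_tables n X) ys \<longleftrightarrow>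
      (\<exists>(i, js)\<in>set (atoms r). \<exists>xs\<in>relations X ! i. \<forall>c < rel_arities T ! r. related n X (xs ! (js ! c)) (ys ! c))"
    unfolding rel_formula_def
  proof (intro bex_cong refl)
    fix a assume "a \<in> set (atoms r)"
    then show "(\<exists>xs\<in>tuples {..<n} (rel_arities S ! fst a). xs \<in> closed_tables n X (length (op_arities S) + fst a) \<and>
      (\<forall>c\<in>set [0..<rel_arities T ! r]. [xs ! (snd a ! c), ys ! c] \<in> closed_tables n X eq_table)) \<longleftrightarrow>
      (case a of (i, js) \<Rightarrow> \<exists>xs\<in>relations X ! i. \<forall>c < rel_arities T ! r. related n X (xs ! (js ! c)) (ys ! c))"
      using atom[of "fst a" "snd a"] by (simp only: prod.collapse split_beta)
  qed
  then show "rel_formula r n (closed_tables n X) ys \<longleftrightarrow> ys \<in> relations (target X (related n X)) ! r"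
    using r n by (simp add: target_def)
qed

section \<open>Assembly of the reduction\<close>

definition target_code :: "nat \<Rightarrow> (nat \<Rightarrow> nat list set) \<Rightarrow> bool list" where
  "target_code n I = encode_nat n @
     concat (map (\<lambda>j. concat (map (\<lambda>xs. encode_nat (LEAST y. op_formula j n I xs y)) (all_tuples n (op_arities T ! j))))
       [0..<length (op_arities T)]) @
     concat (map (\<lambda>r. map (rel_formula r n I) (all_tuples n (rel_arities T ! r))) [0..<length (rel_arities T)])"

lemma emits_target_code:
  "emits (\<lambda>n I. \<forall>j < length (op_arities T). \<forall>xs\<in>tuples {..<n} (op_arities T ! j). \<exists>y<n. op_formula j n I xs y) target_code"
  unfolding target_code_def[abs_def]
proof (intro emits_append emits_concat emits_size emits_bits)
  fix j assume "j \<in> set [0..<length (op_arities T)]"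
  then have j: "j < length (op_arities T)"
    by simp
  show "emits (\<lambda>n I. \<forall>j < length (op_arities T). \<forall>xs\<in>tuples {..<n} (op_arities T ! j). \<exists>y<n. op_formula j n I xs y)
      (\<lambda>n I. concat (map (\<lambda>xs. encode_nat (LEAST y. op_formula j n I xs y)) (all_tuples n (op_arities T ! j))))"
    by (rule emits_weaken[OF emits_numbers[OF testable_op_formula[OF j]]]) (use j in blast)
qed (simp add: testable_rel_formula)

lemma concat_map_zip:
  "length ys = length xs \<Longrightarrow> concat (map f (zip xs ys)) = concat (map (\<lambda>i. f (xs ! i, ys ! i)) [0..<length xs])"
proof -
  assume "length ys = length xs"
  then have "map f (zip xs ys) = map (\<lambda>i. f (xs ! i, ys ! i)) [0..<length xs]"
    by (auto intro!: nth_equalityI)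
  then show ?thesis
    by (rule arg_cong)
qed

lemma target_code_closed_tables:
  assumes X: "is_structure S X" and n: "universe X = {..<n}"
  shows "target_code n (closed_tables n X) = encode_structure T (target X (related n X))"
proof -
  let ?Y = "target X (related n X)"
  have op: "encode_nat (LEAST y. op_formula j n (closed_tables n X) xs y) = encode_nat ((operations ?Y ! j) xs)"
    if "j < length (op_arities T)" "xs \<in> set (all_tuples n (op_arities T ! j))" for j xs
    using that target_tables(1)[OF X n that(1)] by (simp add: target_def set_all_tuples)
  have rel: "rel_formula r n (closed_tables n X) ys \<longleftrightarrow> ys \<in> relations ?Y ! r"
    if "r < length (rel_arities T)" "ys \<in> set (all_tuples n (rel_arities T ! r))" for r ys
    using that target_tables(2)[OF X n] by (simp add: set_all_tuples)
  have "length (operations ?Y) = length (op_arities T)" "length (relations ?Y) = length (rel_arities T)"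
    "universe ?Y = {..<n}"
    by (simp_all add: target_def n)
  then have "encode_structure T ?Y = encode_nat n @
     concat (map (\<lambda>j. concat (map (\<lambda>xs. encode_nat ((operations ?Y ! j) xs)) (all_tuples n (op_arities T ! j))))
       [0..<length (op_arities T)]) @
     concat (map (\<lambda>r. map (\<lambda>ys. ys \<in> relations ?Y ! r) (all_tuples n (rel_arities T ! r))) [0..<length (rel_arities T)])"
    by (simp add: encode_structure_def concat_map_zip encode_operation_def encode_relation_def)
  then show ?thesis
    unfolding target_code_def
    by (simp only:) (intro arg_cong2[where f = append] arg_cong[where f = concat] map_cong refl op rel; simp)
qed

text \<open>The congruence table corresponds to no part of the input; giving it the empty code lets
  one loading lemma treat all tables alike.\<close>

definition input_code :: "nat \<Rightarrow> nat \<Rightarrow> nat struct \<Rightarrow> bool list" where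
  "input_code t n X =
     (if t < length (op_arities S) then encode_operation n (op_arities S ! t, operations X ! t)
      else if t < eq_table then encode_relation n (rel_arities S ! (t - length (op_arities S)),
        relations X ! (t - length (op_arities S)))
      else [])"

lemma encode_structure_input_code:
  assumes "is_structure S X" "universe X = {..<n}"
  shows "encode_structure S X = encode_nat n @ concat (map (\<lambda>t. input_code t n X) [0..<length table_arities])"
proof -
  let ?p = "length (op_arities S)" and ?q = "length (rel_arities S)"
  have len: "length (operations X) = ?p" "length (relations X) = ?q"
    using assms(1) by (simp_all add: is_structure_def)
  have "length table_arities = ?p + ?q + 1"
    by (simp add: table_arities_def)
  then have "[0..<length table_arities] = [0..<?p] @ map (\<lambda>i. i + ?p) [0..<?q] @ [eq_table]"
    by (simp add: upt_add_eq_append[of 0 ?p] map_add_upt eq_table_def add.commute)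
  then have "concat (map (\<lambda>t. input_code t n X) [0..<length table_arities]) =
      concat (map (\<lambda>t. input_code t n X) [0..<?p]) @ concat (map (\<lambda>i. input_code (i + ?p) n X) [0..<?q]) @
      input_code eq_table n X"
    by (simp add: o_def)
  also have "input_code eq_table n X = []"
    by (simp add: input_code_def eq_table_def)
  also have "map (\<lambda>t. input_code t n X) [0..<?p] =
      map (\<lambda>t. encode_operation n (op_arities S ! t, operations X ! t)) [0..<?p]"
    by (rule map_cong[OF refl]) (simp add: input_code_def)
  also have "map (\<lambda>i. input_code (i + ?p) n X) [0..<?q] =
      map (\<lambda>i. encode_relation n (rel_arities S ! i, relations X ! i)) [0..<?q]"
    by (rule map_cong[OF refl]) (simp add: input_code_def eq_table_def)
  finally show ?thesis
    using len assms(2) by (simp add: encode_structure_def concat_map_zip)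
qed

lemma loads_tables:
  assumes t: "t < length table_arities"
  shows "loads t (\<lambda>n X. is_structure S X \<and> universe X = {..<n}) (input_code t)
    (\<lambda>n X. map (\<lambda>xs. xs \<in> tables n X t) (all_tuples n (table_arities ! t)))"
proof -
  let ?p = "length (op_arities S)"
  consider (op) "t < ?p" | (rel) "\<not> t < ?p" "t < eq_table" | (eq) "t = eq_table" "\<not> t < ?p"
    using t by (fastforce simp: table_arities_def eq_table_def)
  then show ?thesis
  proof cases
    case op
    let ?k = "op_arities S ! t"
    obtain f where f1: "realizable input_tapes f" and f2: "\<forall>s n pre g rest.
    (\<forall>j < ?k + 2. s (cn j) = (replicate n True, 0)) \<longrightarrow> (\<forall>xs\<in>tuples {..<n} ?k. g xs < n) \<longrightarrow>
    s (3 + t) = ([], 0) \<longrightarrow>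
    s 1 = (pre @ concat (map (\<lambda>xs. encode_nat (g xs)) (all_tuples n ?k)) @ rest, length pre) \<longrightarrow>
    f s = s(1 := (fst (s 1), length (pre @ concat (map (\<lambda>xs. encode_nat (g xs)) (all_tuples n ?k)))),
      3 + t := full (concat (map (\<lambda>xs. map (\<lambda>y. g xs = y) [0..<n]) (all_tuples n ?k))))"
      using load_operation[OF t, of ?k] by (elim exE conjE)
    have sem: "f s = s(1 := (pre @ input_code t n X @ rest, length (pre @ input_code t n X)),
        3 + t := full (map (\<lambda>xs. xs \<in> tables n X t) (all_tuples n (table_arities ! t))))"
      if cnt: "\<forall>j < ?k + 2. s (cn j) = (replicate n True, 0)" and C: "is_structure S X \<and> universe X = {..<n}"
        and tab: "s (3 + t) = ([], 0)" and inp: "s 1 = (pre @ input_code t n X @ rest, length pre)"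
      for s n X pre rest
    proof -
      let ?g = "operations X ! t"
      have code: "input_code t n X = concat (map (\<lambda>xs. encode_nat (?g xs)) (all_tuples n ?k))"
        using op by (simp add: input_code_def encode_operation_def)
      have g: "?g xs < n" if "xs \<in> tuples {..<n} ?k" for xs
        using structure_op[of S X t xs] C op that by simp
      have "map (\<lambda>xs. xs \<in> tables n X t) (all_tuples n (table_arities ! t)) =
          concat (map (\<lambda>xs. map (\<lambda>y. xs @ [y] \<in> tables n X t) [0..<n]) (all_tuples n ?k))"
        using op by (simp add: table_arity all_tuples_snoc map_concat o_def)
      also have "\<dots> = concat (map (\<lambda>xs. map (\<lambda>y. ?g xs = y) [0..<n]) (all_tuples n ?k))"
        using op by (intro arg_cong[where f = concat] map_cong refl) (auto simp: tables_def set_all_tuples)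
      finally have tb: "map (\<lambda>xs. xs \<in> tables n X t) (all_tuples n (table_arities ! t)) =
          concat (map (\<lambda>xs. map (\<lambda>y. ?g xs = y) [0..<n]) (all_tuples n ?k))" .
      have "f s = s(1 := (fst (s 1), length (pre @ concat (map (\<lambda>xs. encode_nat (?g xs)) (all_tuples n ?k)))),
        3 + t := full (concat (map (\<lambda>xs. map (\<lambda>y. ?g xs = y) [0..<n]) (all_tuples n ?k))))"
        by (rule f2[rule_format]) (use cnt tab inp g in \<open>simp_all only: code\<close>)
      then show ?thesis
        unfolding tb code using inp by (simp add: code)
    qed
    show ?thesis
      unfolding loads_def by (rule exI[of _ f], rule exI[of _ "?k + 2"]) (use f1 sem in blast)
  next
    case rel
    define i where "i = t - ?p"
    let ?k = "rel_arities S ! i"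
    have i: "i < length (rel_arities S)" "t = ?p + i"
      using rel by (auto simp: i_def eq_table_def)
    have ar: "table_arities ! t = ?k"
      unfolding i(2) by (rule table_arity(2)[OF i(1)])
    obtain f where f1: "realizable input_tapes f" and f2: "\<forall>s n pre Q rest.
    (\<forall>j < ?k. s (cn j) = (replicate n True, 0)) \<longrightarrow> s (3 + t) = ([], 0) \<longrightarrow>
    s 1 = (pre @ map Q (all_tuples n ?k) @ rest, length pre) \<longrightarrow>
    f s = s(1 := (fst (s 1), length (pre @ map Q (all_tuples n ?k))), 3 + t := full (map Q (all_tuples n ?k)))"
      using load_relation[OF t, of ?k] by (elim exE conjE)
    have sem: "f s = s(1 := (pre @ input_code t n X @ rest, length (pre @ input_code t n X)),
        3 + t := full (map (\<lambda>xs. xs \<in> tables n X t) (all_tuples n (table_arities ! t))))"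
      if cnt: "\<forall>j < ?k. s (cn j) = (replicate n True, 0)"
        and tab: "s (3 + t) = ([], 0)" and inp: "s 1 = (pre @ input_code t n X @ rest, length pre)"
      for s n X pre rest
    proof -
      let ?Q = "\<lambda>xs. xs \<in> tables n X t"
      have code: "input_code t n X = map ?Q (all_tuples n ?k)"
        using rel by (simp add: input_code_def encode_relation_def tables_def i_def)
      have "f s = s(1 := (fst (s 1), length (pre @ map ?Q (all_tuples n ?k))), 3 + t := full (map ?Q (all_tuples n ?k)))"
        by (rule f2[rule_format]) (use cnt tab inp in \<open>simp_all only: code\<close>)
      then show ?thesis
        unfolding ar code using inp by (simp add: code)
    qed
    show ?thesis
      unfolding loads_def by (rule exI[of _ f], rule exI[of _ ?k]) (use f1 sem in blast)
  next
    case eq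
    obtain f where f1: "realizable input_tapes f" and f2: "\<forall>s n.
    (\<forall>j < 2. s (cn j) = (replicate n True, 0)) \<longrightarrow> s (3 + t) = ([], 0) \<longrightarrow>
    f s = s(3 + t := full (map (\<lambda>_. False) (all_tuples n 2)))"
      using load_empty[OF t, of 2] by (elim exE conjE)
    have sem: "f s = s(1 := (pre @ input_code t n X @ rest, length (pre @ input_code t n X)),
        3 + t := full (map (\<lambda>xs. xs \<in> tables n X t) (all_tuples n (table_arities ! t))))"
      if cnt: "\<forall>j < 2. s (cn j) = (replicate n True, 0)"
        and tab: "s (3 + t) = ([], 0)" and inp: "s 1 = (pre @ input_code t n X @ rest, length pre)"
      for s n X pre rest
    proof -
      have code: "input_code t n X = []" "tables n X t = {}" "table_arities ! t = 2"
        using eq by (simp_all add: input_code_def tables_def table_arity)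
      have "f s = s(3 + t := full (map (\<lambda>_. False) (all_tuples n 2)))"
        by (rule f2[rule_format]) (use cnt tab in auto)
      then show ?thesis
        unfolding code using inp by (simp add: code fun_upd_idem)
    qed
    show ?thesis
      unfolding loads_def by (rule exI[of _ f], rule exI[of _ 2]) (use f1 sem in blast)
  qed
qed

text \<open>Loading, saturating and writing keep different tapes constant, so they are joined as
  feasible programs. The time bound holds on every word because it holds on every well-formed
  memory; the output is analysed for encodings of instances only, and the input format is not
  checked.\<close>

lemma csp_reducible: "polytime_reducible (CSP S A) (CSP T B)"
proof -
  let ?e = eq_table
  obtain f K where f1: "realizable (- {0}) f" and f2: "\<forall>s n I. good K n I [] s \<longrightarrow>
    (\<exists>b. f s = s(2 := ([b], 0), 3 + ?e := tab n ?e (saturate (\<lambda>E. step_formula n (I(?e := E))) n (I ?e))))"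
    using realizable_saturate[OF table_arity(5,3) testable_step] by (elim exE conjE)
  obtain g L where g: "realizable (- {0}) g" "\<And>s n I w. good L n I [] s \<Longrightarrow>
      \<forall>j < length (op_arities T). \<forall>xs\<in>tuples {..<n} (op_arities T ! j). \<exists>y<n. op_formula j n I xs y \<Longrightarrow>
      s 0 = full w \<Longrightarrow> \<exists>b. g s = s(2 := ([b], 0), 0 := full (w @ target_code n I))"
    using emitsE[OF emits_target_code] by blast
  have "\<exists>l. feasible l \<and> (\<forall>n X rest. is_structure S X \<and> universe X = {..<n} \<longrightarrow>
    good (max K L) n (tables n X) [] (l (start_mem (encode_nat n @ concat (map (\<lambda>t. input_code t n X) [0..<length table_arities]) @ rest))) \<and>
    l (start_mem (encode_nat n @ concat (map (\<lambda>t. input_code t n X) [0..<length table_arities]) @ rest)) 0 = ([], 0))"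
    by (rule feasible_load, rule loads_tables)
  then obtain l where l1: "feasible l" and l2: "\<forall>n X rest. is_structure S X \<and> universe X = {..<n} \<longrightarrow>
    good (max K L) n (tables n X) [] (l (start_mem (encode_nat n @ concat (map (\<lambda>t. input_code t n X) [0..<length table_arities]) @ rest))) \<and>
    l (start_mem (encode_nat n @ concat (map (\<lambda>t. input_code t n X) [0..<length table_arities]) @ rest)) 0 = ([], 0)"
    by (elim exE conjE)
  let ?h = "\<lambda>s. g (f (l s))" and ?r = "\<lambda>w. fst (g (f (l (start_mem w))) 0)"
  have "feasible ?h"
    by (rule feasible_comp[OF feasible_comp[OF l1 realizable_feasible[OF f1]] realizable_feasible[OF g(1)]])
  from feasible_polytime[OF this] have poly: "polytime_computable ?r"
    unfolding start_mem_def .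
  have red: "?r (encode_structure S X) = encode_structure T (target X (related n X))"
    if X: "is_structure S X" and n: "universe X = {..<n}" for X n
  proof -
    let ?s = "l (start_mem (encode_structure S X))"
    have s: "good (max K L) n (tables n X) [] ?s" "?s 0 = ([], 0)"
      using l2[rule_format, of X n "[]"] X n encode_structure_input_code[OF X n] by simp_all
    have e: "tables n X ?e = {}"
      by (simp add: tables_def eq_table_def)
    obtain b where fs: "f ?s = ?s(2 := ([b], 0), 3 + ?e := tab n ?e (eq_closure n X))"
      using f2[rule_format, OF good_mono[OF s(1)]] unfolding eq_closure_def e by auto
    have good: "good L n (closed_tables n X) [] (f ?s)"
      unfolding fs closed_tables_def by (intro good_table good_flag good_mono[OF s(1)]) (simp_all add: table_arity)
    \<comment> \<open>By reflexivity of the congruence the term value itself is a witness; this is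
      the precondition inherited from \<open>emits_numbers\<close>.\<close>
    have ex: "\<forall>j < length (op_arities T). \<forall>xs\<in>tuples {..<n} (op_arities T ! j). \<exists>y<n. op_formula j n (closed_tables n X) xs y"
    proof (intro allI impI ballI)
      fix j xs assume j: "j < length (op_arities T)" "xs \<in> tuples {..<n} (op_arities T ! j)"
      have t: "term_eval (operations X) xs (tt j) < n"
        using term_eval_closed[OF X tt_wf[OF j(1)], of xs] j(2) n by simp
      have "related n X (term_eval (operations X) xs (tt j)) (term_eval (operations X) xs (tt j))"
        by (rule related_props(2)[OF X n t t]) (simp add: step_def)
      then show "\<exists>y<n. op_formula j n (closed_tables n X) xs y"
        using target_tables(1)[OF X n j] t by blast
    qed
    have "f ?s 0 = full []"
      by (simp add: fs s full_def)
    from g(2)[OF good ex this] obtain b' where "g (f ?s) = (f ?s)(2 := ([b'], 0), 0 := full ([] @ target_code n (closed_tables n X)))"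
      by blast
    then show ?thesis
      by (simp add: full_def target_code_closed_tables[OF X n])
  qed
  have "?r w \<in> instances (CSP T B) \<and> (w \<in> yes_instances (CSP S A) \<longleftrightarrow> ?r w \<in> yes_instances (CSP T B))"
    if w: "w \<in> instances (CSP S A)" for w
  proof -
    obtain X where X: "X \<in> finite_structures S" "w = encode_structure S X"
      using w by (auto simp: CSP_def)
    then obtain n where sX: "is_structure S X" and n: "universe X = {..<n}"
      by (auto simp: finite_structures_def)
    let ?Y = "target X (related n X)"
    have closed: "related n X x y" if "x \<in> universe X" "y \<in> universe X" "step X (related n X) x y" for x y
      using that related_props(2)[OF sX n] by (simp add: n)
    have bound: "x \<in> universe X \<and> y \<in> universe X" if "related n X x y" for x y
      using related_props(1)[OF sX n that] by (simp add: n)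
    have Y: "?Y \<in> finite_structures T"
      by (rule target_correct(1)[OF X(1)], erule (2) closed, erule bound, erule (1) related_props(3)[OF sX n])
    have hom: "(\<exists>h. is_hom S X A h) \<longleftrightarrow> (\<exists>h. is_hom T ?Y B h)"
      by (rule target_correct(2)[OF X(1)], erule (2) closed, erule bound, erule (1) related_props(3)[OF sX n])
    have rw: "?r w = encode_structure T ?Y"
      unfolding X(2) by (rule red[OF sX n])
    \<comment> \<open>Membership only provides some structure with the same code and a homomorphism;
      \<open>encode_structure_hom\<close> transfers the homomorphism to the structure at
      hand.\<close>
    have yes: "encode_structure U Z \<in> yes_instances (CSP U D) \<longleftrightarrow> (\<exists>h. is_hom U Z D h)"
      if "Z \<in> finite_structures U" for U Z and D :: "'a struct"
      using that encode_structure_hom[of _ U Z D] by (auto simp: CSP_def) metis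
    show ?thesis
      unfolding rw yes[OF Y] unfolding X(2) yes[OF X(1)] using Y hom by (auto simp: CSP_def)
  qed
  then show ?thesis
    unfolding polytime_reducible_def using poly by blast
qed

end

theorem theorem1:
  fixes S T :: signature and A B :: "'a struct"
  assumes "is_structure S A" and "is_structure T B"
    and "finite (universe A)" and "universe A = universe B"
    and "clone (universe A) (basic_operations S A) = clone (universe B) (basic_operations T B)"
    and "partial_polymorphisms (universe A) (basic_relations S A) =
         partial_polymorphisms (universe B) (basic_relations T B)"
  shows "polytime_equivalent (CSP S A) (CSP T B)"
proof -
  have "polytime_reducible (CSP S A) (CSP T B)"
    using csp_translation_exists[OF assms] csp_translation.csp_reducible by blast
  moreover have "polytime_reducible (CSP T B) (CSP S A)"
    using csp_translation_exists[of T B S A] csp_translation.csp_reducible assms by metis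
  ultimately show ?thesis
    by (simp add: polytime_equivalent_def)
qed

end
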